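(* Let $F$ be a function in the Selberg class $\mathcal{S}$, with a fixed functional equation datum $Q_F>0$, $\lambda_1,\dots,\lambda_r>0$, $\mu_1,\dots,\mu_r\in\mathbb{C}$ (with $\Re\mu_j\ge 0$), $|\omega|=1$ as described in the context. Assume the Generalized Riemann Hypothesis for $F$, i.e. all non-trivial zeros of $F$ lie on the line $\Re(s)=\tfrac12$. Then, as $n\to\infty$, $$\lambda_F(n) = \frac{d_F}{2}\, n\log n + c_F\, n + O(\sqrt{n}\,\log n),$$ where $$c_F = \frac{d_F}{2}(\gamma-1) + \frac12 \log\bigl(\lambda Q_F^2\bigr),\qquad \lambda=\prod_{j=1}^r \lambda_j^{2\lambda_j},$$ and $\gamma$ is the Euler constant.
   Context: The Selberg class $\mathcal{S}$ consists of Dirichlet series $F(s)=\sum_{n\ge1}a(n)n^{-s}$ ($\Re s>1$) such that: (i) there is an integer $m\ge 0$ with $(s-1)^mF(s)$ entire of finite order; $m_F$ denotes the least such $m$; (ii) there are $Q_F>0$, $\lambda_j>0$, $\mu_j\in\mathbb{C}$ with $\Re\mu_j\ge0$ ($1\le j\le r$) and $|\omega|=1$ such that $\phi_F(s)=\omega\overline{\phi_F(1-\bar s)}$, where $\phi_F(s)=F(s)Q_F^s\prod_{j=1}^r\Gamma(\lambda_j s+\mu_j)$; (iii) $a(n)=O(n^\epsilon)$ for every $\epsilon>0$; (iv) $F(s)=\prod_p\exp\bigl(\sum_{k\ge1}b(p^k)p^{-ks}\bigr)$ with $b(p^k)=O(p^{k\theta})$ for some $\theta<\tfrac12$. The degree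 is $d_F=2\sum_{j=1}^r\lambda_j$. Define $\xi_F(s)=s^{m_F}(s-1)^{m_F}\phi_F(s)$, an entire function of order 1 whose zeros $\rho$ are the non-trivial zeros of $F$. The (generalized) Li coefficients are $$\lambda_F(n)=\sum_{\rho}\Bigl[1-\Bigl(1-\frac1\rho\Bigr)^{-n}\Bigr],\qquad n\in\mathbb{Z},$$ where the sum is over the zeros $\rho$ of $\xi_F$ counted with multiplicity, interpreted as $\lim_{T\to\infty}\sum_{|\Im\rho|\le T}$. *)

theory Defs
  imports "HOL-Complex_Analysis.Complex_Analysis" "HOL-Library.Landau_Symbols"
begin

text \<open>Functional equation data: Q>0, lambda_j>0, mu_j with Re mu_j \<ge> 0 (j = 1..r), |omega| = 1.
  F :: complex \<Rightarrow> complex is the (meromorphic continuation of the) Dirichlet series with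
  coefficients a; its value at s = 1 is irrelevant.\<close>

definition entire_finite_order :: "(complex \<Rightarrow> complex) \<Rightarrow> bool" where
  "entire_finite_order G \<longleftrightarrow> G holomorphic_on UNIV \<and>
     (\<exists>\<rho> C. \<forall>z. norm (G z) \<le> C * exp (norm z powr \<rho>))"

definition pole_order_ok :: "(complex \<Rightarrow> complex) \<Rightarrow> nat \<Rightarrow> bool" where
  "pole_order_ok F m \<longleftrightarrow> (\<exists>G. entire_finite_order G \<and> (\<forall>s. s \<noteq> 1 \<longrightarrow> G s = (s - 1) ^ m * F s))"

definition m_F :: "(complex \<Rightarrow> complex) \<Rightarrow> nat" where
  "m_F F = (LEAST m. pole_order_ok F m)"

definition phi_F :: "(complex \<Rightarrow> complex) \<Rightarrow> real \<Rightarrow> nat \<Rightarrow> (nat \<Rightarrow> real) \<Rightarrow> (nat \<Rightarrow> complex)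
    \<Rightarrow> complex \<Rightarrow> complex" where
  "phi_F F Q r lam mu s = F s * of_real Q powr s * (\<Prod>j\<in>{1..r}. Gamma (of_real (lam j) * s + mu j))"

definition selberg_class :: "(nat \<Rightarrow> complex) \<Rightarrow> (complex \<Rightarrow> complex) \<Rightarrow> real \<Rightarrow> nat \<Rightarrow>
    (nat \<Rightarrow> real) \<Rightarrow> (nat \<Rightarrow> complex) \<Rightarrow> complex \<Rightarrow> bool" where
  "selberg_class a F Q r lam mu \<omega> \<longleftrightarrow>
     \<comment> \<open>Dirichlet series representation in Re s > 1\<close>
     (\<forall>s. Re s > 1 \<longrightarrow> (\<lambda>n. a n / of_nat n powr s) sums F s) \<and>
     \<comment> \<open>(i)\<close>
     (\<exists>m. pole_order_ok F m) \<and>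
     \<comment> \<open>(ii)\<close>
     Q > 0 \<and> (\<forall>j\<in>{1..r}. lam j > 0 \<and> Re (mu j) \<ge> 0) \<and> norm \<omega> = 1 \<and>
     (\<forall>s. s \<noteq> 0 \<and> s \<noteq> 1 \<and>
          (\<forall>j\<in>{1..r}. of_real (lam j) * s + mu j \<notin> \<int>\<^sub>\<le>\<^sub>0 \<and>
                       of_real (lam j) * (1 - cnj s) + mu j \<notin> \<int>\<^sub>\<le>\<^sub>0) \<longrightarrow>
          phi_F F Q r lam mu s = \<omega> * cnj (phi_F F Q r lam mu (1 - cnj s))) \<and>
     \<comment> \<open>(iii)\<close>
     (\<forall>\<epsilon>>0. a \<in> O(\<lambda>n. of_real (real n powr \<epsilon>))) \<and>
     \<comment> \<open>(iv) Euler product\<close>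
     (\<exists>b :: nat \<Rightarrow> complex. \<exists>\<theta> < 1/2. \<exists>C.
        (\<forall>p k. prime p \<and> k \<ge> 1 \<longrightarrow> norm (b (p ^ k)) \<le> C * real p powr (real k * \<theta>)) \<and>
        (\<forall>s. Re s > 1 \<longrightarrow>
           (\<lambda>N. \<Prod>p\<in>{p. prime p \<and> p \<le> N}.
                 exp (\<Sum>k. b (p ^ Suc k) / of_nat (p ^ Suc k) powr s)) \<longlonglongrightarrow> F s))"

definition degree_F :: "nat \<Rightarrow> (nat \<Rightarrow> real) \<Rightarrow> real" where
  "degree_F r lam = 2 * (\<Sum>j\<in>{1..r}. lam j)"

text \<open>xi_F(s) = s^m (s-1)^m phi_F(s), taken as its (entire) continuation: the value at each
  point is the limit of the defining expression.\<close>
definition xi_F :: "(complex \<Rightarrow> complex) \<Rightarrow> real \<Rightarrow> nat \<Rightarrow> (nat \<Rightarrow> real) \<Rightarrow> (nat \<Rightarrow> complex)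
    \<Rightarrow> complex \<Rightarrow> complex" where
  "xi_F F Q r lam mu s = Lim (at s) (\<lambda>z. z ^ m_F F * (z - 1) ^ m_F F * phi_F F Q r lam mu z)"

definition li_partial :: "(complex \<Rightarrow> complex) \<Rightarrow> int \<Rightarrow> real \<Rightarrow> complex" where
  "li_partial xi n T = (\<Sum>\<rho>\<in>{\<rho>. xi \<rho> = 0 \<and> \<bar>Im \<rho>\<bar> \<le> T}.
      of_int (zorder xi \<rho>) * (1 - (1 - 1 / \<rho>) powi (- n)))"

end

theory Submission
  imports Defs "HOL-Real_Asymp.Real_Asymp"
begin

text \<open>
  Under the Riemann hypothesis the logarithm of the completed function \<open>\<xi>\<close> exists on
  \<open>Re s > 1/2\<close>, and by the functional equation its phase on the critical line is
  constant between zeros and jumps by \<open>\<pi>\<close> at each zero. Stirling's formula for the Gamma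
  factors, together with the bound \<open>O(log T)\<close> for the argument of \<open>F\<close> (which comes from
  Phragmen-Lindelof, the removal of the \<open>O(log T)\<close> zeros near height \<open>T\<close>, and
  Borel-Caratheodory), therefore counts the zeros up to an error \<open>O(log T)\<close>. On the critical
  line \<open>w = 1 - 1/\<rho>\<close> has modulus one, so the summands \<open>1 - w\<^sup>-\<^sup>n\<close> are bounded by
  2 and have derivative \<open>O(n/t\<^sup>2)\<close> in \<open>t = Im \<rho>\<close>; partial summation split at height
  \<open>\<surd>n\<close> turns the sum over zeros into an integral against the smooth density with error
  \<open>O(\<surd>n log n)\<close>. That integral is evaluated exactly with the Fejer kernel and produces
  the harmonic number \<open>n H\<^sub>n - n\<close>, whence the main terms.
\<close>

section \<open>Stirling asymptotics for the complex logarithm of Gamma\<close>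

text \<open>The sum over zeros need not converge absolutely: a summand is only known to be O(n/t),
  while the zeros have density of order log t. The zeros above and below the real axis are therefore
  each compared with an integral over heights. On each side only the difference of sum and integral
  is shown to converge; the integrals converge once added, because their imaginary parts cancel. No
  symmetry of the zeros under conjugation is available, as the coefficients may be complex, so both
  sides are counted separately; the smooth count \<open>Psi t / pi\<close> is nevertheless the same,
  because \<open>Psi\<close> is odd. A cut at height U costs O(U log U) below it, where summands are
  bounded by 2, and O((n/U) log U) above it; U = sqrt n balances the two. The smooth phase is
  written with s Ln s - s at s = 1/2 + it rather than with t log t - t, since its derivative is
  exactly ln |s|, for which the integral has a closed form. The hypothesis concerns
  \<open>xi_F\<close>, a pointwise limit, whereas the argument needs one entire function; hence xi
  is rebuilt by gluing a formula on a right half-plane to its reflection.\<close>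

abbreviation crit :: "real \<Rightarrow> complex" where
  "crit t \<equiv> Complex (1/2) t"

lemma vertical_line_deriv: "((\<lambda>t. Complex x t) has_vector_derivative \<i>) (at t within S)"
  unfolding has_vector_derivative_complex_iff by (auto intro!: derivative_eq_intros)

lemma isCont_vertical_line: "isCont (\<lambda>t. Complex x t) t"
  using vertical_line_deriv[of x t UNIV] by (rule has_vector_derivative_continuous)

lemma Re_pos_not_nonpos:
  fixes z :: complex
  assumes "Re z > 0"
  shows "z \<noteq> 0" "z \<notin> \<real>\<^sub>\<le>\<^sub>0" "z \<notin> \<int>\<^sub>\<le>\<^sub>0"
proof -
  show "z \<noteq> 0" using assms by auto
  show 1: "z \<notin> \<real>\<^sub>\<le>\<^sub>0" using assms by (auto simp: complex_nonpos_Reals_iff)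
  show "z \<notin> \<int>\<^sub>\<le>\<^sub>0" using 1 nonpos_Ints_subset_nonpos_Reals by blast
qed

text \<open>The derivative of \<open>Ln (w + x) - x / w\<close> in x is - x / (w (w + x)), and
  moving right from w in the right half-plane does not decrease the modulus, so the mean value
  inequality on the unit segment gives 1 / |w|^2. These are the terms whose sum is Digamma -
  Ln.\<close>

lemma Ln_Suc_minus_Ln_bound:
  assumes "Re w > 0"
  shows "norm (Ln (w + 1) - Ln w - 1 / w) \<le> 1 / norm w ^ 2"
proof -
  define f where "f = (\<lambda>x. Ln (w + x) - x / w)"
  have pos: "Re (w + x) > 0" "w + x \<noteq> 0" "w + x \<notin> \<real>\<^sub>\<le>\<^sub>0" "norm w \<le> norm (w + x)"
    if "x \<in> closed_segment 0 1" for x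
  proof -
    from that obtain u where u: "0 \<le> u" "x = of_real u"
      by (auto simp: closed_segment_def scaleR_conv_of_real)
    show 1: "Re (w + x) > 0" using assms u by simp
    then show "w + x \<noteq> 0" "w + x \<notin> \<real>\<^sub>\<le>\<^sub>0"
      by (metis less_irrefl zero_complex.simps(1), auto simp: complex_nonpos_Reals_iff)
    show "norm w \<le> norm (w + x)"
      unfolding cmod_def using assms u by (intro real_sqrt_le_mono) (auto intro!: power_mono)
  qed
  have w: "w \<noteq> 0" using assms by auto
  have "norm (f 1 - f 0) \<le> 1 / norm w ^ 2 * norm (1 - 0 :: complex)"
  proof (rule field_differentiable_bound[of "closed_segment 0 1"])
    fix x :: complex assume x: "x \<in> closed_segment 0 1"
    show "(f has_field_derivative (1 / (w + x) - 1 / w)) (at x within closed_segment 0 1)"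
      unfolding f_def using pos[OF x] w
      by (auto intro!: derivative_eq_intros simp: divide_inverse)
    obtain u where u: "0 \<le> u" "u \<le> 1" "x = of_real u"
      using x by (auto simp: closed_segment_def scaleR_conv_of_real)
    have "1 / (w + x) - 1 / w = - x / (w * (w + x))"
      using pos[OF x] w by (simp add: field_simps)
    then have "norm (1 / (w + x) - 1 / w) = u / (norm w * norm (w + x))"
      using u by (simp add: norm_divide norm_mult)
    also have "\<dots> \<le> 1 / (norm w * norm w)"
      using u pos[OF x] w by (intro frac_le mult_mono) auto
    finally show "norm (1 / (w + x) - 1 / w) \<le> 1 / norm w ^ 2" by (simp add: power2_eq_square)
  qed (auto)
  then show ?thesis by (simp add: f_def algebra_simps)
qed

text \<open>Digamma is the limit of ln m minus the sum of 1 / (z + k). Telescoping Ln over unit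
  steps turns Digamma - Ln into the series of one-step errors \<open>e\<close>, which is dominated
  by a telescoping series.\<close>

lemma Digamma_minus_Ln_bound:
  assumes "Re z > 0"
  shows "norm (Digamma z - Ln z) \<le> 2 / norm z ^ 2 + 2 / norm z"
proof -
  have z: "z \<noteq> 0" using assms by auto
  define x where "x = norm z"
  have x: "x > 0" using z by (simp add: x_def)
  define e where "e = (\<lambda>k. Ln (z + of_nat k + 1) - Ln (z + of_nat k) - 1 / (z + of_nat k))"
  have sum_e: "(\<Sum>k<m. e k) = Ln (z + of_nat m) - Ln z - (\<Sum>k<m. inverse (z + of_nat k))" for m
    by (induction m) (auto simp: e_def field_simps)
  have norm_ge: "x ^ 2 + real k ^ 2 \<le> norm (z + of_nat k) ^ 2" for k
    unfolding x_def cmod_power2 using assms by (simp add: power2_eq_square algebra_simps)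
  have e_bound: "norm (e k) \<le> 2 / (x + real k) ^ 2" for k
  proof -
    have "norm (e k) \<le> 1 / norm (z + of_nat k) ^ 2"
      unfolding e_def using assms by (intro Ln_Suc_minus_Ln_bound) simp
    \<comment> \<open>As Re z > 0, |z + k|^2 is at least x^2 + k^2, hence at least half of (x +
      k)^2; the latter form telescopes.\<close>
    also have "\<dots> \<le> 1 / ((x + real k) ^ 2 / 2)"
    proof (rule divide_left_mono)
      have "(x + real k) ^ 2 / 2 \<le> x ^ 2 + real k ^ 2"
        using sum_squares_bound[of x "real k"] by (simp add: power2_sum)
      then show "(x + real k) ^ 2 / 2 \<le> norm (z + of_nat k) ^ 2" using norm_ge[of k] by linarith
      then show "0 < norm (z + of_nat k) ^ 2 * ((x + real k) ^ 2 / 2)"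
        using x by (smt (verit) divide_pos_pos mult_pos_pos of_nat_0_le_iff zero_less_power)
    qed auto
    finally show ?thesis by simp
  qed
  \<comment> \<open>The term 2 / x^2 for k = 0 is kept aside; every later term is at most 2 / (x + k
    - 1) - 2 / (x + k).\<close>
  have sum_bound: "(\<Sum>k<Suc m. 2 / (x + real k) ^ 2) \<le> 2 / x ^ 2 + 2 / x - 2 / (x + real m)" for m
  proof (induction m)
    case (Suc m)
    have "2 / (x + real (Suc m)) ^ 2 \<le> 2 / (x + real m) - 2 / (x + real (Suc m))"
    proof -
      have "2 / (x + real m) - 2 / (x + real (Suc m)) = 2 / ((x + real m) * (x + real (Suc m)))"
        using x by (simp add: field_simps)
      moreover have "2 / (x + real (Suc m)) ^ 2 \<le> 2 / ((x + real m) * (x + real (Suc m)))"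
        unfolding power2_eq_square using x by (intro divide_left_mono mult_mono) auto
      ultimately show ?thesis by simp
    qed
    then show ?case using Suc by simp
  qed auto
  have bound: "norm (\<Sum>k<m. e k) \<le> 2 / x ^ 2 + 2 / x" for m
  proof -
    have "norm (\<Sum>k<m. e k) \<le> (\<Sum>k<m. 2 / (x + real k) ^ 2)"
      by (intro sum_norm_le e_bound)
    also have "\<dots> \<le> (\<Sum>k<Suc m. 2 / (x + real k) ^ 2)" by simp
    also have "\<dots> \<le> 2 / x ^ 2 + 2 / x - 2 / (x + real m)" by (rule sum_bound)
    also have "\<dots> \<le> 2 / x ^ 2 + 2 / x" using x by simp
    finally show ?thesis .
  qed
  \<comment> \<open>\<open>Digamma_LIMSEQ\<close> involves ln m, while the telescoped sum ends in Ln
    (z + m); their difference is Ln (1 + z / m), which tends to 0.\<close>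
  have "(\<lambda>m. z / of_nat m) \<longlonglongrightarrow> 0"
    by (rule lim_const_over_n)
  then have "(\<lambda>m. Ln (1 + z / of_nat m)) \<longlonglongrightarrow> Ln (1 + 0)"
    by (intro tendsto_intros) (auto simp: complex_nonpos_Reals_iff)
  moreover have "eventually (\<lambda>m. Ln (1 + z / of_nat m) = Ln (z + of_nat m) - of_real (ln (real m))) sequentially"
    using eventually_gt_at_top[of 0]
  proof eventually_elim
    case (elim m)
    have "Ln (z + of_nat m) = Ln (of_real (real m) * (1 + z / of_nat m))"
      using elim by (simp add: distrib_left add.commute)
    also have "\<dots> = of_real (ln (real m)) + Ln (1 + z / of_nat m)"
    proof -
      have "Ln (of_real (real m) * (1 + z / of_nat m)) = Ln (of_real (real m)) + Ln (1 + z / of_nat m)"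
        if "1 + z / of_nat m \<noteq> 0"
        using elim that by (intro Ln_times_of_real[of "real m"]) auto
      moreover have "Ln (of_real (real m)) = of_real (ln (real m))"
        using elim by (intro Ln_of_real) simp
      moreover
      have "Re (1 + z / of_nat m) > 0"
        using elim assms by (simp add: Re_divide_of_nat add_pos_pos)
      then have "1 + z / of_nat m \<noteq> 0" by (rule Re_pos_not_nonpos)
      ultimately show ?thesis by simp
    qed
    finally show ?case by simp
  qed
  ultimately have "(\<lambda>m. Ln (z + of_nat m) - of_real (ln (real m))) \<longlonglongrightarrow> 0"
    by (simp add: tendsto_cong)
  from tendsto_add[OF Digamma_LIMSEQ[OF z] this]
  have "(\<lambda>m. (\<Sum>k<m. e k) + Ln z) \<longlonglongrightarrow> Digamma z"
    by (simp add: sum_e algebra_simps)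
  from tendsto_diff[OF this tendsto_const[of "Ln z"]]
  have "(\<lambda>m. \<Sum>k<m. e k) \<longlonglongrightarrow> Digamma z - Ln z" by simp
  then have "norm (Digamma z - Ln z) \<le> 2 / x ^ 2 + 2 / x"
    by (rule Lim_norm_ubound[rotated]) (use bound in auto)
  then show ?thesis by (simp add: x_def)
qed

lemma Ln_norm_le:
  assumes "Re z \<ge> 0" "z \<noteq> 0"
  shows "norm (Ln z) \<le> \<bar>ln (norm z)\<bar> + pi / 2"
proof -
  have "norm (Ln z) \<le> \<bar>Re (Ln z)\<bar> + \<bar>Im (Ln z)\<bar>" by (rule cmod_le)
  also have "\<bar>Im (Ln z)\<bar> \<le> pi / 2" using assms Re_Ln_pos_le by blast
  finally show ?thesis using assms by simp
qed

lemma exp_ln_Gamma_complex: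
  fixes z :: complex
  assumes "z \<notin> \<int>\<^sub>\<le>\<^sub>0"
  shows "exp (ln_Gamma z) = Gamma z"
proof -
  have "(\<lambda>n. exp (ln_Gamma_series z n)) \<longlonglongrightarrow> exp (ln_Gamma z)"
    by (intro tendsto_exp ln_Gamma_complex_LIMSEQ assms)
  moreover have "eventually (\<lambda>n. exp (ln_Gamma_series z n) = Gamma_series z n) sequentially"
    using eventually_gt_at_top[of 0] by eventually_elim (rule exp_ln_Gamma_series_complex[OF _ assms])
  ultimately have "(\<lambda>n. Gamma_series z n) \<longlonglongrightarrow> exp (ln_Gamma z)"
    by (simp add: tendsto_cong)
  then show ?thesis using Gamma_series_LIMSEQ[of z] LIMSEQ_unique by blast
qed

lemma ln_bound_of_derivative:
  fixes f :: "real \<Rightarrow> 'a :: real_normed_vector"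
  assumes "\<And>t. t \<ge> 0 \<Longrightarrow> (f has_vector_derivative f' t) (at t)"
    and "\<And>t. t \<ge> 0 \<Longrightarrow> norm (f' t) \<le> K / (1 + t)" and "T \<ge> 0"
  shows "norm (f T - f 0) \<le> K * ln (1 + T)"
proof (cases "T = 0")
  case False
  then have "T > 0" using assms by simp
  have "norm (f T - f 0) \<le> K * ln (1 + T) - K * ln (1 + 0)"
  proof (rule differentiable_bound_general[OF \<open>T > 0\<close>])
    show "continuous_on {0..T} f"
      using assms(1) by (auto intro!: continuous_at_imp_continuous_on has_vector_derivative_continuous)
    show "continuous_on {0..T} (\<lambda>t. K * ln (1 + t))" by (intro continuous_intros) auto
    fix x assume x: "0 < x" "x < T"
    show "(f has_vector_derivative f' x) (at x)" using x by (intro assms) auto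
    show "((\<lambda>t. K * ln (1 + t)) has_vector_derivative K / (1 + x)) (at x)"
      using x by (auto intro!: derivative_eq_intros simp: has_real_derivative_iff_has_vector_derivative[symmetric])
    show "norm (f' x) \<le> K / (1 + x)" using x by (intro assms) auto
  qed
  then show ?thesis by simp
qed simp

text \<open>The derivative of z Ln z - z is Ln z, so along the line the difference has derivative i
  (Digamma - Ln) = O(1 / |z|) and grows at most like log y. The term - Ln z / 2 of Stirling's
  formula is itself O(log y) and stays in the error.\<close>

lemma Stirling_vertical_upper:
  assumes "x > 0"
  shows "\<exists>C. \<forall>y\<ge>0. norm (ln_Gamma (Complex x y) - (Complex x y * Ln (Complex x y) - Complex x y)) \<le> C * ln (y + 2)"
proof -
  define z where "z = (\<lambda>y. Complex x y)"
  define f where "f = (\<lambda>y. ln_Gamma (z y) - (z y * Ln (z y) - z y))"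
  \<comment> \<open>The factor 2 / x + 2 uses |z| >= x to merge the two terms of the Digamma bound;
    the factor 2 + 2 / x comes from 1 + y <= (2 + 2 / x) |z|.\<close>
  define K where "K = (2 / x + 2) * (2 + 2 / x)"
  have "norm (f T - f 0) \<le> K * ln (1 + T)" if T: "T \<ge> 0" for T
  proof (rule ln_bound_of_derivative[OF _ _ T])
    fix y :: real assume y: "y \<ge> 0"
    have Re: "Re (z y) = x" "Re (z y) > 0" using assms by (auto simp: z_def)
    note nz = Re_pos_not_nonpos[OF Re(2)]
    have dz: "(z has_vector_derivative \<i>) (at y)"
      unfolding z_def by (rule vertical_line_deriv)
    have "((\<lambda>w. ln_Gamma w - (w * Ln w - w)) has_field_derivative Digamma (z y) - Ln (z y)) (at (z y))"
      using nz by (auto intro!: derivative_eq_intros)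
    from field_vector_diff_chain_at[OF dz this]
    show "(f has_vector_derivative \<i> * (Digamma (z y) - Ln (z y))) (at y)"
      by (simp add: f_def o_def)
    have nx: "norm (z y) \<ge> x" using abs_Re_le_cmod[of "z y"] assms Re by simp
    have ny: "norm (z y) \<ge> y" using abs_Im_le_cmod[of "z y"] y by (simp add: z_def)
    have "norm (\<i> * (Digamma (z y) - Ln (z y))) \<le> 2 / norm (z y) ^ 2 + 2 / norm (z y)"
      using Digamma_minus_Ln_bound[OF Re(2)] by (simp add: norm_mult)
    also have "\<dots> = (2 / norm (z y) + 2) / norm (z y)"
      using nz by (simp add: field_simps power2_eq_square)
    also have "\<dots> \<le> (2 / x + 2) / norm (z y)"
      using nx assms by (intro divide_right_mono add_mono divide_left_mono) (auto intro!: mult_pos_pos)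
    also have "\<dots> \<le> K / (1 + y)"
    proof -
      have "1 + y \<le> (2 + 2 / x) * norm (z y)"
      proof -
        have "1 \<le> norm (z y) / x" using nx assms by simp
        moreover have "norm (z y) / x \<le> 2 / x * norm (z y)" using assms by (simp add: field_simps)
        ultimately show ?thesis using ny y by (simp add: distrib_right)
      qed
      then have "(2 / x + 2) * (1 + y) \<le> (2 / x + 2) * ((2 + 2 / x) * norm (z y))"
        using assms by (intro mult_left_mono) auto
      then show ?thesis using y nz unfolding K_def
        by (simp add: divide_le_eq pos_le_divide_eq mult.assoc mult.commute mult.left_commute)
    qed
    finally show "norm (\<i> * (Digamma (z y) - Ln (z y))) \<le> K / (1 + y)" .
  qed
  then have *: "norm (f y) \<le> norm (f 0) + K * ln (1 + y)" if "y \<ge> 0" for y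
    using that norm_triangle_sub[of "f y" "f 0"] by fastforce
  \<comment> \<open>The argument y + 2 keeps the logarithm at least ln 2, so the constant
    \<open>norm (f 0)\<close> can be absorbed even at y = 0.\<close>
  have "norm (f y) \<le> (norm (f 0) / ln 2 + K) * ln (y + 2)" if y: "y \<ge> 0" for y
  proof -
    have "norm (f 0) \<le> norm (f 0) / ln 2 * ln (y + 2)"
      using y by (simp add: field_simps mult_left_mono)
    moreover have "K * ln (1 + y) \<le> K * ln (y + 2)"
      using y assms by (intro mult_left_mono) (auto simp: K_def)
    ultimately show ?thesis using *[OF y] by (simp add: distrib_right)
  qed
  then show ?thesis unfolding f_def z_def by blast
qed

text \<open>Conjugation passes through the approximating series term by term, since every logarithm
  in it has its argument in the right half-plane. This transfers Stirling's estimate to the lower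
  half of a vertical line.\<close>

lemma ln_Gamma_cnj:
  assumes "Re z > 0"
  shows "ln_Gamma (cnj z) = cnj (ln_Gamma z)"
proof -
  have nz: "z \<notin> \<int>\<^sub>\<le>\<^sub>0" "cnj z \<notin> \<int>\<^sub>\<le>\<^sub>0" using assms Re_pos_not_nonpos[of z] Re_pos_not_nonpos[of "cnj z"] by auto
  have ser: "ln_Gamma_series (cnj z) n = cnj (ln_Gamma_series z n)" if n: "n > 0" for n
  proof -
    have Ln: "cnj (Ln w) = Ln (cnj w)" if "Re w > 0" for w
      using that Re_pos_not_nonpos[OF that] cnj_Ln by blast
    have "cnj (\<Sum>k=1..n. Ln (z / of_nat k + 1)) = (\<Sum>k=1..n. Ln (cnj z / of_nat k + 1))"
      unfolding cnj_sum
    proof (intro sum.cong refl)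
      fix k assume "k \<in> {1..n}"
      then have "Re (z / of_nat k + 1) > 0" using assms by (simp add: Re_divide_of_nat add_pos_pos)
      then show "cnj (Ln (z / of_nat k + 1)) = Ln (cnj z / of_nat k + 1)" by (subst Ln) simp_all
    qed
    moreover have "cnj (Ln (of_nat n)) = Ln (of_nat n :: complex)"
      using n by (simp add: cnj_Ln complex_nonpos_Reals_iff)
    ultimately show ?thesis by (simp add: ln_Gamma_series_def Ln[OF assms])
  qed
  have "(\<lambda>n. cnj (ln_Gamma_series z n)) \<longlonglongrightarrow> ln_Gamma (cnj z)"
    by (rule Lim_transform_eventually[OF ln_Gamma_complex_LIMSEQ[OF nz(2)]])
      (auto simp: ser intro: eventually_mono[OF eventually_gt_at_top[of 0]])
  moreover have "(\<lambda>n. cnj (ln_Gamma_series z n)) \<longlonglongrightarrow> cnj (ln_Gamma z)"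
    by (intro tendsto_cnj ln_Gamma_complex_LIMSEQ nz)
  ultimately show ?thesis using LIMSEQ_unique by blast
qed

lemma Stirling_vertical:
  assumes "x > 0"
  shows "\<exists>C. \<forall>z. Re z = x \<longrightarrow> norm (ln_Gamma z - (z * Ln z - z)) \<le> C * ln (\<bar>Im z\<bar> + 2)"
proof -
  obtain C where C: "\<And>y. y \<ge> 0 \<Longrightarrow>
      norm (ln_Gamma (Complex x y) - (Complex x y * Ln (Complex x y) - Complex x y)) \<le> C * ln (y + 2)"
    using Stirling_vertical_upper[OF assms] by blast
  have "norm (ln_Gamma z - (z * Ln z - z)) \<le> C * ln (\<bar>Im z\<bar> + 2)" if z: "Re z = x" for z
  proof (cases "Im z \<ge> 0")
    case True
    then show ?thesis using C[of "Im z"] z by (metis abs_of_nonneg complex_surj)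
  next
    case False
    have "norm (ln_Gamma (cnj z) - (cnj z * Ln (cnj z) - cnj z)) \<le> C * ln (- Im z + 2)"
      using C[of "- Im z"] z False by (metis cnj.code complex_surj le_minus_iff less_eq_real_def linear minus_zero neg_0_le_iff_le)
    moreover have "ln_Gamma (cnj z) - (cnj z * Ln (cnj z) - cnj z) = cnj (ln_Gamma z - (z * Ln z - z))"
      using z assms Re_pos_not_nonpos[of z] by (simp add: ln_Gamma_cnj cnj_Ln)
    ultimately show ?thesis using False by (metis abs_of_nonpos complex_mod_cnj less_eq_real_def not_le)
  qed
  then show ?thesis by blast
qed

section \<open>Zeros of entire functions and bounds in strips and discs\<close>

lemma finite_zeros_compact:
  fixes g :: "complex \<Rightarrow> complex"
  assumes "g holomorphic_on UNIV" "g c \<noteq> 0" "compact K"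
  shows "finite {z \<in> K. g z = 0}"
proof (cases "\<exists>w. g w = 0")
  case True
  then have "\<not> g constant_on UNIV" using assms(2) by (metis UNIV_I constant_on_def)
  then show ?thesis
    using holomorphic_compact_finite_zeros[OF assms(1) open_UNIV connected_UNIV assms(3)] by simp
qed auto

lemma zorder_entire_nonneg:
  assumes "g holomorphic_on UNIV" "g c \<noteq> 0"
  shows "zorder g z \<ge> 0"
proof -
  have "\<exists>w\<in>UNIV. g w \<noteq> 0" using assms(2) by blast
  from zorder_exist_zero[OF assms(1) open_UNIV connected_UNIV UNIV_I this, of z]
  show ?thesis by (auto split: if_splits)
qed

text \<open>To the right of all points of \<open>Z\<close> the principal logarithms add up to a
  holomorphic branch of the logarithm of the polynomial, in which each
  \<open>Ln (s - \<rho>)\<close> has imaginary part below pi / 2 in absolute value. This makes the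
  phase contributed by a zero explicit.\<close>

lemma exp_sum_Ln:
  assumes "finite Z" "\<And>\<rho>. \<rho> \<in> Z \<Longrightarrow> Re (s - \<rho>) > 0"
  shows "exp (\<Sum>\<rho>\<in>Z. of_nat (n \<rho>) * Ln (s - \<rho>)) = (\<Prod>\<rho>\<in>Z. (s - \<rho>) ^ n \<rho>)"
  unfolding exp_sum[OF assms(1)]
proof (intro prod.cong refl)
  fix \<rho> assume "\<rho> \<in> Z"
  then have nz: "s - \<rho> \<noteq> 0" using assms(2) Re_pos_not_nonpos(1) by blast
  show "exp (of_nat (n \<rho>) * Ln (s - \<rho>)) = (s - \<rho>) ^ n \<rho>"
    unfolding exp_of_nat_mult exp_Ln[OF nz] ..
qed

lemma holomorphic_ln_convex:
  assumes "open S" "convex S" "f holomorphic_on S" "\<And>z. z \<in> S \<Longrightarrow> f z \<noteq> 0"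
  obtains g where "g holomorphic_on S" "\<And>z. z \<in> S \<Longrightarrow> f z = exp (g z)"
proof -
  have "\<exists>g. g holomorphic_on S \<and> (\<forall>z\<in>S. f z = exp (g z))"
    using simply_connected_eq_holomorphic_log[OF assms(1)] convex_imp_simply_connected[OF assms(2)] assms(3,4) by blast
  then show thesis using that by blast
qed

lemma entire_factor_zero:
  fixes k :: "complex \<Rightarrow> complex"
  assumes hol: "k holomorphic_on UNIV" and nz: "k w0 \<noteq> 0"
  shows "\<exists>k'. k' holomorphic_on UNIV \<and> (\<forall>z. k z = k' z * (z - \<rho>) ^ nat (zorder k \<rho>)) \<and> k' \<rho> \<noteq> 0"
proof -
  define n where "n = nat (zorder k \<rho>)"
  obtain r where r: "r > 0" "zor_poly k \<rho> holomorphic_on cball \<rho> r"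
    and eq: "\<And>w. w \<in> cball \<rho> r \<Longrightarrow> k w = zor_poly k \<rho> w * (w - \<rho>) ^ n \<and> zor_poly k \<rho> w \<noteq> 0"
    using zorder_exist_zero[OF hol open_UNIV connected_UNIV, of \<rho>] nz unfolding n_def by blast
  \<comment> \<open>The quotient is completed at \<open>\<rho>\<close> by the local factor
    \<open>zor_poly\<close>; on the ball both formulas agree, so the two holomorphic pieces
    glue.\<close>
  define k' where "k' = (\<lambda>z. if z = \<rho> then zor_poly k \<rho> \<rho> else k z / (z - \<rho>) ^ n)"
  have loc: "k' w = zor_poly k \<rho> w" if "w \<in> ball \<rho> r" for w
    using that eq[of w] by (auto simp: k'_def)
  have "k' holomorphic_on (ball \<rho> r) \<union> (- {\<rho>})"
  proof (rule holomorphic_on_Un)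
    have "zor_poly k \<rho> holomorphic_on ball \<rho> r" using r(2) holomorphic_on_subset by force
    then show "k' holomorphic_on ball \<rho> r" by (rule holomorphic_transform) (simp add: loc)
    have "(\<lambda>z. k z / (z - \<rho>) ^ n) holomorphic_on - {\<rho>}"
      using hol by (intro holomorphic_intros holomorphic_on_subset[OF hol]) auto
    then show "k' holomorphic_on - {\<rho>}" by (rule holomorphic_transform) (auto simp: k'_def)
  qed auto
  moreover have "ball \<rho> r \<union> (- {\<rho>}) = UNIV" using r by auto
  moreover have "k z = k' z * (z - \<rho>) ^ n" for z
    using eq[of \<rho>] r by (cases "z = \<rho>") (auto simp: k'_def)
  moreover have "k' \<rho> \<noteq> 0" using eq[of \<rho>] r by (simp add: k'_def)
  ultimately show ?thesis unfolding n_def by auto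
qed

text \<open>The zeros are divided out one at a time. The product of the factors already removed does
  not vanish at the next point, so the order there of the remaining cofactor is the order of
  \<open>g\<close> itself, as the exponents demand.\<close>

lemma entire_factor_zeros:
  fixes g :: "complex \<Rightarrow> complex"
  assumes hol: "g holomorphic_on UNIV" and nz: "g w0 \<noteq> 0" and "finite Z"
  shows "\<exists>k. k holomorphic_on UNIV \<and>
    (\<forall>z. g z = k z * (\<Prod>\<rho>\<in>Z. (z - \<rho>) ^ nat (zorder g \<rho>))) \<and> (\<forall>\<rho>\<in>Z. k \<rho> \<noteq> 0)"
  using \<open>finite Z\<close>
proof (induction Z)
  case empty
  then show ?case using hol by auto
next
  case (insert \<rho> Z)
  then obtain k where k: "k holomorphic_on UNIV"
      "\<And>z. g z = k z * (\<Prod>\<rho>\<in>Z. (z - \<rho>) ^ nat (zorder g \<rho>))" "\<And>\<rho>. \<rho> \<in> Z \<Longrightarrow> k \<rho> \<noteq> 0"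
    by blast
  define P where "P = (\<lambda>z. \<Prod>\<rho>\<in>Z. (z - \<rho>) ^ nat (zorder g \<rho>))"
  have kw0: "k w0 \<noteq> 0" using k(2)[of w0] nz by auto
  obtain k' where k': "k' holomorphic_on UNIV" "\<And>z. k z = k' z * (z - \<rho>) ^ nat (zorder k \<rho>)" "k' \<rho> \<noteq> 0"
    using entire_factor_zero[OF k(1) kw0] by blast
  have ana: "P analytic_on {\<rho>}" "k analytic_on {\<rho>}"
    using k(1) by (auto simp: P_def intro!: analytic_intros holomorphic_on_imp_analytic_at[of _ UNIV])
  have "P \<rho> \<noteq> 0" using insert.hyps by (auto simp: P_def)
  then have zP: "zorder P \<rho> = 0" by (intro zorder_eq_0I ana)
  have "eventually (\<lambda>w. g w \<noteq> 0) (at \<rho>)"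
    using non_zero_neighbour_alt[OF hol open_UNIV connected_UNIV, of \<rho> w0] nz by auto
  then have "zorder (\<lambda>z. k z * P z) \<rho> = zorder k \<rho> + zorder P \<rho>"
    using ana by (intro zorder_times_analytic) (auto simp: P_def k(2)[symmetric])
  then have "zorder g \<rho> = zorder k \<rho>"
    using zP by (simp add: P_def k(2)[symmetric])
  then have "g z = k' z * (\<Prod>\<rho>\<in>insert \<rho> Z. (z - \<rho>) ^ nat (zorder g \<rho>))" for z
    using k(2)[of z] k'(2)[of z] insert.hyps by simp
  moreover have "k' \<sigma> \<noteq> 0" if "\<sigma> \<in> insert \<rho> Z" for \<sigma>
    using that k(3)[of \<sigma>] k'(2)[of \<sigma>] k'(3) by auto
  ultimately show ?case using k'(1) by blast
qed

text \<open>An upper bound A for Re f puts f closer to 0 than to the mirror image 2 A, so f / (2 A -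
  f) maps the disc into the unit disc and vanishes at the centre. Schwarz's lemma bounds it by r' /
  r, and solving for f gives the estimate.\<close>

lemma Borel_Caratheodory:
  assumes hol: "f holomorphic_on ball c r" and f0: "f c = 0" and A: "A > 0"
    and Re: "\<And>z. z \<in> ball c r \<Longrightarrow> Re (f z) < A" and z: "norm (z - c) \<le> r'" "r' < r"
  shows "norm (f z) \<le> 2 * r' / (r - r') * A"
proof -
  have r: "r > 0" "r' \<ge> 0" using z norm_ge_zero[of "z - c"] by linarith+
  define g where "g = (\<lambda>w :: complex. f (c + r * w) / (2 * A - f (c + r * w)))"
  have mem: "c + r * w \<in> ball c r" if "norm w < 1" for w :: complex
    using that r by (simp add: dist_norm norm_mult)
  have ne: "2 * A - f u \<noteq> 0" if "u \<in> ball c r" for u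
    using Re[OF that] A by (auto simp: complex_eq_iff)
  have lt: "norm (f u) < norm (2 * A - f u)" if "u \<in> ball c r" for u
  proof -
    have "norm (2 * A - f u) ^ 2 - norm (f u) ^ 2 = 4 * A * (A - Re (f u))"
      unfolding cmod_power2 by (simp add: power2_eq_square algebra_simps)
    also have "\<dots> > 0" using A Re[OF that] by simp
    finally show ?thesis by (simp add: power2_less_imp_less)
  qed
  have "g holomorphic_on ball 0 1"
  proof -
    have "(f \<circ> (\<lambda>w. c + r * w)) holomorphic_on ball 0 1"
      by (rule holomorphic_on_compose_gen[OF _ hol]) (use mem in \<open>auto intro!: holomorphic_intros\<close>)
    then have "(\<lambda>w. f (c + r * w)) holomorphic_on ball 0 1" by (simp add: o_def)
    then show ?thesis unfolding g_def using ne mem by (intro holomorphic_intros) auto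
  qed
  moreover have "g 0 = 0" by (simp add: g_def f0)
  moreover have "norm (g w) < 1" if "norm w < 1" for w
    using lt[OF mem[OF that]] ne[OF mem[OF that]] by (simp add: g_def norm_divide divide_less_eq)
  moreover define w where "w = (z - c) / r"
  moreover have w: "norm w \<le> r' / r" "norm w < 1"
    using z r by (auto simp: w_def norm_divide divide_right_mono field_simps)
  ultimately have "norm (g w) \<le> norm w" by (intro Schwarz_Lemma) auto
  then have gw: "norm (g w) \<le> r' / r" using w by simp
  have cz: "c + r * w = z" using r by (simp add: w_def)
  have "z \<in> ball c r" using z by (simp add: dist_norm norm_minus_commute)
  then have "f z = g w * (2 * A - f z)" using ne[of z] by (simp add: g_def cz)
  then have "norm (f z) = norm (g w) * norm (2 * A - f z)" by (metis norm_mult)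
  also have "\<dots> \<le> r' / r * (2 * A + norm (f z))"
    using gw r A norm_triangle_ineq4[of "2 * complex_of_real A" "f z"] by (intro mult_mono) auto
  finally have "norm (f z) * (r - r') \<le> 2 * r' * A" using r by (simp add: field_simps)
  then show ?thesis using z by (simp add: field_simps)
qed

text \<open>The values of \<open>q\<close> differ by multiples of 2 pi i, and a continuous function
  with such a discrete range is constant on a connected set. Used to compare branches of one
  logarithm that were built in different ways.\<close>

lemma continuous_exp_const_imp_const:
  fixes q :: "'a :: topological_space \<Rightarrow> complex"
  assumes "connected S" "continuous_on S q" "\<And>z. z \<in> S \<Longrightarrow> exp (q z) = w"
  shows "\<exists>c. \<forall>z\<in>S. q z = c"
proof -
  have "q constant_on S"
  proof (rule continuous_discrete_range_constant[OF assms(1,2)])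
    fix x assume x: "x \<in> S"
    have "2 * pi \<le> norm (q y - q x)" if "y \<in> S" "q y \<noteq> q x" for y
    proof -
      have "exp (q y) = exp (q x)" using assms(3) x that by metis
      then obtain n where n: "q y = q x + (of_int (2 * n) * pi) * \<i>" using exp_eq by metis
      then have "n \<noteq> 0" using that by auto
      then have "1 \<le> \<bar>real_of_int n\<bar>" by linarith
      then have "2 * pi * 1 \<le> 2 * pi * \<bar>real_of_int n\<bar>" by (intro mult_left_mono) auto
      also have "\<dots> = norm (q y - q x)" by (simp add: n norm_mult)
      finally show ?thesis by simp
    qed
    then show "\<exists>e>0. \<forall>y. y \<in> S \<and> q y \<noteq> q x \<longrightarrow> e \<le> norm (q y - q x)"
      by (intro exI[of _ "2 * pi"]) auto
  qed
  then show ?thesis by (auto simp: constant_on_def)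
qed

text \<open>The factor exp (- eps cos (kappa (z - c))) decays doubly exponentially in |Im z|, which
  beats any growth of finite order. The maximum principle on a tall rectangle then leaves only the
  vertical edges to matter, and eps tends to 0.\<close>

lemma Phragmen_Lindelof_strip:
  assumes hol: "f holomorphic_on S" and S: "{z. a \<le> Re z \<and> Re z \<le> b} \<subseteq> S" and ab: "a < b"
    and growth: "\<And>z. a \<le> Re z \<Longrightarrow> Re z \<le> b \<Longrightarrow> norm z \<ge> 1 \<Longrightarrow> norm (f z) \<le> C * exp (norm z powr p)"
    and edges: "\<And>z. Re z = a \<or> Re z = b \<Longrightarrow> norm (f z) \<le> B"
    and B: "B > 0" and z: "a \<le> Re z" "Re z \<le> b"
  shows "norm (f z) \<le> B"
proof -
  \<comment> \<open>With this scaling the argument of the cosine has real part in [-1/2, 1/2] on the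
    strip, well inside (- pi / 2, pi / 2), so Re \<open>K\<close> is at least q cosh (kappa Im z)
    with q = cos (1/2) > 0.\<close>
  define \<kappa> where "\<kappa> = 1 / (b - a)"
  define c where "c = (a + b) / 2"
  define K :: "complex \<Rightarrow> complex" where "K = (\<lambda>z. cos (of_real \<kappa> * (z - of_real c)))"
  define q where "q = cos (1/2 :: real)"
  have \<kappa>: "\<kappa> > 0" using ab by (simp add: \<kappa>_def)
  have q: "q > 0" unfolding q_def using pi_gt3 by (intro cos_gt_zero) auto
  have ReK: "q * cosh (\<kappa> * Im z) \<le> Re (K z)" if "a \<le> Re z" "Re z \<le> b" for z
  proof -
    have "\<bar>\<kappa> * (Re z - c)\<bar> \<le> 1/2"
      using that ab by (auto simp: \<kappa>_def c_def abs_if field_simps)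
    then have "q \<le> cos \<bar>\<kappa> * (Re z - c)\<bar>"
      unfolding q_def using pi_gt3 by (intro cos_monotone_0_pi_le) auto
    then have "q * cosh (\<kappa> * Im z) \<le> cos (\<kappa> * (Re z - c)) * cosh (\<kappa> * Im z)"
      by (intro mult_right_mono) (simp_all only: cos_abs_real cosh_real_nonneg)
    also have "\<dots> = Re (K z)" unfolding K_def Re_cos cosh_def by (simp add: right_diff_distrib)
    finally show ?thesis .
  qed
  have bound: "norm (f z * exp (- of_real \<epsilon> * K z)) \<le> B" if \<epsilon>: "\<epsilon> > 0" for \<epsilon>
  proof -
    define M where "M = \<bar>a\<bar> + \<bar>b\<bar> + 1"
    \<comment> \<open>A positive exponent makes the bound increasing in |z|; since the growth
      hypothesis is invoked only at |z| >= 1, raising the exponent only enlarges it.\<close>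
    define p' where "p' = max p 1"
    have M: "M > 0" "p' > 0" "\<epsilon> * q > 0" using \<epsilon> q by (auto simp: M_def p'_def)
    have "((\<lambda>Y. \<bar>C\<bar> * exp ((M + Y) powr p' - \<epsilon> * q * (exp (\<kappa> * Y) / 2))) \<longlongrightarrow> 0) at_top"
    proof -
      have "filterlim (\<lambda>Y. (M + Y) powr p' - (\<epsilon> * q) * (exp (\<kappa> * Y) / 2)) at_bot at_top"
        using M \<kappa> by real_asymp
      then have "((\<lambda>Y. \<bar>C\<bar> * exp ((M + Y) powr p' - \<epsilon> * q * (exp (\<kappa> * Y) / 2))) \<longlongrightarrow> \<bar>C\<bar> * 0) at_top"
        by (intro tendsto_mult tendsto_const filterlim_compose[OF exp_at_bot])
      then show ?thesis by simp
    qed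
    then have "eventually (\<lambda>Y. \<bar>C\<bar> * exp ((M + Y) powr p' - \<epsilon> * q * (exp (\<kappa> * Y) / 2)) < B) at_top"
      using B by (rule order_tendstoD)
    then have "eventually (\<lambda>Y. \<bar>C\<bar> * exp ((M + Y) powr p' - \<epsilon> * q * (exp (\<kappa> * Y) / 2)) < B \<and> max 1 \<bar>Im z\<bar> < Y) at_top"
      using eventually_gt_at_top by (rule eventually_conj)
    \<comment> \<open>\<open>Y\<close> is so large that the horizontal edges are harmless, that
      \<open>z\<close> lies in the rectangle, and that points of those edges have modulus at least
      1.\<close>
    then obtain Y where Y: "\<bar>C\<bar> * exp ((M + Y) powr p' - \<epsilon> * q * (exp (\<kappa> * Y) / 2)) < B" "max 1 \<bar>Im z\<bar> < Y"
      using eventually_happens'[OF trivial_limit_at_top_linorder] by blast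
    define R where "R = cbox (Complex a (-Y)) (Complex b Y)"
    have R: "R \<subseteq> {z. a \<le> Re z \<and> Re z \<le> b}" by (auto simp: R_def in_cbox_complex_iff)
    have holg: "(\<lambda>z. f z * exp (- of_real \<epsilon> * K z)) holomorphic_on R"
      unfolding K_def using R S by (intro holomorphic_intros holomorphic_on_subset[OF hol]) auto
    show ?thesis
    proof (rule maximum_modulus_frontier[of "\<lambda>z. f z * exp (- of_real \<epsilon> * K z)" R])
      show "(\<lambda>z. f z * exp (- of_real \<epsilon> * K z)) holomorphic_on interior R"
        using holg interior_subset holomorphic_on_subset by blast
      show "continuous_on (closure R) (\<lambda>z. f z * exp (- of_real \<epsilon> * K z))"
        using holomorphic_on_imp_continuous_on[OF holg] by (simp add: R_def)
      show "bounded R" by (simp add: R_def)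
      show "z \<in> R" using z Y by (auto simp: R_def in_cbox_complex_iff)
      fix w assume "w \<in> frontier R"
      then have w: "a \<le> Re w" "Re w \<le> b" "\<bar>Im w\<bar> \<le> Y" and edge: "Re w = a \<or> Re w = b \<or> \<bar>Im w\<bar> = Y"
        by (auto simp: R_def frontier_cbox in_cbox_complex_iff in_box_complex_iff abs_if split: if_splits)
      have n: "norm (f w * exp (- of_real \<epsilon> * K w)) = norm (f w) * exp (- \<epsilon> * Re (K w))"
        by (simp add: norm_mult)
      have ReK0: "Re (K w) \<ge> 0"
        using ReK[OF w(1,2)] q cosh_real_pos[of "\<kappa> * Im w"] by (smt (verit) mult_pos_pos)
      show "norm (f w * exp (- of_real \<epsilon> * K w)) \<le> B"
      proof (cases "Re w = a \<or> Re w = b")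
        case True
        then have "norm (f w) * exp (- \<epsilon> * Re (K w)) \<le> B * 1"
          using edges[OF True] ReK0 \<epsilon> B by (intro mult_mono) auto
        then show ?thesis using n by simp
      next
        case False
        with edge have Yw: "\<bar>Im w\<bar> = Y" by auto
        then have Y0: "Y \<ge> 0" by auto
        have "norm w \<le> M + Y" using Yw cmod_le[of w] w by (auto simp: M_def)
        have w1: "norm w \<ge> 1" using abs_Im_le_cmod[of w] Yw Y by simp
        then have "norm w powr p \<le> norm w powr p'" by (intro powr_mono) (auto simp: p'_def)
        also have "\<dots> \<le> (M + Y) powr p'" using \<open>norm w \<le> M + Y\<close> M by (intro powr_mono2) auto
        finally have "norm w powr p \<le> (M + Y) powr p'" .
        moreover have "exp (\<kappa> * Y) / 2 \<le> cosh (\<kappa> * Im w)"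
        proof -
          have eq: "cosh (\<kappa> * Im w) = cosh (\<kappa> * Y)" using Yw \<kappa> Y0 by (simp only: cosh_real_eq_iff abs_mult abs_of_pos)
          show ?thesis unfolding eq by (simp add: cosh_def)
        qed
        then have "\<epsilon> * (q * (exp (\<kappa> * Y) / 2)) \<le> \<epsilon> * Re (K w)"
          using ReK[OF w(1,2)] \<epsilon> q by (intro mult_left_mono) (smt (verit) mult_left_mono, simp)
        ultimately have "norm w powr p - \<epsilon> * Re (K w) \<le> (M + Y) powr p' - \<epsilon> * q * (exp (\<kappa> * Y) / 2)"
          by (simp add: mult.assoc)
        have "norm (f w) * exp (- \<epsilon> * Re (K w)) \<le> (\<bar>C\<bar> * exp (norm w powr p)) * exp (- \<epsilon> * Re (K w))"
          using growth[OF w(1,2) w1] by (intro mult_right_mono) (auto intro: order_trans mult_right_mono)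
        also have "\<dots> = \<bar>C\<bar> * exp (norm w powr p - \<epsilon> * Re (K w))"
          by (simp add: exp_diff exp_minus field_simps)
        also have "\<dots> \<le> \<bar>C\<bar> * exp ((M + Y) powr p' - \<epsilon> * q * (exp (\<kappa> * Y) / 2))"
          using \<open>norm w powr p - _ \<le> _\<close> by (intro mult_left_mono) auto
        finally show ?thesis using n Y by simp
      qed
    qed
  qed
  have "((\<lambda>\<epsilon>. norm (f z * exp (- of_real \<epsilon> * K z))) \<longlongrightarrow> norm (f z * exp (- of_real 0 * K z))) (at_right 0)"
    by (intro tendsto_intros)
  then have "norm (f z * exp (- of_real 0 * K z)) \<le> B"
    by (rule tendsto_upperbound[OF _ eventually_mono[OF eventually_at_right_less[of 0] bound] trivial_limit_at_right_real])
  then show ?thesis by simp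
qed

text \<open>The line Re z = x may lie left of the imaginary axis; only z + a is known to be in the
  right half-plane. Between z + a and z + n the logarithm of Gamma changes by O(log (|z| + 2)),
  because Digamma is of that size, and the recurrence of Gamma leads from z + n back to z through a
  Pochhammer product. Both contribute a power of |z| + 1.\<close>

lemma Gamma_ratio_bound:
  assumes "a > 0" "x + a > 0"
  shows "\<exists>C n. C > 0 \<and> (\<forall>z. Re z = x \<and> z \<notin> \<int>\<^sub>\<le>\<^sub>0 \<longrightarrow>
           norm (Gamma (z + of_real a)) \<le> C * (norm z + 1) ^ n * norm (Gamma z))"
proof -
  \<comment> \<open>An integer n > a keeps the segment from z + a to z + n inside Re w >= x + a >
    0.\<close>
  obtain n :: nat where n: "a < real n" using reals_Archimedean2 by blast
  define x0 where "x0 = x + a"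
  have x0: "x0 > 0" using assms by (simp add: x0_def)
  define K where "K = \<bar>ln x0\<bar> + pi / 2 + 2 / x0 ^ 2 + 2 / x0"
  \<comment> \<open>The Digamma estimate and the Pochhammer product each give N^n with N = |z| + n
    <= n (|z| + 1); the exponential comes from the bounded part \<open>K\<close> of the Digamma
    estimate.\<close>
  define C where "C = real n ^ (2 * n) * exp (real n * K)"
  have "0 < real n" using n assms by linarith
  then have n1: "real n \<ge> 1" by simp
  have "norm (Gamma (z + of_real a)) \<le> C * (norm z + 1) ^ (2 * n) * norm (Gamma z)"
    if z: "Re z = x" "z \<notin> \<int>\<^sub>\<le>\<^sub>0" for z
  proof -
    define N where "N = norm z + real n"
    have N1: "N \<ge> 1" using n1 by (simp add: N_def add_increasing)
    define I where "I = closed_segment (z + of_real a) (z + of_nat n)"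
    have I: "Re w \<ge> x0" "norm w \<le> N" if "w \<in> I" for w
    proof -
      obtain u where u: "0 \<le> u" "u \<le> 1" "w = (1 - u) *\<^sub>R (z + of_real a) + u *\<^sub>R (z + of_nat n)"
        using \<open>w \<in> I\<close> by (auto simp: I_def in_segment)
      have w: "w = z + of_real (a + u * (real n - a))"
        using u(3) by (simp add: scaleR_conv_of_real algebra_simps)
      have *: "0 \<le> u * (real n - a)" "u * (real n - a) \<le> 1 * (real n - a)"
        using u n by (auto intro!: mult_right_mono)
      show "Re w \<ge> x0" using * z by (simp add: w x0_def)
      have "norm w \<le> norm z + \<bar>a + u * (real n - a)\<bar>"
        unfolding w by (metis norm_of_real norm_triangle_ineq)
      then show "norm w \<le> N" using * assms by (simp add: N_def)
    qed
    have "norm (ln_Gamma (z + of_real a) - ln_Gamma (z + of_nat n))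
        \<le> (ln N + K) * norm ((z + of_real a) - (z + of_nat n))"
    proof (rule field_differentiable_bound[of I])
      fix w assume w: "w \<in> I"
      have Re: "Re w > 0" using I[OF w] x0 by simp
      show "(ln_Gamma has_field_derivative Digamma w) (at w within I)"
        using Re_pos_not_nonpos[OF Re] by (auto intro!: derivative_eq_intros)
      have nw: "x0 \<le> norm w" using I[OF w] complex_Re_le_cmod[of w] by linarith
      have "norm (Digamma w) \<le> norm (Ln w) + norm (Digamma w - Ln w)"
        using norm_triangle_sub[of "Digamma w" "Ln w"] by simp
      also have "\<dots> \<le> (\<bar>ln (norm w)\<bar> + pi / 2) + (2 / norm w ^ 2 + 2 / norm w)"
        using Re by (intro add_mono Ln_norm_le Digamma_minus_Ln_bound) auto
      also have "\<bar>ln (norm w)\<bar> \<le> ln N + \<bar>ln x0\<bar>"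
      proof -
        have "ln x0 \<le> ln (norm w)" "ln (norm w) \<le> ln N" "ln N \<ge> 0"
          using nw x0 I[OF w] N1 by (intro ln_mono ln_ge_zero; linarith)+
        then show ?thesis by linarith
      qed
      also have "2 / norm w ^ 2 + 2 / norm w \<le> 2 / x0 ^ 2 + 2 / x0"
        using nw x0 by (intro add_mono divide_left_mono power_mono) (auto intro!: mult_pos_pos)
      finally show "norm (Digamma w) \<le> ln N + K" by (simp add: K_def)
    qed (auto simp: I_def)
    also have "\<dots> = (ln N + K) * (real n - a)"
    proof -
      have "(z + of_real a) - (z + of_nat n) = of_real (a - real n)" by simp
      then show ?thesis using n by (simp only: norm_of_real) simp
    qed
    also have "\<dots> \<le> (ln N + K) * real n"
      using N1 assms x0 by (intro mult_left_mono) (auto simp: K_def intro!: add_nonneg_nonneg)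
    finally have d: "norm (ln_Gamma (z + of_real a) - ln_Gamma (z + of_nat n)) \<le> (ln N + K) * real n" .
    have mem: "z + of_real a \<in> I" "z + of_nat n \<in> I" by (auto simp: I_def)
    have Rp: "Re (z + of_real a) > 0" "Re (z + of_nat n) > 0" using I(1)[OF mem(1)] I(1)[OF mem(2)] x0 by linarith+
    have "Gamma (z + of_real a) = exp (ln_Gamma (z + of_real a) - ln_Gamma (z + of_nat n)) * Gamma (z + of_nat n)"
      using exp_ln_Gamma_complex Re_pos_not_nonpos(3)[OF Rp(1)] Re_pos_not_nonpos(3)[OF Rp(2)]
      by (simp add: exp_diff Gamma_eq_zero_iff)
    then have "norm (Gamma (z + of_real a)) = exp (Re (ln_Gamma (z + of_real a) - ln_Gamma (z + of_nat n))) * norm (Gamma (z + of_nat n))"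
      by (metis norm_exp_eq_Re norm_mult)
    also have "\<dots> \<le> exp ((ln N + K) * real n) * norm (Gamma (z + of_nat n))"
      using order_trans[OF complex_Re_le_cmod d] by (intro mult_right_mono) auto
    also have "exp ((ln N + K) * real n) = N ^ n * exp (real n * K)"
      using N1 by (simp add: exp_of_nat2_mult exp_of_nat_mult exp_add power_mult_distrib)
    also have "Gamma (z + of_nat n) = pochhammer z n * Gamma z"
      using pochhammer_Gamma[OF z(2), of n] z by (simp add: Gamma_eq_zero_iff field_simps)
    also have "norm (pochhammer z n * Gamma z) \<le> N ^ n * norm (Gamma z)"
    proof -
      have "norm (pochhammer z n) = (\<Prod>i<n. norm (z + of_nat i))"
        by (simp add: pochhammer_prod prod_norm atLeast0LessThan)
      also have "\<dots> \<le> (\<Prod>i<n. N)"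
      proof (intro prod_mono conjI)
        fix i assume "i \<in> {..<n}"
        then show "norm (z + of_nat i) \<le> N"
          using norm_triangle_ineq[of z "of_nat i"] by (simp add: N_def)
      qed auto
      finally show ?thesis by (simp add: norm_mult mult_right_mono)
    qed
    also have "N ^ n * exp (real n * K) * (N ^ n * norm (Gamma z)) = N ^ (2 * n) * exp (real n * K) * norm (Gamma z)"
      by (simp add: mult_2 power_add)
    also have "\<dots> \<le> (real n * (norm z + 1)) ^ (2 * n) * exp (real n * K) * norm (Gamma z)"
    proof -
      have "N \<le> real n * (norm z + 1)"
        unfolding N_def using mult_right_mono[OF n1, of "norm z"] by (simp add: distrib_left)
      then show ?thesis using N1 by (intro mult_right_mono power_mono) auto
    qed
    finally show ?thesis using N1 by (simp add: C_def power_mult_distrib mult_ac mult_left_mono)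
  qed
  moreover have "C > 0" using n1 by (simp add: C_def)
  ultimately show ?thesis by blast
qed

text \<open>Each zero that is divided out changes the phase along the segment by at most \<open>\<pi>\<close>, and
  Jensen's argument bounds their number by \<open>log\<^sub>2 M\<close>; the zero-free cofactor is left to
  Borel-Caratheodory.\<close>
lemma Im_holomorphic_log_bound:
  fixes G h :: "complex \<Rightarrow> complex"
  assumes G: "G holomorphic_on UNIV" and Re_c: "Re c = 3"
    and M: "M > 1" "\<And>z. norm (z - c) \<le> 9 \<Longrightarrow> norm (G z) \<le> M * norm (G c)"
    and h: "h holomorphic_on {z. Re z > 1/2}" "\<And>z. Re z > 1/2 \<Longrightarrow> G z = exp (h z)"
    and z: "Im z = Im c" "1/2 < Re z" "Re z \<le> 3"
  shows "\<bar>Im (h z) - Im (h c)\<bar> \<le> (20 + pi / ln 2) * ln M"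
proof -
  have Gnz: "G w \<noteq> 0" if "Re w > 1/2" for w using h(2)[OF that] by simp
  have Gc: "G c \<noteq> 0" using Gnz Re_c by simp
  \<comment> \<open>Radius 3 covers the horizontal segment from c towards Re z = 1/2, of length 5/2.
    Radius 9 is three times as large, so points of the outer circle are at distance at least 6 from
    every zero in \<open>Z\<close>, at least twice the distance of that zero from c.\<close>
  define Z where "Z = {w \<in> cball c 3. G w = 0}"
  have finZ: "finite Z"
    unfolding Z_def by (rule finite_zeros_compact[OF G Gc]) simp
  have ReZ: "Re \<rho> \<le> 1/2" "norm (\<rho> - c) \<le> 3" if "\<rho> \<in> Z" for \<rho>
    using that Gnz[of \<rho>] by (auto simp: Z_def dist_norm norm_minus_commute not_less[symmetric])
  have Znc: "c \<noteq> \<rho>" if "\<rho> \<in> Z" for \<rho> using that Gc by (auto simp: Z_def)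
  define n where "n = (\<lambda>\<rho>. nat (zorder G \<rho>))"
  obtain k where k: "k holomorphic_on UNIV" "\<And>z. G z = k z * (\<Prod>\<rho>\<in>Z. (z - \<rho>) ^ n \<rho>)" "\<And>\<rho>. \<rho> \<in> Z \<Longrightarrow> k \<rho> \<noteq> 0"
    using entire_factor_zeros[OF G Gc finZ] unfolding n_def by blast
  define N where "N = (\<Sum>\<rho>\<in>Z. n \<rho>)"
  define D where "D = (\<Prod>\<rho>\<in>Z. (c - \<rho>) ^ n \<rho>)"
  have D: "D \<noteq> 0" using Znc finZ by (auto simp: D_def)
  have kbound: "norm (k w * D) \<le> M * norm (G c) / 2 ^ N" if "norm (w - c) \<le> 9" for w
  proof (rule maximum_modulus_frontier[of "\<lambda>w. k w * D" "cball c 9"])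
    fix w assume "w \<in> frontier (cball c 9)"
    then have w: "norm (w - c) = 9" by (simp add: dist_norm norm_minus_commute)
    have "norm D * 2 ^ N = (\<Prod>\<rho>\<in>Z. (2 * norm (c - \<rho>)) ^ n \<rho>)"
      by (simp add: D_def N_def prod_norm[symmetric] norm_power power_mult_distrib prod.distrib power_sum mult.commute)
    also have "\<dots> \<le> (\<Prod>\<rho>\<in>Z. norm (w - \<rho>) ^ n \<rho>)"
    proof (intro prod_mono conjI power_mono)
      fix \<rho> assume \<rho>: "\<rho> \<in> Z"
      have "norm (w - c) \<le> norm (w - \<rho>) + norm (\<rho> - c)" by (metis diff_add_cancel add_diff_eq norm_triangle_ineq)
      then show "2 * norm (c - \<rho>) \<le> norm (w - \<rho>)"
        using ReZ(2)[OF \<rho>] w by (simp add: norm_minus_commute)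
    qed auto
    finally have "norm (k w) * (norm D * 2 ^ N) \<le> norm (G w)"
      by (simp add: k(2) norm_mult prod_norm[symmetric] norm_power mult_left_mono)
    also have "\<dots> \<le> M * norm (G c)" using M(2)[of w] w by simp
    finally show "norm (k w * D) \<le> M * norm (G c) / 2 ^ N"
      by (simp add: norm_mult field_simps)
  next
    show "(\<lambda>w. k w * D) holomorphic_on interior (cball c 9)"
      by (intro holomorphic_intros holomorphic_on_subset[OF k(1)]) auto
    show "continuous_on (closure (cball c 9)) (\<lambda>w. k w * D)"
      by (intro continuous_intros holomorphic_on_imp_continuous_on holomorphic_on_subset[OF k(1)]) auto
  qed (use that in \<open>auto simp: dist_norm norm_minus_commute\<close>)
  have kc: "G c = k c * D" by (simp add: k(2) D_def)
  have "norm (G c) \<le> M * norm (G c) / 2 ^ N" using kbound[of c] kc by simp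
  then have "2 ^ N \<le> M" using Gc by (simp add: field_simps)
  then have "ln (2 ^ N) \<le> ln M" by (subst ln_le_cancel_iff) (use M in auto)
  then have "real N * ln 2 \<le> ln M" by (simp add: ln_realpow)
  then have NM: "real N \<le> ln M / ln 2" by (simp add: field_simps)
  have knz: "k w \<noteq> 0" if "w \<in> ball c 3" for w
  proof
    assume "k w = 0"
    then have "G w = 0" by (simp add: k(2))
    then have "w \<in> Z" using that by (simp add: Z_def)
    then show False using k(3) \<open>k w = 0\<close> by blast
  qed
  obtain l0 where l0: "l0 holomorphic_on ball c 3" "\<And>w. w \<in> ball c 3 \<Longrightarrow> k w = exp (l0 w)"
    using holomorphic_ln_convex[OF open_ball[of c 3] convex_ball holomorphic_on_subset[OF k(1) subset_UNIV] knz] by blast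
  define l where "l = (\<lambda>w. l0 w - l0 c)"
  \<comment> \<open>The real part is at most ln M; as ln M > 0, doubling yields the strict
    inequality that \<open>Borel_Caratheodory\<close> asks for.\<close>
  have Re_l: "Re (l w) < 2 * ln M" if w: "w \<in> ball c 3" for w
  proof -
    have "exp (Re (l w)) = norm (k w) / norm (k c)"
      using l0(2)[OF w] l0(2)[of c] by (simp add: l_def exp_diff)
    also have "\<dots> = norm (k w * D) / norm (G c)" using D by (simp add: kc norm_mult)
    also have "\<dots> \<le> M * norm (G c) / 2 ^ N / norm (G c)"
      using kbound[of w] w by (intro divide_right_mono) (auto simp: dist_norm norm_minus_commute)
    also have "\<dots> \<le> M" using Gc M(1) by (simp add: field_simps)
    finally have "Re (l w) \<le> ln M" using M(1) by (simp add: ln_ge_iff)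
    then show ?thesis using M(1) ln_gt_zero[of M] by linarith
  qed
  \<comment> \<open>The radii 5/2 and 3 give the factor 10, which with 2 ln M makes the constant 20
    of the conclusion.\<close>
  have "norm (l z) \<le> 2 * (5/2) / (3 - 5/2) * (2 * ln M)"
  proof (rule Borel_Caratheodory[of l c 3])
    show "l holomorphic_on ball c 3" unfolding l_def using l0 by (intro holomorphic_intros)
    show "norm (z - c) \<le> 5/2"
      using cmod_le[of "z - c"] z Re_c by simp
  qed (use Re_l M(1) in \<open>auto simp: l_def\<close>)
  then have lz: "\<bar>Im (l z)\<bar> \<le> 20 * ln M" using abs_Im_le_cmod[of "l z"] by simp
  define E where "E = {w. Re w > 1/2} \<inter> ball c 3"
  have Ln: "Re (w - \<rho>) > 0" if "w \<in> E" "\<rho> \<in> Z" for w \<rho>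
    using that ReZ[of \<rho>] by (simp add: E_def)
  define q where "q = (\<lambda>w. h w - l w - (\<Sum>\<rho>\<in>Z. of_nat (n \<rho>) * Ln (w - \<rho>)))"
  have zE: "z \<in> E" "c \<in> E"
    using z Re_c cmod_le[of "c - z"] by (auto simp: E_def dist_norm)
  have "\<exists>d. \<forall>w\<in>E. q w = d"
  proof (rule continuous_exp_const_imp_const)
    show "connected E" unfolding E_def
      by (intro convex_connected convex_Int convex_halfspace_Re_gt) auto
    have "q holomorphic_on E"
      unfolding q_def l_def using Ln Re_pos_not_nonpos
      by (intro holomorphic_intros holomorphic_on_subset[OF h(1)] holomorphic_on_subset[OF l0(1)])
         (auto simp: E_def)
    then show "continuous_on E q" by (rule holomorphic_on_imp_continuous_on)
    fix w assume w: "w \<in> E"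
    have "exp (\<Sum>\<rho>\<in>Z. of_nat (n \<rho>) * Ln (w - \<rho>)) = (\<Prod>\<rho>\<in>Z. (w - \<rho>) ^ n \<rho>)"
      by (intro exp_sum_Ln finZ Ln w)
    moreover have "exp (h w) = k w * (\<Prod>\<rho>\<in>Z. (w - \<rho>) ^ n \<rho>)" using h(2)[of w] w k(2) by (simp add: E_def)
    moreover have "exp (l w) = k w / k c" using l0(2)[of w] l0(2)[of c] w by (simp add: l_def exp_diff E_def)
    moreover have "(\<Prod>\<rho>\<in>Z. (w - \<rho>) ^ n \<rho>) \<noteq> 0" using Ln[OF w] finZ by auto
    moreover have "k w \<noteq> 0" "k c \<noteq> 0" using knz w by (auto simp: E_def)
    ultimately show "exp (q w) = k c" by (simp add: q_def exp_diff)
  qed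
  then have "q z = q c" using zE by auto
  then have "h z - h c = l z + (\<Sum>\<rho>\<in>Z. of_nat (n \<rho>) * (Ln (z - \<rho>) - Ln (c - \<rho>)))"
    by (simp add: q_def l_def sum_subtractf algebra_simps)
  from arg_cong[OF this, of Im]
  have "Im (h z) - Im (h c) = Im (l z) + (\<Sum>\<rho>\<in>Z. real (n \<rho>) * (Im (Ln (z - \<rho>)) - Im (Ln (c - \<rho>))))"
    by simp
  moreover have "\<bar>\<Sum>\<rho>\<in>Z. real (n \<rho>) * (Im (Ln (z - \<rho>)) - Im (Ln (c - \<rho>)))\<bar> \<le> (\<Sum>\<rho>\<in>Z. real (n \<rho>) * pi)"
  proof (rule order_trans[OF sum_abs], intro sum_mono)
    fix \<rho> assume \<rho>: "\<rho> \<in> Z"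
    have "\<bar>Im (Ln (z - \<rho>))\<bar> < pi / 2" "\<bar>Im (Ln (c - \<rho>))\<bar> < pi / 2"
      using Ln[OF zE(1) \<rho>] Ln[OF zE(2) \<rho>] Re_Ln_pos_lt Re_pos_not_nonpos(1) by blast+
    then have "\<bar>Im (Ln (z - \<rho>)) - Im (Ln (c - \<rho>))\<bar> \<le> pi" by linarith
    then show "\<bar>real (n \<rho>) * (Im (Ln (z - \<rho>)) - Im (Ln (c - \<rho>)))\<bar> \<le> real (n \<rho>) * pi"
      by (simp add: abs_mult mult_left_mono)
  qed
  moreover have "(\<Sum>\<rho>\<in>Z. real (n \<rho>) * pi) = real N * pi" by (simp add: N_def sum_distrib_right)
  moreover have "real N * pi \<le> ln M / ln 2 * pi" using NM by (intro mult_right_mono) auto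
  ultimately show ?thesis using lz by (simp add: algebra_simps)
qed

section \<open>Counting zeros by the phase on the critical line\<close>

text \<open>With the zeros near the segment divided out, X = k P, the cofactor k has a logarithm
  across the line. The functional equation makes the phase of k constant on the line, since s - rho
  is purely imaginary there and conjugation only changes its sign. The whole change of phase thus
  comes from the factors s - rho, whose arguments go from - pi / 2 to pi / 2 as Im rho is passed.
  \<open>H\<close> lives only to the right of the line, hence the limit in
  \<open>\<delta>\<close>.\<close>

lemma zeros_between_eq_phase_difference:
  fixes X H :: "complex \<Rightarrow> complex"
  assumes X: "X holomorphic_on UNIV" "\<And>s. X s = \<omega> * cnj (X (1 - cnj s))"
    and zeros: "\<And>s. X s = 0 \<Longrightarrow> Re s = 1/2"
    and H: "H holomorphic_on {s. Re s > 1/2}" "\<And>s. Re s > 1/2 \<Longrightarrow> X s = exp (H s)"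
    and T: "T1 < T2" "X (crit T1) \<noteq> 0" "X (crit T2) \<noteq> 0"
  shows "((\<lambda>\<delta>. Im (H (Complex (1/2 + \<delta>) T2)) - Im (H (Complex (1/2 + \<delta>) T1))) \<longlongrightarrow>
           pi * (\<Sum>\<rho> | X \<rho> = 0 \<and> T1 < Im \<rho> \<and> Im \<rho> < T2. real_of_int (zorder X \<rho>))) (at_right 0)"
proof -
  \<comment> \<open>The box exceeds the heights T1 and T2 by 1, so that the cofactor has no zeros on
    an open horizontal strip containing both endpoints.\<close>
  define Z where "Z = {\<rho> \<in> cbox (Complex 0 (T1 - 1)) (Complex 1 (T2 + 1)). X \<rho> = 0}"
  have finZ: "finite Z"
    unfolding Z_def by (rule finite_zeros_compact[OF X(1) T(2)]) simp
  have ReZ: "\<rho> = crit (Im \<rho>)" if "\<rho> \<in> Z" for \<rho>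
    using zeros[of \<rho>] that by (auto simp: Z_def complex_eq_iff)
  define n where "n = (\<lambda>\<rho>. nat (zorder X \<rho>))"
  obtain k where k: "k holomorphic_on UNIV" "\<And>z. X z = k z * (\<Prod>\<rho>\<in>Z. (z - \<rho>) ^ n \<rho>)" "\<And>\<rho>. \<rho> \<in> Z \<Longrightarrow> k \<rho> \<noteq> 0"
    using entire_factor_zeros[OF X(1) T(2) finZ] unfolding n_def by blast
  define P where "P = (\<lambda>z. \<Prod>\<rho>\<in>Z. (z - \<rho>) ^ n \<rho>)"
  have kP: "X z = k z * P z" for z using k(2) by (simp add: P_def)
  define Y where "Y = {s. T1 - 1 < Im s} \<inter> {s. Im s < T2 + 1}"
  have convY: "convex Y" unfolding Y_def
    by (intro convex_Int convex_halfspace_Im_gt convex_halfspace_Im_lt)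
  have openY: "open Y" unfolding Y_def by (intro open_Int open_halfspace_Im_gt open_halfspace_Im_lt)
  have knz: "k s \<noteq> 0" if "s \<in> Y" for s
  proof
    assume "k s = 0"
    then have "X s = 0" by (simp add: k(2))
    then have "s \<in> Z" using that zeros[of s] by (auto simp: Z_def Y_def in_cbox_complex_iff)
    then show False using k(3) \<open>k s = 0\<close> by blast
  qed
  obtain \<kappa> where \<kappa>: "\<kappa> holomorphic_on Y" "\<And>s. s \<in> Y \<Longrightarrow> k s = exp (\<kappa> s)"
    using holomorphic_ln_convex[OF openY convY holomorphic_on_subset[OF k(1) subset_UNIV] knz] by blast
  have cont\<kappa>: "isCont \<kappa> s" if "s \<in> Y" for s
    using holomorphic_on_imp_continuous_on[OF \<kappa>(1)] openY that by (simp add: continuous_on_eq_continuous_at)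
  define E where "E = {s. Re s > 1/2} \<inter> Y"
  have Ln: "Re (s - \<rho>) > 0" if "s \<in> E" "\<rho> \<in> Z" for s \<rho>
    using that ReZ[of \<rho>] zeros[of \<rho>] by (auto simp: E_def Z_def)
  define q where "q = (\<lambda>s. H s - \<kappa> s - (\<Sum>\<rho>\<in>Z. of_nat (n \<rho>) * Ln (s - \<rho>)))"
  have "\<exists>d. \<forall>s\<in>E. q s = d"
  proof (rule continuous_exp_const_imp_const)
    show "connected E" unfolding E_def
      by (intro convex_connected convex_Int convex_halfspace_Re_gt convY)
    have "q holomorphic_on E"
      unfolding q_def using Ln Re_pos_not_nonpos
      by (intro holomorphic_intros holomorphic_on_subset[OF H(1)] holomorphic_on_subset[OF \<kappa>(1)])
         (auto simp: E_def)
    then show "continuous_on E q" by (rule holomorphic_on_imp_continuous_on)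
    fix s assume s: "s \<in> E"
    have "exp (\<Sum>\<rho>\<in>Z. of_nat (n \<rho>) * Ln (s - \<rho>)) = P s"
      unfolding P_def by (intro exp_sum_Ln finZ Ln s)
    moreover have "exp (H s) = exp (\<kappa> s) * P s"
      using H(2)[of s] s k(2) \<kappa>(2)[of s] by (simp add: E_def P_def)
    moreover have "exp (H s) \<noteq> 0" by simp
    ultimately show "exp (q s) = 1" by (simp add: q_def exp_diff)
  qed
  then obtain d where d: "\<And>s. s \<in> E \<Longrightarrow> q s = d" by blast
  define \<sigma> where "\<sigma> = (\<lambda>T \<delta>. Complex (1/2 + \<delta>) T)"
  have ImH: "Im (H (\<sigma> T2 \<delta>)) - Im (H (\<sigma> T1 \<delta>)) = Im (\<kappa> (\<sigma> T2 \<delta>)) - Im (\<kappa> (\<sigma> T1 \<delta>))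
      + (\<Sum>\<rho>\<in>Z. real (n \<rho>) * (Im (Ln (\<sigma> T2 \<delta> - \<rho>)) - Im (Ln (\<sigma> T1 \<delta> - \<rho>))))" if "\<delta> > 0" for \<delta>
  proof -
    have "\<sigma> T1 \<delta> \<in> E" "\<sigma> T2 \<delta> \<in> E" using that T(1) by (auto simp: \<sigma>_def E_def Y_def)
    then have "q (\<sigma> T2 \<delta>) = q (\<sigma> T1 \<delta>)" using d by simp
    then have "H (\<sigma> T2 \<delta>) - H (\<sigma> T1 \<delta>) = \<kappa> (\<sigma> T2 \<delta>) - \<kappa> (\<sigma> T1 \<delta>)
      + (\<Sum>\<rho>\<in>Z. of_nat (n \<rho>) * (Ln (\<sigma> T2 \<delta> - \<rho>) - Ln (\<sigma> T1 \<delta> - \<rho>)))"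
      by (simp add: q_def sum_subtractf algebra_simps)
    from arg_cong[OF this, of Im] show ?thesis by simp
  qed
  have \<sigma>: "((\<lambda>\<delta>. \<sigma> T \<delta>) \<longlongrightarrow> crit T) (at_right 0)" for T
    unfolding \<sigma>_def by (rule tendsto_eq_intros refl)+ simp_all
  have Y12: "crit t \<in> Y" if "T1 - 1 < t" "t < T2 + 1" for t using that by (simp add: Y_def)
  have lim\<kappa>: "((\<lambda>\<delta>. \<kappa> (\<sigma> T \<delta>)) \<longlongrightarrow> \<kappa> (crit T)) (at_right 0)" if "T = T1 \<or> T = T2" for T
    using that T(1) Y12[of T] by (intro isCont_tendsto_compose[OF cont\<kappa> \<sigma>]) auto
  \<comment> \<open>On the line s - rho = i y, with y nonzero because the endpoints are not zeros.
    The principal logarithm is continuous at such points and has imaginary part sgn y times pi /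
    2.\<close>
  have limLn: "((\<lambda>\<delta>. Im (Ln (\<sigma> T \<delta> - \<rho>))) \<longlongrightarrow> sgn (T - Im \<rho>) * (pi / 2)) (at_right 0)"
    if "T = T1 \<or> T = T2" "\<rho> \<in> Z" for T \<rho>
  proof -
    define y where "y = T - Im \<rho>"
    have "X \<rho> = 0" using that by (simp add: Z_def)
    then have y: "y \<noteq> 0" using T that ReZ[of \<rho>] unfolding y_def by (metis eq_iff_diff_eq_0)
    have eq: "crit T - \<rho> = \<i> * of_real y"
      using ReZ[OF that(2)] by (simp add: complex_eq_iff y_def)
    have "\<i> * of_real y \<notin> \<real>\<^sub>\<le>\<^sub>0" using y by (simp add: complex_nonpos_Reals_iff)
    then have "((\<lambda>\<delta>. Im (Ln (\<sigma> T \<delta> - \<rho>))) \<longlongrightarrow> Im (Ln (crit T - \<rho>))) (at_right 0)"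
      by (intro tendsto_Im tendsto_Ln tendsto_diff \<sigma> tendsto_const) (simp add: eq)
    moreover have "Im (Ln (\<i> * of_real y)) = sgn y * (pi / 2)"
    proof (cases "y > 0")
      case True
      have "Ln (of_real y * \<i>) = of_real (ln y) + Ln \<i>" using True by (subst Ln_times_of_real) (auto simp: Ln_of_real)
      then show ?thesis using True by (simp add: mult.commute)
    next
      case False
      have "Ln (of_real (-y) * (-\<i>)) = of_real (ln (-y)) + Ln (-\<i>)"
        using False y Ln_times_of_real[of "- y" "- \<i>"] Ln_of_real[of "- y"] by simp
      then show ?thesis using False y by (simp add: mult.commute)
    qed
    ultimately show ?thesis unfolding eq y_def[symmetric] by simp
  qed
  \<comment> \<open>Twice the imaginary part times i is \<open>\<kappa>\<close> minus its conjugate,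
    and its exponential is k / cnj k. On the line this quotient is \<open>\<omega>'\<close> wherever
    P does not vanish, and by continuity also at the heights of zeros.\<close>
  have "\<exists>c. \<forall>t\<in>{T1 - 1<..<T2 + 1}. 2 * \<i> * of_real (Im (\<kappa> (crit t))) = c"
  proof (rule continuous_exp_const_imp_const)
    define f where "f = (\<lambda>t. exp (2 * \<i> * of_real (Im (\<kappa> (crit t)))))"
    define \<omega>' where "\<omega>' = \<omega> * (\<Prod>\<rho>\<in>Z. (-1) ^ n \<rho>)"
    have isC: "isCont (\<lambda>t. \<kappa> (crit t)) t" if "t \<in> {T1 - 1<..<T2 + 1}" for t
    proof -
      show ?thesis using that by (intro isCont_o2[OF isCont_vertical_line] cont\<kappa> Y12) auto
    qed
    show "connected {T1 - 1<..<T2 + 1}" by simp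
    show "continuous_on {T1 - 1<..<T2 + 1} (\<lambda>t. 2 * \<i> * complex_of_real (Im (\<kappa> (crit t))))"
      by (intro continuous_at_imp_continuous_on ballI continuous_intros isCont_Im isC)
    fix t assume t: "t \<in> {T1 - 1<..<T2 + 1}"
    have fcont: "isCont f t" unfolding f_def using isC[OF t] by (intro continuous_intros isCont_Im)
    have "eventually (\<lambda>x. x \<in> {T1 - 1<..<T2 + 1}) (at t)"
      using t by (intro eventually_at_in_open') auto
    moreover have "eventually (\<lambda>x. x \<notin> Im ` Z) (at t)"
    proof -
      have "eventually (\<lambda>x. x \<in> - (Im ` Z - {t}) - {t}) (at t)"
        by (rule eventually_at_in_open[OF open_Compl[OF finite_imp_closed]]) (use finZ in auto)
      then show ?thesis by eventually_elim auto
    qed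
    ultimately have "eventually (\<lambda>x. f x = \<omega>') (at t)"
    proof eventually_elim
      case (elim x)
      define s where "s = crit x"
      have s: "1 - cnj s = s" by (simp add: s_def complex_eq_iff)
      have sY: "s \<in> Y" using Y12[of x] elim by (simp add: s_def)
      have "s \<notin> Z" using elim(2) by (metis complex.sel(2) imageI s_def)
      then have Ps: "P s \<noteq> 0" using finZ by (auto simp: P_def)
      have "cnj (P s) = (\<Prod>\<rho>\<in>Z. (- (s - \<rho>)) ^ n \<rho>)"
        unfolding P_def cnj_prod complex_cnj_power
      proof (intro prod.cong refl arg_cong[of _ _ "\<lambda>x. x ^ _"])
        fix \<rho> assume "\<rho> \<in> Z"
        then have "Re \<rho> = 1/2" using zeros by (simp add: Z_def)
        then show "cnj (s - \<rho>) = - (s - \<rho>)" by (simp add: s_def complex_eq_iff)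
      qed
      also have "\<dots> = (\<Prod>\<rho>\<in>Z. (-1) ^ n \<rho>) * P s"
        unfolding P_def prod.distrib[symmetric] by (intro prod.cong refl) (rule power_minus)
      finally have "k s * P s = \<omega>' * cnj (k s) * P s"
        using X(2)[of s] unfolding s kP complex_cnj_mult
        by (simp only: \<omega>'_def mult_ac)
      then have "k s = \<omega>' * cnj (k s)" using Ps by simp
      then have "exp (\<kappa> s) = \<omega>' * exp (cnj (\<kappa> s))" using \<kappa>(2)[OF sY] by (simp add: exp_cnj)
      then have "exp (\<kappa> s - cnj (\<kappa> s)) = \<omega>'" by (simp add: exp_diff)
      also have "\<kappa> s - cnj (\<kappa> s) = 2 * \<i> * of_real (Im (\<kappa> s))" by (simp add: complex_eq_iff)
      finally show ?case by (simp add: f_def s_def)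
    qed
    then have "(f \<longlongrightarrow> \<omega>') (at t)" by (rule tendsto_eventually)
    moreover have "(f \<longlongrightarrow> f t) (at t)" using fcont by (simp add: isCont_def)
    ultimately have "f t = \<omega>'" using tendsto_unique[of "at t"] by (simp add: trivial_limit_at)
    then show "exp (2 * \<i> * complex_of_real (Im (\<kappa> (crit t)))) = \<omega>'" by (simp add: f_def)
  qed
  then obtain c where c: "\<And>t. t \<in> {T1 - 1<..<T2 + 1} \<Longrightarrow> 2 * \<i> * of_real (Im (\<kappa> (crit t))) = c"
    by blast
  have "2 * \<i> * of_real (Im (\<kappa> (crit T1))) = 2 * \<i> * of_real (Im (\<kappa> (crit T2)))"
    using c[of T1] c[of T2] T(1) by simp
  then have \<kappa>eq: "Im (\<kappa> (crit T1)) = Im (\<kappa> (crit T2))" by simp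
  have "((\<lambda>\<delta>. Im (\<kappa> (\<sigma> T2 \<delta>)) - Im (\<kappa> (\<sigma> T1 \<delta>))
      + (\<Sum>\<rho>\<in>Z. real (n \<rho>) * (Im (Ln (\<sigma> T2 \<delta> - \<rho>)) - Im (Ln (\<sigma> T1 \<delta> - \<rho>))))) \<longlongrightarrow>
      Im (\<kappa> (crit T2)) - Im (\<kappa> (crit T1))
      + (\<Sum>\<rho>\<in>Z. real (n \<rho>) * (sgn (T2 - Im \<rho>) * (pi / 2) - sgn (T1 - Im \<rho>) * (pi / 2)))) (at_right 0)"
    by (intro tendsto_intros lim\<kappa> limLn) auto
  \<comment> \<open>A zero above or below both endpoints yields equal signs, which cancel; one in
    between contributes pi times its multiplicity.\<close>
  also have "(\<Sum>\<rho>\<in>Z. real (n \<rho>) * (sgn (T2 - Im \<rho>) * (pi / 2) - sgn (T1 - Im \<rho>) * (pi / 2)))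
      = (\<Sum>\<rho> | X \<rho> = 0 \<and> T1 < Im \<rho> \<and> Im \<rho> < T2. pi * real (n \<rho>))"
  proof (rule sum.mono_neutral_cong_right[OF finZ])
    show "{\<rho>. X \<rho> = 0 \<and> T1 < Im \<rho> \<and> Im \<rho> < T2} \<subseteq> Z"
    proof
      fix \<rho> assume \<rho>: "\<rho> \<in> {\<rho>. X \<rho> = 0 \<and> T1 < Im \<rho> \<and> Im \<rho> < T2}"
      then have "Re \<rho> = 1/2" using zeros by blast
      then show "\<rho> \<in> Z" using \<rho> by (auto simp: Z_def in_cbox_complex_iff)
    qed
    show "\<forall>\<rho>\<in>Z - {\<rho>. X \<rho> = 0 \<and> T1 < Im \<rho> \<and> Im \<rho> < T2}.
        real (n \<rho>) * (sgn (T2 - Im \<rho>) * (pi / 2) - sgn (T1 - Im \<rho>) * (pi / 2)) = 0"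
    proof
      fix \<rho> assume "\<rho> \<in> Z - {\<rho>. X \<rho> = 0 \<and> T1 < Im \<rho> \<and> Im \<rho> < T2}"
      then have "\<rho> \<in> Z" "X \<rho> = 0" "Im \<rho> \<le> T1 \<or> T2 \<le> Im \<rho>" by (auto simp: Z_def)
      moreover from this have "Im \<rho> \<noteq> T1" "Im \<rho> \<noteq> T2" using ReZ T by metis+
      ultimately show "real (n \<rho>) * (sgn (T2 - Im \<rho>) * (pi / 2) - sgn (T1 - Im \<rho>) * (pi / 2)) = 0"
        using T(1) by (auto simp: sgn_if)
    qed
    fix \<rho> assume "\<rho> \<in> {\<rho>. X \<rho> = 0 \<and> T1 < Im \<rho> \<and> Im \<rho> < T2}"
      then show "real (n \<rho>) * (sgn (T2 - Im \<rho>) * (pi / 2) - sgn (T1 - Im \<rho>) * (pi / 2)) = pi * real (n \<rho>)"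
        by (auto simp: sgn_if)
  qed
  also have "\<dots> = pi * (\<Sum>\<rho> | X \<rho> = 0 \<and> T1 < Im \<rho> \<and> Im \<rho> < T2. real_of_int (zorder X \<rho>))"
    unfolding sum_distrib_left
  proof (intro sum.cong refl)
    fix \<rho>
    have "zorder X \<rho> \<ge> 0" by (rule zorder_entire_nonneg[OF X(1) T(2)])
    then show "pi * real (n \<rho>) = pi * real_of_int (zorder X \<rho>)" by (simp add: n_def)
  qed
  finally have "((\<lambda>\<delta>. Im (\<kappa> (\<sigma> T2 \<delta>)) - Im (\<kappa> (\<sigma> T1 \<delta>))
      + (\<Sum>\<rho>\<in>Z. real (n \<rho>) * (Im (Ln (\<sigma> T2 \<delta> - \<rho>)) - Im (Ln (\<sigma> T1 \<delta> - \<rho>))))) \<longlongrightarrow>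
      pi * (\<Sum>\<rho> | X \<rho> = 0 \<and> T1 < Im \<rho> \<and> Im \<rho> < T2. real_of_int (zorder X \<rho>))) (at_right 0)"
    by (simp add: \<kappa>eq)
  then have "((\<lambda>\<delta>. Im (H (\<sigma> T2 \<delta>)) - Im (H (\<sigma> T1 \<delta>))) \<longlongrightarrow>
      pi * (\<Sum>\<rho> | X \<rho> = 0 \<and> T1 < Im \<rho> \<and> Im \<rho> < T2. real_of_int (zorder X \<rho>))) (at_right 0)"
    by (rule Lim_transform_eventually)
       (rule eventually_mono[OF eventually_at_right_less[of 0]], simp add: ImH)
  then show ?thesis by (simp add: \<sigma>_def)
qed

section \<open>Integrals along the critical line\<close>

text \<open>A primitive on the half-plane lets the vertical segment be replaced by the other three
  sides of a rectangle to its right. These have total length 4 T and stay at distance at least T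
  from 0, so decay of order |s|^(-3/2) makes their contribution vanish.\<close>

lemma vertical_integral_tendsto_0:
  assumes hol: "f holomorphic_on {s. Re s > 0}"
    and bound: "\<And>s. Re s \<ge> 1/2 \<Longrightarrow> norm s \<ge> 2 \<Longrightarrow> norm (f s) \<le> C / norm s powr (3/2)"
  shows "((\<lambda>T. integral {-T..T} (\<lambda>t. f (crit t))) \<longlongrightarrow> 0) at_top"
    and "(\<lambda>t. f (crit t)) integrable_on {a..b}"
proof -
  obtain P where "\<And>s. s \<in> {s. Re s > 0} \<Longrightarrow> (P has_field_derivative f s) (at s within {s. Re s > 0})"
    using holomorphic_convex_primitive'[OF convex_halfspace_Re_gt open_halfspace_Re_gt hol] by blast
  then have P: "(P has_field_derivative f s) (at s)" if "Re s > 0" for s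
    using that at_within_open[OF _ open_halfspace_Re_gt] by (metis mem_Collect_eq)
  have "isCont f s" if "Re s > 0" for s
    using holomorphic_on_imp_continuous_on[OF hol] that
    by (simp add: continuous_on_eq_continuous_at open_halfspace_Re_gt)
  then have "isCont (\<lambda>t. f (crit t)) t" for t
    by (intro isCont_o2[OF isCont_vertical_line]) auto
  then have cont: "continuous_on S (\<lambda>t. f (crit t))" for S
    by (intro continuous_at_imp_continuous_on) auto
  then show "(\<lambda>t. f (crit t)) integrable_on {a..b}" by (intro integrable_continuous_interval)
  have int: "integral {-T..T} (\<lambda>t. f (crit t)) = (P (crit T) - P (crit (-T))) / \<i>"
    if "T \<ge> 0" for T
  proof (rule integral_unique)
    have "((\<lambda>t. f (crit t)) has_integral (P (crit T) / \<i> - P (crit (-T)) / \<i>)) {-T..T}"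
    proof (rule fundamental_theorem_of_calculus)
      fix t
      have "((P \<circ> (\<lambda>t. crit t)) has_vector_derivative \<i> * f (crit t)) (at t within {-T..T})"
        by (rule field_vector_diff_chain_within[OF vertical_line_deriv]) (auto intro!: DERIV_subset[OF P])
      then show "((\<lambda>t. P (crit t) / \<i>) has_vector_derivative f (crit t)) (at t within {-T..T})"
        unfolding o_def by (auto intro!: derivative_eq_intros simp: field_simps has_vector_derivative_def)
    qed (use that in auto)
    then show "((\<lambda>t. f (crit t)) has_integral (P (crit T) - P (crit (-T))) / \<i>) {-T..T}"
      by (simp only: diff_divide_distrib)
  qed
  have seg: "norm (P b - P a) \<le> C / T powr (3/2) * norm (b - a)"
    if "T \<ge> 2" "\<And>s. s \<in> closed_segment a b \<Longrightarrow> Re s \<ge> 1/2 \<and> norm s \<ge> T" for a b T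
  proof (rule field_differentiable_bound[of "closed_segment a b"])
    fix s assume s: "s \<in> closed_segment a b"
    show "(P has_field_derivative f s) (at s within closed_segment a b)"
      using that(2)[OF s] by (intro DERIV_subset[OF P]) auto
    have C: "C \<ge> 0" using bound[of s] that(1) that(2)[OF s]
      by (smt (verit) divide_neg_pos norm_ge_zero powr_gt_zero)
    have "norm (f s) \<le> C / norm s powr (3/2)" using bound[of s] that(1) that(2)[OF s] by auto
    also have "\<dots> \<le> C / T powr (3/2)"
      using that(1) that(2)[OF s] C by (intro divide_left_mono powr_mono2) (auto intro!: mult_pos_pos)
    finally show "norm (f s) \<le> C / T powr (3/2)" .
  qed auto
  have main: "norm (integral {-T..T} (\<lambda>t. f (crit t))) \<le> C / T powr (3/2) * (4 * T)"
    if T: "T \<ge> 2" for T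
  proof -
    define q where "q = C / T powr (3/2)"
    define p0 p1 p2 p3 where "p0 = crit (-T)" and "p1 = Complex (1/2 + T) (-T)"
      and "p2 = Complex (1/2 + T) T" and "p3 = crit T"
    have far: "norm s \<ge> T" if "Re s \<ge> T \<or> Im s \<le> -T \<or> Im s \<ge> T" for s
      using that complex_Re_le_cmod[of s] abs_Im_le_cmod[of s] by linarith
    have sub: "closed_segment p0 p1 \<subseteq> {s. Re s \<ge> 1/2} \<inter> {s. Im s \<le> -T}"
      "closed_segment p1 p2 \<subseteq> {s. Re s \<ge> 1/2} \<inter> {s. Re s \<ge> T}"
      "closed_segment p2 p3 \<subseteq> {s. Re s \<ge> 1/2} \<inter> {s. Im s \<ge> T}"
      using T by (intro closed_segment_subset convex_Int convex_halfspace_Re_ge convex_halfspace_Im_le convex_halfspace_Im_ge;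
        simp add: p0_def p1_def p2_def p3_def)+
    have "norm (P p1 - P p0) \<le> q * norm (p1 - p0)"
         "norm (P p2 - P p1) \<le> q * norm (p2 - p1)"
         "norm (P p3 - P p2) \<le> q * norm (p3 - p2)"
      by (rule seg[OF T, folded q_def], use sub far in blast)+
    moreover have "norm (p1 - p0) = T" "norm (p2 - p1) = 2 * T" "norm (p3 - p2) = T"
      using T by (simp_all add: p0_def p1_def p2_def p3_def cmod_def real_sqrt_mult)
    moreover have "norm (P p3 - P p0) \<le> norm (P p1 - P p0) + norm (P p2 - P p1) + norm (P p3 - P p2)"
      using norm_triangle_ineq[of "P p3 - P p2" "P p2 - P p0"] norm_triangle_ineq[of "P p2 - P p1" "P p1 - P p0"]
      by simp
    ultimately have "norm (P p3 - P p0) \<le> q * (4 * T)" by (simp add: algebra_simps)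
    then show ?thesis using T by (simp add: int norm_divide norm_mult q_def p3_def p0_def)
  qed
  have "((\<lambda>T. C / T powr (3/2) * (4 * T)) \<longlongrightarrow> 0) at_top" by real_asymp
  then show "((\<lambda>T. integral {-T..T} (\<lambda>t. f (crit t))) \<longlongrightarrow> 0) at_top"
    by (rule Lim_null_comparison[rotated]) (rule eventually_mono[OF eventually_ge_at_top[of 2] main])
qed

section \<open>Powers of 1 - 1/s on the critical line\<close>

definition crit_w :: "real \<Rightarrow> complex" where
  "crit_w t = 1 - 1 / crit t"

lemma crit_line_norm: "complex_of_real (1/4 + t ^ 2) = crit t * (1 - crit t)"
  "norm (crit t) ^ 2 = 1/4 + t ^ 2" "crit t \<noteq> 0" "1/4 + t ^ 2 > (0::real)"
proof -
  show "norm (crit t) ^ 2 = 1/4 + t ^ 2"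
    unfolding cmod_power2 by (simp add: power2_eq_square)
qed (auto simp: complex_eq_iff power2_eq_square add_pos_nonneg)

text \<open>With s = 1/2 + it the weight 1/4 + t^2 is s (1 - s), and w = (s - 1) / s, so the factor
  s - 1 cancels. One power of w thus removes the pole of the reciprocal weight at s = 1 when the
  expression is continued off the line.\<close>

lemma crit_w_div_norm: "crit_w t / of_real (1/4 + t ^ 2) = - 1 / crit t ^ 2"
proof -
  have "crit t \<noteq> 0" "1 - crit t \<noteq> 0" by (auto simp: complex_eq_iff)
  then show ?thesis
    unfolding crit_w_def crit_line_norm by (simp add: divide_simps power2_eq_square)
qed

lemma norm_crit_w [simp]: "norm (crit_w t) = 1"
proof -
  have "norm (crit t - 1) = norm (crit t)"
    by (simp add: cmod_def power2_eq_square)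
  moreover have "crit_w t = (crit t - 1) / crit t"
    using crit_line_norm(3)[of t] by (simp add: crit_w_def diff_divide_distrib)
  ultimately show ?thesis using crit_line_norm(3)[of t] by (simp add: norm_divide)
qed

text \<open>The point w moves on the unit circle with angular velocity - 1 / (1/4 + t^2), so powers
  of w against this weight have elementary primitives.\<close>

lemma crit_w_power_deriv:
  "((\<lambda>t. crit_w t ^ k) has_vector_derivative (- \<i> * of_nat k * crit_w t ^ k / of_real (1/4 + t ^ 2))) (at t within S)"
proof -
  have "((\<lambda>s. 1 - 1 / s) has_field_derivative 1 / crit t ^ 2) (at (crit t))"
    using crit_line_norm(3)[of t] by (auto intro!: derivative_eq_intros simp: power2_eq_square)
  from DERIV_power[OF this, of k]
  have "((\<lambda>s. (1 - 1 / s) ^ k) has_field_derivative of_nat k * (1 / crit t ^ 2) * crit_w t ^ (k - 1)) (at (crit t))"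
    by (simp add: crit_w_def mult.assoc)
  then have "(((\<lambda>s. (1 - 1 / s) ^ k) \<circ> (\<lambda>t. crit t)) has_vector_derivative
      \<i> * (of_nat k * (1 / crit t ^ 2) * crit_w t ^ (k - 1))) (at t within S)"
    by (rule field_vector_diff_chain_within[OF vertical_line_deriv has_field_derivative_at_within])
  moreover have "\<i> * (of_nat k * (1 / crit t ^ 2) * crit_w t ^ (k - 1)) = - \<i> * of_nat k * crit_w t ^ k / of_real (1/4 + t ^ 2)"
  proof (cases k)
    case (Suc j)
    have "- \<i> * of_nat k * crit_w t ^ k / of_real (1/4 + t ^ 2) = - \<i> * of_nat k * crit_w t ^ j * (crit_w t / of_real (1/4 + t ^ 2))"
      using Suc by simp
    then show ?thesis unfolding crit_w_div_norm using Suc by simp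
  qed simp
  ultimately show ?thesis by (simp add: o_def crit_w_def)
qed

lemma isCont_crit_w [continuous_intros]: "isCont (\<lambda>t. crit_w t) t"
  using has_vector_derivative_continuous[OF crit_w_power_deriv[of 1 t UNIV]] by simp

lemma crit_w_Re_Im_deriv:
  "((\<lambda>t. Re (crit_w t ^ k)) has_real_derivative (real k * Im (crit_w t ^ k) / (1/4 + t ^ 2))) (at t within S)"
  "((\<lambda>t. Im (crit_w t ^ k)) has_real_derivative (- real k * Re (crit_w t ^ k) / (1/4 + t ^ 2))) (at t within S)"
  using crit_w_power_deriv[of k t S] unfolding has_vector_derivative_complex_iff
  by (simp_all del: of_real_add of_real_power of_real_divide add: Re_divide_of_real Im_divide_of_real)

lemma crit_w_minus: "crit_w (- t) = cnj (crit_w t)"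
  by (simp add: crit_w_def complex_eq_iff Re_divide Im_divide)

lemma crit_w_tendsto: "(crit_w \<longlongrightarrow> 1) at_top"
proof -
  have "((\<lambda>t. 1 / crit t) \<longlongrightarrow> 0) at_top"
  proof (rule Lim_null_comparison)
    show "eventually (\<lambda>t. norm (1 / crit t) \<le> 1 / t) at_top"
      using eventually_gt_at_top[of 0]
    proof eventually_elim
      case (elim t)
      have "t \<le> norm (crit t)" using abs_Im_le_cmod[of "crit t"] by simp
      then show ?case using elim by (simp add: norm_divide frac_le)
    qed
    show "((\<lambda>t::real. 1 / t) \<longlongrightarrow> 0) at_top" by real_asymp
  qed
  then have "((\<lambda>t. 1 - 1 / crit t) \<longlongrightarrow> 1 - 0) at_top" by (intro tendsto_intros)
  then show ?thesis by (simp add: crit_w_def[abs_def])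
qed

lemma crit_w_power_tendsto:
  "((\<lambda>t. Re (crit_w t ^ k)) \<longlongrightarrow> 1) at_top" "((\<lambda>t. Im (crit_w t ^ k)) \<longlongrightarrow> 0) at_top"
  "((\<lambda>t. Re (crit_w (- t) ^ k)) \<longlongrightarrow> 1) at_top" "((\<lambda>t. Im (crit_w (- t) ^ k)) \<longlongrightarrow> 0) at_top"
proof -
  have 1: "((\<lambda>t. crit_w t ^ k) \<longlongrightarrow> 1 ^ k) at_top" by (intro tendsto_intros crit_w_tendsto)
  have 2: "((\<lambda>t. crit_w (- t) ^ k) \<longlongrightarrow> cnj 1 ^ k) at_top"
    unfolding crit_w_minus by (intro tendsto_intros crit_w_tendsto)
  show "((\<lambda>t. Re (crit_w t ^ k)) \<longlongrightarrow> 1) at_top" "((\<lambda>t. Im (crit_w t ^ k)) \<longlongrightarrow> 0) at_top"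
    using tendsto_Re[OF 1] tendsto_Im[OF 1] by simp_all
  show "((\<lambda>t. Re (crit_w (- t) ^ k)) \<longlongrightarrow> 1) at_top" "((\<lambda>t. Im (crit_w (- t) ^ k)) \<longlongrightarrow> 0) at_top"
    using tendsto_Re[OF 2] tendsto_Im[OF 2] by simp_all
qed

section \<open>Elementary integrals against the weight 1 / (1/4 + t^2)\<close>

lemma arctan_2_limits:
  "((\<lambda>t. arctan (2 * t)) \<longlongrightarrow> pi / 2) at_top" "((\<lambda>t. arctan (2 * - t)) \<longlongrightarrow> - (pi / 2)) at_top"
  by real_asymp+

text \<open>The primitive is - Im (w^k) / k, and w tends to 1 at both ends, so the boundary terms
  vanish.\<close>

lemma crit_integral_Re_power:
  assumes "k \<ge> 1"
  shows "((\<lambda>T. integral {-T..T} (\<lambda>t. Re (crit_w t ^ k) / (1/4 + t ^ 2))) \<longlongrightarrow> 0) at_top"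
proof -
  have "((\<lambda>T. - Im (crit_w T ^ k) / k - (- Im (crit_w (-T) ^ k) / k)) \<longlongrightarrow> - 0 / k - (- 0 / k)) at_top"
    using assms by (intro tendsto_intros crit_w_power_tendsto) auto
  moreover have "eventually (\<lambda>T. - Im (crit_w T ^ k) / k - (- Im (crit_w (-T) ^ k) / k) =
      integral {-T..T} (\<lambda>t. Re (crit_w t ^ k) / (1/4 + t ^ 2))) at_top"
    using eventually_ge_at_top[of 0]
  proof eventually_elim
    case (elim T)
    show ?case
    proof (rule sym, rule integral_unique, rule fundamental_theorem_of_calculus)
      fix t :: real
      have "((\<lambda>t. - Im (crit_w t ^ k) / k) has_real_derivative - (- real k * Re (crit_w t ^ k) / (1/4 + t ^ 2)) / k) (at t within {-T..T})"
        by (intro DERIV_cdivide DERIV_minus crit_w_Re_Im_deriv)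
      then show "((\<lambda>t. - Im (crit_w t ^ k) / k) has_vector_derivative Re (crit_w t ^ k) / (1/4 + t ^ 2)) (at t within {-T..T})"
        using assms by (simp add: has_real_derivative_iff_has_vector_derivative)
    qed (use elim in auto)
  qed
  ultimately show ?thesis by (simp add: tendsto_cong)
qed

lemma crit_integral_1:
  "((\<lambda>T. integral {-T..T} (\<lambda>t. 1 / (1/4 + t ^ 2))) \<longlongrightarrow> 2 * pi) at_top"
proof -
  have "((\<lambda>T. 2 * arctan (2 * T) - 2 * arctan (2 * - T)) \<longlongrightarrow> 2 * (pi / 2) - 2 * (- (pi / 2))) at_top"
    by (intro tendsto_intros arctan_2_limits)
  moreover have "eventually (\<lambda>T. 2 * arctan (2 * T) - 2 * arctan (2 * - T) = integral {-T..T} (\<lambda>t. 1 / (1/4 + t ^ 2))) at_top"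
    using eventually_ge_at_top[of 0]
  proof eventually_elim
    case (elim T)
    show ?case
    proof (rule sym, rule integral_unique, rule fundamental_theorem_of_calculus)
      fix t :: real
      have "1 + (2 * t) ^ 2 > 0" by (simp add: add_pos_nonneg)
      then show "((\<lambda>t. 2 * arctan (2 * t)) has_vector_derivative 1 / (1/4 + t ^ 2)) (at t within {-T..T})"
        unfolding has_real_derivative_iff_has_vector_derivative[symmetric]
        by (auto intro!: derivative_eq_intros simp: field_simps power2_eq_square)
    qed (use elim in auto)
  qed
  ultimately show ?thesis by (simp add: tendsto_cong)
qed

lemma crit_integral_Im_arctan:
  assumes "k \<ge> 1"
  shows "((\<lambda>T. integral {-T..T} (\<lambda>t. Im (crit_w t ^ k) * arctan (2 * t) / (1/4 + t ^ 2))) \<longlongrightarrow> pi / k) at_top"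
proof -
  \<comment> \<open>Integration by parts: Re (w^k) / k is a primitive of Im (w^k) against the
    weight, and the derivative 1 / (2 (1/4 + t^2)) of arctan (2 t) leaves a remainder accounted for
    by the second summand. Only the first summand has nonzero limits, pi / (2 k) and its
    negative.\<close>
  define V where "V = (\<lambda>t. Re (crit_w t ^ k) * arctan (2 * t) / k + Im (crit_w t ^ k) / (2 * real k ^ 2))"
  have "((\<lambda>T. V T - V (-T)) \<longlongrightarrow> (1 * (pi / 2) / k + 0 / (2 * real k ^ 2)) - (1 * (- (pi / 2)) / k + 0 / (2 * real k ^ 2))) at_top"
    unfolding V_def using assms by (intro tendsto_intros crit_w_power_tendsto arctan_2_limits) auto
  moreover have "eventually (\<lambda>T. V T - V (-T) =
      integral {-T..T} (\<lambda>t. Im (crit_w t ^ k) * arctan (2 * t) / (1/4 + t ^ 2))) at_top"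
    using eventually_ge_at_top[of 0]
  proof eventually_elim
    case (elim T)
    show ?case
    proof (rule sym, rule integral_unique, rule fundamental_theorem_of_calculus)
      fix t :: real
      have "1 + (2 * t) ^ 2 > 0" by (simp add: add_pos_nonneg)
      moreover have "(arctan has_real_derivative 1 / (1 + (2 * t) ^ 2)) (at (2 * t))"
        by (auto intro!: derivative_eq_intros simp: divide_inverse)
      then have "((\<lambda>t. arctan (2 * t)) has_real_derivative (1 / (1 + (2 * t) ^ 2) * 2)) (at t within {-T..T})"
        by (rule DERIV_chain2) (auto intro!: derivative_eq_intros)
      moreover have "1 / (1 + (2 * t) ^ 2) * 2 = 1 / (2 * (1/4 + t ^ 2))"
        using calculation by (simp add: field_simps power2_eq_square)
      ultimately have at: "((\<lambda>t. arctan (2 * t)) has_real_derivative 1 / (2 * (1/4 + t ^ 2))) (at t within {-T..T})"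
        by simp
      have "(V has_real_derivative
          (real k * Im (crit_w t ^ k) / (1/4 + t ^ 2) * arctan (2 * t) + 1 / (2 * (1/4 + t ^ 2)) * Re (crit_w t ^ k)) / k
          + (- real k * Re (crit_w t ^ k) / (1/4 + t ^ 2)) / (2 * real k ^ 2)) (at t within {-T..T})"
        unfolding V_def by (intro DERIV_add DERIV_cdivide DERIV_mult crit_w_Re_Im_deriv at)
      moreover have "(real k * Im (crit_w t ^ k) / (1/4 + t ^ 2) * arctan (2 * t) + 1 / (2 * (1/4 + t ^ 2)) * Re (crit_w t ^ k)) / k
          + (- real k * Re (crit_w t ^ k) / (1/4 + t ^ 2)) / (2 * real k ^ 2) = Im (crit_w t ^ k) * arctan (2 * t) / (1/4 + t ^ 2)"
      proof -
        have alg: "(K * I / N * A + 1 / (2 * N) * R) / K + (- K * R / N) / (2 * K ^ 2) = I * A / N"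
          if "K \<noteq> 0" "N \<noteq> 0" for K I N A R :: real
          using that by (simp add: field_simps power2_eq_square)
        show ?thesis by (rule alg) (use assms crit_line_norm(4)[of t] in auto)
      qed
      ultimately show "(V has_vector_derivative Im (crit_w t ^ k) * arctan (2 * t) / (1/4 + t ^ 2)) (at t within {-T..T})"
        by (simp add: has_real_derivative_iff_has_vector_derivative)
    qed (use elim in auto)
  qed
  ultimately show ?thesis by (simp add: tendsto_cong)
qed

text \<open>From ln x <= x - 1 at x = sqrt |s|; the slack absorbs pi / 2. Against a decay of order
  |s|^(-2) this leaves the exponent 3/2 needed for the contour shift.\<close>

lemma Ln_norm_le_sqrt:
  assumes "Re s \<ge> 0" "norm s \<ge> 2"
  shows "norm (Ln s) \<le> 2 * norm s powr (1/2)"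
proof -
  have "ln (sqrt (norm s)) \<le> sqrt (norm s) - 1" using assms by (intro ln_le_minus_one) auto
  then have "ln (norm s) \<le> 2 * sqrt (norm s) - 2" using assms by (subst (asm) ln_sqrt) auto
  moreover have "norm (Ln s) \<le> \<bar>ln (norm s)\<bar> + pi / 2" using assms by (intro Ln_norm_le) auto
  moreover have "ln (norm s) \<ge> 0" using assms by simp
  ultimately show ?thesis using pi_less_4 by (simp add: powr_half_sqrt)
qed

text \<open>The integrand is the restriction to the line of a function holomorphic on Re s > 0, so
  the integral vanishes by moving the contour to the right. The only candidate for a pole is s = 1:
  for k >= 1 a factor w cancels it, and for k = 0 the zero of Ln at 1 does.\<close>

lemma crit_integral_Ln:
  "((\<lambda>T. integral {-T..T} (\<lambda>t. crit_w t ^ k * Ln (crit t) / of_real (1/4 + t ^ 2))) \<longlongrightarrow> 0) at_top"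
  "(\<lambda>t. crit_w t ^ k * Ln (crit t) / of_real (1/4 + t ^ 2)) integrable_on {a..b}"
proof -
  obtain f C where f: "f holomorphic_on {s. Re s > 0}"
    "\<And>s. Re s \<ge> 1/2 \<Longrightarrow> norm s \<ge> 2 \<Longrightarrow> norm (f s) \<le> C / norm s powr (3/2)"
    "\<And>t. f (crit t) = crit_w t ^ k * Ln (crit t) / of_real (1/4 + t ^ 2)"
  proof (cases k)
    case 0
    \<comment> \<open>The value at the removable singularity is the limit of Ln s / (s (1 - s)) at
      1.\<close>
    define f where "f = (\<lambda>s. if s = 1 then - 1 else Ln s / (s * (1 - s)))"
    have "f holomorphic_on {s. Re s > 0}"
    proof (rule no_isolated_singularity')
      show "open {s. Re s > 0}" "finite {1::complex}" by (auto simp: open_halfspace_Re_gt)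
      have "(\<lambda>s. Ln s / (s * (1 - s))) holomorphic_on {s. Re s > 0} - {1}"
        by (intro holomorphic_intros) (use Re_pos_not_nonpos in auto)
      then show "f holomorphic_on {s. Re s > 0} - {1}"
        by (rule holomorphic_transform) (auto simp: f_def)
      fix z assume "z \<in> {1::complex}"
      then have z: "z = 1" by simp
      have "(Ln has_field_derivative 1) (at 1)"
        by (auto intro!: derivative_eq_intros)
      then have "((\<lambda>s. (Ln s - Ln 1) / (s - 1)) \<longlongrightarrow> 1) (at 1)"
        by (simp add: has_field_derivative_iff)
      then have "((\<lambda>s. - ((Ln s - Ln 1) / (s - 1)) / s) \<longlongrightarrow> - 1 / 1) (at 1)"
        by (intro tendsto_intros) auto
      then have "(f \<longlongrightarrow> - 1 / 1) (at 1)"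
      proof (rule Lim_transform_eventually)
        have "eventually (\<lambda>s. s \<noteq> (1::complex)) (at 1)" by (simp add: eventually_at_filter)
        moreover have "eventually (\<lambda>s. s \<noteq> (0::complex)) (at 1)"
          using t1_space_nhds[of "1::complex" 0] by (auto simp: eventually_at_filter elim: eventually_mono)
        ultimately show "eventually (\<lambda>s. - ((Ln s - Ln 1) / (s - 1)) / s = f s) (at 1)"
        proof eventually_elim
          case (elim s)
          then have "s - 1 \<noteq> 0" "1 - s \<noteq> 0" by auto
          then show ?case using elim by (simp add: f_def divide_simps) (simp add: algebra_simps)
        qed
      qed
      then show "(f \<longlongrightarrow> f z) (at z within {s. Re s > 0})"
        by (simp add: z f_def tendsto_within_subset[OF _ subset_UNIV])
    qed
    moreover have "norm (f s) \<le> 4 / norm s powr (3/2)" if s: "Re s \<ge> 1/2" "norm s \<ge> 2" for s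
    proof -
      have "norm s \<le> norm (1 - s) + 1" using norm_triangle_ineq4[of 1 "1 - s"] by simp
      then have "norm (1 - s) \<ge> norm s / 2" using s by linarith
      then have "norm s * norm (1 - s) \<ge> norm s * (norm s / 2)" by (intro mult_left_mono) auto
      moreover have "norm (Ln s) \<le> 2 * norm s powr (1/2)" using s by (intro Ln_norm_le_sqrt) auto
      ultimately have "norm (Ln s) / (norm s * norm (1 - s)) \<le> 2 * norm s powr (1/2) / (norm s * (norm s / 2))"
        using s by (intro frac_le) (auto simp: zero_less_mult_iff)
      also have "\<dots> = 4 * (norm s powr (1/2) / norm s powr 2)"
        using s by (simp add: power2_eq_square)
      also have "norm s powr (1/2) / norm s powr 2 = norm s powr (1/2 - 2)"
        by (rule powr_diff[symmetric])
      also have "\<dots> = 1 / norm s powr (3/2)"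
        by (simp add: powr_minus_divide[symmetric])
      finally show ?thesis using s by (auto simp: f_def norm_divide norm_mult)
    qed
    moreover have "f (crit t) = crit_w t ^ k * Ln (crit t) / of_real (1/4 + t ^ 2)" for t
      unfolding crit_line_norm f_def using 0 by (auto simp: complex_eq_iff)
    ultimately show ?thesis using that by blast
  next
    case (Suc j)
    define f where "f = (\<lambda>s. - ((1 - 1 / s) ^ j * Ln s / s ^ 2))"
    have "f holomorphic_on {s. Re s > 0}"
      unfolding f_def by (intro holomorphic_intros) (use Re_pos_not_nonpos in auto)
    moreover have "norm (f s) \<le> 2 / norm s powr (3/2)" if s: "Re s \<ge> 1/2" "norm s \<ge> 2" for s
    proof -
      have s0: "s \<noteq> 0" using s by auto
      have "norm (s - 1) \<le> norm s"
        unfolding cmod_def using s by (intro real_sqrt_le_mono) (simp add: power2_eq_square algebra_simps)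
      moreover have "1 - 1 / s = (s - 1) / s" using s0 by (simp add: diff_divide_distrib)
      ultimately have "norm (1 - 1 / s) \<le> 1" using s0 by (simp add: norm_divide)
      then have "norm ((1 - 1 / s) ^ j) \<le> 1" by (simp add: norm_power power_le_one)
      moreover have "norm (Ln s) \<le> 2 * norm s powr (1/2)" using s by (intro Ln_norm_le_sqrt) auto
      ultimately have "norm ((1 - 1 / s) ^ j) * norm (Ln s) \<le> 1 * (2 * norm s powr (1/2))"
        by (intro mult_mono) auto
      then have "norm (f s) \<le> 2 * norm s powr (1/2) / norm s ^ 2"
        by (simp add: f_def norm_divide norm_mult norm_power divide_right_mono)
      also have "\<dots> = 2 * (norm s powr (1/2) / norm s powr 2)"
        using s by simp
      also have "norm s powr (1/2) / norm s powr 2 = norm s powr (1/2 - 2)"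
        by (rule powr_diff[symmetric])
      also have "\<dots> = 1 / norm s powr (3/2)"
        by (simp add: powr_minus_divide[symmetric])
      finally show ?thesis by simp
    qed
    moreover have "f (crit t) = crit_w t ^ k * Ln (crit t) / of_real (1/4 + t ^ 2)" for t
    proof -
      have "crit_w t ^ k * Ln (crit t) / of_real (1/4 + t ^ 2) =
        crit_w t ^ j * Ln (crit t) * (crit_w t / of_real (1/4 + t ^ 2))" by (simp add: Suc)
      then show ?thesis unfolding crit_w_div_norm by (simp add: f_def crit_w_def)
    qed
    ultimately show ?thesis using that by blast
  qed
  show "((\<lambda>T. integral {-T..T} (\<lambda>t. crit_w t ^ k * Ln (crit t) / of_real (1/4 + t ^ 2))) \<longlongrightarrow> 0) at_top"
    using vertical_integral_tendsto_0(1)[OF f(1,2)] f(3) by simp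
  show "(\<lambda>t. crit_w t ^ k * Ln (crit t) / of_real (1/4 + t ^ 2)) integrable_on {a..b}"
    using vertical_integral_tendsto_0(2)[OF f(1,2)] f(3) by simp
qed

text \<open>Since 1 - w = 1 / s, the weight identity reads w / (1/4 + t^2) = - (1 - w)^2, and
  multiplying by w^n produces a second difference in n.\<close>

lemma crit_w_second_difference:
  "1 - Re (crit_w t ^ (n + 2)) = 2 * (1 - Re (crit_w t ^ (n + 1))) - (1 - Re (crit_w t ^ n))
     + Re (crit_w t ^ (n + 1)) / (1/4 + t ^ 2)"
proof -
  define w where "w = crit_w t"
  have "w / of_real (1/4 + t ^ 2) = - ((1 - w) ^ 2)"
    unfolding w_def crit_w_div_norm by (simp add: crit_w_def power_divide)
  then have "w ^ (n + 1) / of_real (1/4 + t ^ 2) = - (w ^ n * (1 - w) ^ 2)"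
    by (metis mult_minus_right power_add power_one_right times_divide_eq_right)
  also have "\<dots> = 2 * w ^ (n + 1) - w ^ n - w ^ (n + 2)"
    by (simp add: power2_eq_square algebra_simps)
  finally have "w ^ (n + 1) / of_real (1/4 + t ^ 2) = 2 * w ^ (n + 1) - w ^ n - w ^ (n + 2)" .
  from arg_cong[OF this, of Re] show ?thesis
    unfolding w_def[symmetric] Re_divide_of_real by simp
qed

lemma isCont_crit_w_power: "isCont (\<lambda>t. Re (crit_w t ^ k)) t" "isCont (\<lambda>t. Im (crit_w t ^ k)) t"
  using crit_w_Re_Im_deriv[of k t UNIV] DERIV_isCont by blast+

text \<open>On the critical line this sums the Fejer kernel by second differences in \<open>n\<close>.\<close>
lemma crit_integral_recursion:
  fixes g :: "real \<Rightarrow> real"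
  assumes g: "\<And>t. isCont g t"
    and c: "\<And>k. ((\<lambda>T. integral {-T..T} (\<lambda>t. Re (crit_w t ^ k) * g t / (1/4 + t ^ 2))) \<longlongrightarrow> c k) at_top"
    and L: "L 0 = 0" "L 1 = c 0 / 2" "\<And>n. L (n + 2) = 2 * L (n + 1) - L n + c (n + 1)"
  shows "((\<lambda>T. integral {-T..T} (\<lambda>t. (1 - Re (crit_w t ^ n)) * g t)) \<longlongrightarrow> L n) at_top"
proof (induction n rule: induct_nat_012)
  case 0
  show ?case using L by simp
next
  case 1
  have "(1 - Re (crit_w t ^ 1)) = 1 / (1/4 + t ^ 2) / 2" for t
    by (simp add: crit_w_def Re_divide power2_eq_square)
  then have "(\<lambda>t. (1 - Re (crit_w t ^ 1)) * g t) = (\<lambda>t. Re (crit_w t ^ 0) * g t / (1/4 + t ^ 2) / 2)"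
    by (simp add: fun_eq_iff)
  moreover have "((\<lambda>T. integral {-T..T} (\<lambda>t. Re (crit_w t ^ 0) * g t / (1/4 + t ^ 2)) / 2) \<longlongrightarrow> c 0 / 2) at_top"
    by (intro tendsto_divide c tendsto_const) simp
  ultimately show ?case unfolding One_nat_def[symmetric] L(2) by (simp only: integral_divide)
next
  case (ge2 n)
  have int: "(\<lambda>t. (1 - Re (crit_w t ^ k)) * g t) integrable_on {a..b}"
            "(\<lambda>t. Re (crit_w t ^ k) * g t / (1/4 + t ^ 2)) integrable_on {a..b}" for k a b
    using crit_line_norm(4)
    by (intro integrable_continuous_interval continuous_at_imp_continuous_on ballI continuous_intros
        isCont_crit_w_power g; simp add: less_imp_neq[symmetric])+
  have eq: "integral {-T..T} (\<lambda>t. (1 - Re (crit_w t ^ (n + 2))) * g t) =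
      2 * integral {-T..T} (\<lambda>t. (1 - Re (crit_w t ^ (n + 1))) * g t)
      - integral {-T..T} (\<lambda>t. (1 - Re (crit_w t ^ n)) * g t)
      + integral {-T..T} (\<lambda>t. Re (crit_w t ^ (n + 1)) * g t / (1/4 + t ^ 2))" for T
  proof (rule integral_unique)
    have "((\<lambda>t. 2 * ((1 - Re (crit_w t ^ (n + 1))) * g t) - (1 - Re (crit_w t ^ n)) * g t + Re (crit_w t ^ (n + 1)) * g t / (1/4 + t ^ 2))
      has_integral (2 * integral {-T..T} (\<lambda>t. (1 - Re (crit_w t ^ (n + 1))) * g t)
      - integral {-T..T} (\<lambda>t. (1 - Re (crit_w t ^ n)) * g t)
      + integral {-T..T} (\<lambda>t. Re (crit_w t ^ (n + 1)) * g t / (1/4 + t ^ 2)))) {-T..T}"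
      by (intro has_integral_add has_integral_diff has_integral_mult_right integrable_integral int)
    then show "((\<lambda>t. (1 - Re (crit_w t ^ (n + 2))) * g t) has_integral (2 * integral {-T..T} (\<lambda>t. (1 - Re (crit_w t ^ (n + 1))) * g t)
      - integral {-T..T} (\<lambda>t. (1 - Re (crit_w t ^ n)) * g t)
      + integral {-T..T} (\<lambda>t. Re (crit_w t ^ (n + 1)) * g t / (1/4 + t ^ 2)))) {-T..T}"
      unfolding crit_w_second_difference by (simp add: algebra_simps)
  qed
  have "((\<lambda>T. integral {-T..T} (\<lambda>t. (1 - Re (crit_w t ^ (n + 2))) * g t)) \<longlongrightarrow> 2 * L (n + 1) - L n + c (n + 1)) at_top"
    unfolding eq using ge2 by (intro tendsto_intros c) simp_all
  then show ?case unfolding L(3)[symmetric] by simp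
qed

text \<open>The second differences \<open>c k\<close> vanish for k >= 1, so the limit is linear in
  n, with slope c 0 / 2 = pi.\<close>

lemma crit_integral_const:
  "((\<lambda>T. integral {-T..T} (\<lambda>t. 1 - Re (crit_w t ^ n))) \<longlongrightarrow> pi * n) at_top"
proof -
  define c where "c = (\<lambda>k::nat. if k = 0 then 2 * pi else 0)"
  have "((\<lambda>T. integral {-T..T} (\<lambda>t. (1 - Re (crit_w t ^ n)) * 1)) \<longlongrightarrow> pi * n) at_top"
  proof (rule crit_integral_recursion)
    fix k show "((\<lambda>T. integral {-T..T} (\<lambda>t. Re (crit_w t ^ k) * 1 / (1/4 + t ^ 2))) \<longlongrightarrow> c k) at_top"
      using crit_integral_Re_power[of k] crit_integral_1 by (cases "k = 0") (auto simp: c_def)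
  qed (auto simp: c_def algebra_simps)
  then show ?thesis by simp
qed

section \<open>The integral against ln |s| and the harmonic numbers\<close>

lemma Im_Ln_crit: "Im (Ln (crit t)) = arctan (2 * t)"
proof -
  have "Ln (crit t) = Ln (of_real (norm (crit t)) * cis (arctan (2 * t)))"
  proof -
    have "1/2 = norm (crit t) * cos (arctan (2 * t))" "t = norm (crit t) * sin (arctan (2 * t))"
    proof -
      have *: "norm (crit t) = sqrt (1 + (2 * t) ^ 2) / 2"
      proof -
        have "sqrt (1 + (2 * t) ^ 2) / 2 = sqrt ((1 + (2 * t) ^ 2) / 4)"
          by (simp add: real_sqrt_divide)
        then show ?thesis by (simp add: cmod_def power2_eq_square add_divide_distrib)
      qed
      have "sqrt (1 + (2 * t) ^ 2) > 0" by (simp add: add_pos_nonneg)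
      then have "sqrt (1 + (2 * t) ^ 2) \<noteq> 0" by linarith
      then show "1/2 = norm (crit t) * cos (arctan (2 * t))" "t = norm (crit t) * sin (arctan (2 * t))"
        unfolding * cos_arctan sin_arctan by (simp_all add: field_simps)
    qed
    then have "crit t = of_real (norm (crit t)) * cis (arctan (2 * t))"
      by (simp add: complex_eq_iff)
    then show ?thesis by simp
  qed
  also have "\<dots> = of_real (ln (norm (crit t))) + Ln (cis (arctan (2 * t)))"
    using crit_line_norm(3)[of t] Ln_times_of_real[of "norm (crit t)" "cis (arctan (2 * t))"]
    by (simp add: Ln_of_real)
  also have "Ln (cis (arctan (2 * t))) = \<i> * arctan (2 * t)"
    using arctan_bounded[of "2 * t"] by (subst Ln_cis) auto
  finally show ?thesis by simp
qed

text \<open>The real part of w^k Ln s is Re (w^k) ln |s| - Im (w^k) arctan (2 t). Its weighted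
  integral tends to 0, so the logarithmic integrals have the limits of the arctangent ones: 0 for k
  = 0 and pi / k otherwise. The recursion with second differences pi / (n + 1) and two vanishing
  initial values is solved by pi (n H_n - n).\<close>

lemma crit_integral_ln:
  "((\<lambda>T. integral {-T..T} (\<lambda>t. (1 - Re (crit_w t ^ n)) * ln (norm (crit t)))) \<longlongrightarrow>
     pi * (n * harm n - n)) at_top"
proof -
  define c where "c = (\<lambda>k::nat. if k = 0 then 0 else pi / k)"
  define g where "g = (\<lambda>t. ln (norm (crit t)))"
  have g: "isCont g t" for t
    unfolding g_def using crit_line_norm(3)[of t]
    by (intro continuous_intros isCont_vertical_line) auto
  have "((\<lambda>T. integral {-T..T} (\<lambda>t. (1 - Re (crit_w t ^ n)) * g t)) \<longlongrightarrow> pi * (n * harm n - n)) at_top"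
  proof (rule crit_integral_recursion[OF g])
    fix k
    define F where "F = (\<lambda>t. crit_w t ^ k * Ln (crit t) / of_real (1/4 + t ^ 2))"
    define R where "R = (\<lambda>t. Im (crit_w t ^ k) * arctan (2 * t) / (1/4 + t ^ 2))"
    have Rint: "R integrable_on {a..b}" for a b
      unfolding R_def using crit_line_norm(4)
      by (intro integrable_continuous_interval continuous_at_imp_continuous_on ballI continuous_intros
        isCont_crit_w_power; simp add: less_imp_neq[symmetric])
    have eq: "integral {-T..T} (\<lambda>t. Re (crit_w t ^ k) * g t / (1/4 + t ^ 2)) = Re (integral {-T..T} F) + integral {-T..T} R" for T
    proof (rule integral_unique)
      have "(F has_integral integral {-T..T} F) {-T..T}"
        unfolding F_def by (intro integrable_integral crit_integral_Ln)
      then have "((\<lambda>t. Re (F t)) has_integral Re (integral {-T..T} F)) {-T..T}"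
        using has_integral_linear[OF _ bounded_linear_Re] by (force simp: o_def)
      then have "((\<lambda>t. Re (F t) + R t) has_integral (Re (integral {-T..T} F) + integral {-T..T} R)) {-T..T}"
        by (intro has_integral_add integrable_integral Rint)
      moreover have "Re (F t) + R t = Re (crit_w t ^ k) * g t / (1/4 + t ^ 2)" for t
        using crit_line_norm(3)[of t] unfolding F_def R_def Re_divide_of_real
        by (simp add: Im_Ln_crit g_def diff_divide_distrib)
      ultimately show "((\<lambda>t. Re (crit_w t ^ k) * g t / (1/4 + t ^ 2)) has_integral (Re (integral {-T..T} F) + integral {-T..T} R)) {-T..T}"
        by simp
    qed
    have R: "((\<lambda>T. integral {-T..T} R) \<longlongrightarrow> c k) at_top"
      using crit_integral_Im_arctan[of k] unfolding R_def c_def by (cases "k = 0") auto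
    have "((\<lambda>T. Re (integral {-T..T} F) + integral {-T..T} R) \<longlongrightarrow> Re 0 + c k) at_top"
      using R unfolding F_def by (intro tendsto_add tendsto_Re crit_integral_Ln(1))
    then show "((\<lambda>T. integral {-T..T} (\<lambda>t. Re (crit_w t ^ k) * g t / (1/4 + t ^ 2))) \<longlongrightarrow> c k) at_top"
      by (simp add: eq)
  next
    fix n :: nat
    have "harm (n + 1) = harm n + 1 / real (n + 1)" "harm (n + 2) = harm n + 1 / real (n + 1) + 1 / real (n + 2)"
      by (simp_all add: harm_Suc inverse_eq_divide)
    moreover have "real (n + 2) / real (n + 1) = 1 + 1 / real (n + 1)" by (simp add: field_simps)
    ultimately have "real (n + 1) * harm (n + 1) = real (n + 1) * harm n + 1"
      "real (n + 2) * harm (n + 2) = real (n + 2) * harm n + 1 + 1 / real (n + 1) + 1"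
      by (simp_all add: distrib_left del: of_nat_add)
    then show "pi * (real (n + 2) * harm (n + 2) - real (n + 2)) = 2 * (pi * (real (n + 1) * harm (n + 1) - real (n + 1)))
        - pi * (real n * harm n - real n) + c (n + 1)"
      unfolding c_def by (simp only:) (simp add: algebra_simps)
  qed (auto simp: c_def harm_def)
  then show ?thesis by (simp add: g_def)
qed

section \<open>Partial summation over zeros\<close>

text \<open>Completeness along the integers gives the limit. Its explicit distance from
  \<open>D U\<close> is kept because the error is later read off at one chosen height.\<close>

lemma limit_at_top_of_Cauchy_bound:
  fixes D :: "real \<Rightarrow> 'a :: banach"
  assumes D: "\<And>U T. 1 \<le> U \<Longrightarrow> U \<le> T \<Longrightarrow> norm (D T - D U) \<le> \<beta> U"
    and \<beta>: "(\<beta> \<longlongrightarrow> 0) at_top"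
  shows "\<exists>e. (D \<longlongrightarrow> e) at_top \<and> (\<forall>U\<ge>1. norm (e - D U) \<le> \<beta> U)"
proof -
  have small: "\<exists>N\<ge>1. \<beta> N < e" if "e > 0" for e
  proof -
    have "eventually (\<lambda>U. \<beta> U < e \<and> U \<ge> 1) at_top"
      using order_tendstoD(2)[OF \<beta> that] eventually_ge_at_top by (rule eventually_conj)
    then show ?thesis using eventually_happens'[OF trivial_limit_at_top_linorder] by blast
  qed
  have "Cauchy (\<lambda>k. D (real k))"
  proof (rule CauchyI')
    fix e :: real assume "e > 0"
    then obtain N where N: "N \<ge> 1" "\<beta> N < e / 2" using small[of "e / 2"] by auto
    obtain K where K: "N \<le> real K" using real_arch_simple by blast
    have "norm (D (real m) - D (real n)) < e" if "m \<ge> K" "n > m" for m n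
    proof -
      have "norm (D (real m) - D N) \<le> \<beta> N" "norm (D (real n) - D N) \<le> \<beta> N"
        using that K N by (auto intro!: D)
      then show ?thesis
        using N norm_triangle_ineq4[of "D (real m) - D N" "D (real n) - D N"] by simp
    qed
    then show "\<exists>M. \<forall>m\<ge>M. \<forall>n>m. dist (D (real m)) (D (real n)) < e" by (auto simp: dist_norm)
  qed
  then obtain e where e: "(\<lambda>k. D (real k)) \<longlonglongrightarrow> e" using Cauchy_convergent convergent_def by blast
  have bound: "norm (e - D U) \<le> \<beta> U" if U: "U \<ge> 1" for U
  proof (rule Lim_norm_ubound)
    show "(\<lambda>k. D (real k) - D U) \<longlonglongrightarrow> e - D U" by (intro tendsto_intros e)
    have "eventually (\<lambda>k. real k \<ge> U) sequentially"
      using filterlim_real_sequentially by (auto simp: filterlim_at_top)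
    then show "eventually (\<lambda>k. norm (D (real k) - D U) \<le> \<beta> U) sequentially"
      by eventually_elim (use U in \<open>auto intro!: D\<close>)
  qed simp
  have "((\<lambda>U. D U - e) \<longlongrightarrow> 0) at_top"
  proof (rule Lim_null_comparison[OF _ \<beta>])
    show "eventually (\<lambda>U. norm (D U - e) \<le> \<beta> U) at_top"
      by (rule eventually_mono[OF eventually_ge_at_top[of 1]]) (subst norm_minus_commute, rule bound)
  qed
  then show ?thesis using bound by (auto simp: LIM_zero_iff)
qed

lemma ln_over_antimono:
  fixes U T :: real
  assumes "1 \<le> U" "U \<le> T"
  shows "(ln (T + 2) + 1) / T \<le> (ln (U + 2) + 1) / U"
    and "((\<lambda>t. ln (t + 2) / t ^ 2) integrable_on {U..T})"
    and "integral {U..T} (\<lambda>t. ln (t + 2) / t ^ 2) \<le> (ln (U + 2) + 1) / U"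
proof -
  \<comment> \<open>\<open>g\<close> is the derivative of - (ln (t + 2) + 1) / t; the added 1 in the
    numerator outweighs the term 1 / (t (t + 2)), so g dominates ln (t + 2) / t^2.\<close>
  define g where "g = (\<lambda>t::real. (ln (t + 2) + 1) / t ^ 2 - 1 / (t * (t + 2)))"
  have le: "ln (t + 2) / t ^ 2 \<le> g t" "0 \<le> ln (t + 2) / t ^ 2" if "t \<in> {U..T}" for t :: real
  proof -
    have "1 / (t * (t + 2)) \<le> 1 / t ^ 2"
      using that assms unfolding power2_eq_square by (intro divide_left_mono mult_left_mono) auto
    then show "ln (t + 2) / t ^ 2 \<le> g t" by (simp add: g_def add_divide_distrib)
    show "0 \<le> ln (t + 2) / t ^ 2" using that assms by simp
  qed
  have "(g has_integral (- ((ln (T + 2) + 1) / T) - - ((ln (U + 2) + 1) / U))) {U..T}"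
  proof (rule fundamental_theorem_of_calculus[OF assms(2)])
    fix t assume "t \<in> {U..T}"
    then have t: "t > 0" "t \<noteq> 0" "t + 2 \<noteq> 0" "t + 2 > 0" using assms by auto
    have "((\<lambda>t. - ((ln (t + 2) + 1) / t)) has_real_derivative - ((1 / (t + 2) * t - (ln (t + 2) + 1) * 1) / (t * t))) (at t within {U..T})"
      using t by (intro DERIV_minus DERIV_divide) (auto intro!: derivative_eq_intros)
    moreover have "- ((1 / (t + 2) * t - (ln (t + 2) + 1) * 1) / (t * t)) = g t"
      using t by (simp add: g_def power2_eq_square diff_divide_distrib)
    ultimately show "((\<lambda>t. - ((ln (t + 2) + 1) / t)) has_vector_derivative g t) (at t within {U..T})"
      by (simp add: has_real_derivative_iff_has_vector_derivative)
  qed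
  note g = this
  show int: "((\<lambda>t. ln (t + 2) / t ^ 2) integrable_on {U..T})"
    using assms by (intro integrable_continuous_interval continuous_intros) auto
  have "0 \<le> integral {U..T} (\<lambda>t. ln (t + 2) / t ^ 2)" by (rule integral_nonneg[OF int]) (use le in auto)
  moreover have i: "integral {U..T} (\<lambda>t. ln (t + 2) / t ^ 2) \<le> - ((ln (T + 2) + 1) / T) - - ((ln (U + 2) + 1) / U)"
    by (rule has_integral_le[OF integrable_integral[OF int] g]) (use le in auto)
  ultimately show "(ln (T + 2) + 1) / T \<le> (ln (U + 2) + 1) / U" by linarith
  have "(ln (T + 2) + 1) / T \<ge> 0" using assms by (intro divide_nonneg_nonneg add_nonneg_nonneg ln_ge_zero) auto
  then show "integral {U..T} (\<lambda>t. ln (t + 2) / t ^ 2) \<le> (ln (U + 2) + 1) / U" using i by linarith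
qed

text \<open>Abel summation: \<open>f T - f (\<gamma> i)\<close> is the integral of f' over the
  heights from \<open>\<gamma> i\<close> to T, and summing the indicators of these intervals with
  the weights \<open>m i\<close> gives the counting function.\<close>

lemma partial_summation_aux:
  fixes Z :: "'i set" and \<gamma> :: "'i \<Rightarrow> real" and m :: "'i \<Rightarrow> real" and f f' :: "real \<Rightarrow> complex"
  assumes fin: "finite {i \<in> Z. \<gamma> i \<le> T}" and UT: "U \<le> T"
    and f: "\<And>t. (f has_vector_derivative f' t) (at t)"
  defines "Nt \<equiv> (\<lambda>t. \<Sum>i | i \<in> Z \<and> \<gamma> i \<le> t. m i)"
    and "S \<equiv> (\<lambda>t. \<Sum>i | i \<in> Z \<and> \<gamma> i \<le> t. of_real (m i) * f (\<gamma> i))"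
  shows "((\<lambda>t. of_real (Nt t - Nt U) * f' t) has_integral (of_real (Nt T - Nt U) * f T - (S T - S U))) {U..T}"
proof -
  define A where "A = {i \<in> Z. U < \<gamma> i \<and> \<gamma> i \<le> T}"
  have finA: "finite A" using fin by (rule rev_finite_subset) (auto simp: A_def)
  have finle: "finite {i \<in> Z. \<gamma> i \<le> t}" if "t \<le> T" for t
    using fin by (rule rev_finite_subset) (use that in auto)
  have split: "(\<Sum>i | i \<in> Z \<and> \<gamma> i \<le> t. h i) - (\<Sum>i | i \<in> Z \<and> \<gamma> i \<le> U. h i) = (\<Sum>i | i \<in> A \<and> \<gamma> i \<le> t. h i)"
    if "U \<le> t" "t \<le> T" for t and h :: "'i \<Rightarrow> 'b :: ab_group_add"
  proof -
    have "{i \<in> Z. \<gamma> i \<le> t} = {i \<in> Z. \<gamma> i \<le> U} \<union> {i \<in> A. \<gamma> i \<le> t}"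
      using that by (auto simp: A_def)
    moreover have "sum h ({i \<in> Z. \<gamma> i \<le> U} \<union> {i \<in> A. \<gamma> i \<le> t}) = sum h {i \<in> Z. \<gamma> i \<le> U} + sum h {i \<in> A. \<gamma> i \<le> t}"
      by (intro sum.union_disjoint finle[OF UT] finite_subset[OF _ finA]) (auto simp: A_def)
    ultimately have "sum h {i \<in> Z. \<gamma> i \<le> t} = sum h {i \<in> Z. \<gamma> i \<le> U} + sum h {i \<in> A. \<gamma> i \<le> t}"
      by (simp only:)
    then show ?thesis by simp
  qed
  have "((\<lambda>t. of_real (m i) * (if t \<in> {\<gamma> i..T} then f' t else 0)) has_integral (of_real (m i) * (f T - f (\<gamma> i)))) {U..T}"
    if "i \<in> A" for i
  proof (rule has_integral_mult_right)
    have "(f' has_integral (f T - f (\<gamma> i))) {\<gamma> i..T}"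
      using that by (intro fundamental_theorem_of_calculus has_vector_derivative_at_within[OF f]) (auto simp: A_def)
    then show "((\<lambda>t. if t \<in> {\<gamma> i..T} then f' t else 0) has_integral (f T - f (\<gamma> i))) {U..T}"
      using that by (subst has_integral_restrict) (auto simp: A_def)
  qed
  then have I1: "((\<lambda>t. \<Sum>i\<in>A. of_real (m i) * (if t \<in> {\<gamma> i..T} then f' t else 0)) has_integral
      (\<Sum>i\<in>A. of_real (m i) * (f T - f (\<gamma> i)))) {U..T}"
    by (intro has_integral_sum finA)
  have I2: "(\<Sum>i\<in>A. of_real (m i) * (if t \<in> {\<gamma> i..T} then f' t else 0)) = of_real (Nt t - Nt U) * f' t"
    if "t \<in> {U..T}" for t
  proof -
    have "(\<Sum>i\<in>A. of_real (m i) * (if t \<in> {\<gamma> i..T} then f' t else 0)) = (\<Sum>i\<in>A. if \<gamma> i \<le> t then of_real (m i) * f' t else 0)"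
      using that by (intro sum.cong) auto
    also have "\<dots> = (\<Sum>i | i \<in> A \<and> \<gamma> i \<le> t. of_real (m i) * f' t)" by (rule sum.inter_filter[OF finA, symmetric])
    also have "\<dots> = of_real (\<Sum>i | i \<in> A \<and> \<gamma> i \<le> t. m i) * f' t" by (simp add: sum_distrib_right)
    finally show ?thesis unfolding Nt_def using that split[of t m] by simp
  qed
  have I3: "(\<Sum>i\<in>A. of_real (m i) * (f T - f (\<gamma> i))) = of_real (Nt T - Nt U) * f T - (S T - S U)"
  proof -
    have "{i \<in> A. \<gamma> i \<le> T} = A" by (auto simp: A_def)
    then have "S T - S U = (\<Sum>i\<in>A. of_real (m i) * f (\<gamma> i))" "Nt T - Nt U = (\<Sum>i\<in>A. m i)"
      unfolding S_def Nt_def using split[OF UT order_refl, of m] split[OF UT order_refl, of "\<lambda>i. of_real (m i) * f (\<gamma> i)"]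
      by simp_all
    then show ?thesis by (simp add: sum_distrib_right sum_subtractf right_diff_distrib)
  qed
  show ?thesis by (rule has_integral_eq[OF I2 I1[unfolded I3]])
qed

text \<open>Subtracting the Abel identity for the smooth count \<open>M\<close> from the one for the
  true count leaves only their difference E = O(log). Tails beyond U therefore differ by O(n log U /
  U), which gives both the existence of the limit and its distance from the value at U. Below U the
  bound 2 for f against a count of O(U log U) suffices. Neither the sum nor the integral is claimed
  to converge alone.\<close>

lemma partial_summation:
  fixes Z :: "'i set" and \<gamma> :: "'i \<Rightarrow> real" and m :: "'i \<Rightarrow> real" and M M' :: "real \<Rightarrow> real"
    and f f' :: "nat \<Rightarrow> real \<Rightarrow> complex"
  assumes fin: "\<And>T. finite {i \<in> Z. \<gamma> i \<le> T}" and m0: "\<And>i. i \<in> Z \<Longrightarrow> m i \<ge> 0"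
    and N: "\<And>t. t \<ge> 0 \<Longrightarrow> \<bar>(\<Sum>i | i \<in> Z \<and> \<gamma> i \<le> t. m i) - M t\<bar> \<le> C * ln (t + 2)"
    and M: "\<And>t. (M has_real_derivative M' t) (at t)" "continuous_on UNIV M'" "M 0 = 0"
    and M'_le: "\<And>t. t \<ge> 0 \<Longrightarrow> \<bar>M' t\<bar> \<le> D * ln (t + 2)"
    and f: "\<And>n t. (f n has_vector_derivative f' n t) (at t)"
      "\<And>n t. norm (f n t) \<le> 2" "\<And>n t. t > 0 \<Longrightarrow> norm (f n t) \<le> n / t"
      "\<And>n t. t > 0 \<Longrightarrow> norm (f' n t) \<le> n / t ^ 2"
  shows "\<exists>K. \<forall>n\<ge>1. \<exists>e. ((\<lambda>T. (\<Sum>i | i \<in> Z \<and> \<gamma> i \<le> T. of_real (m i) * f n (\<gamma> i))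
            - integral {0..T} (\<lambda>t. f n t * of_real (M' t))) \<longlongrightarrow> e) at_top
          \<and> norm e \<le> K * (sqrt n * (ln (sqrt n + 2) + 1))"
proof -
  define Nt where "Nt = (\<lambda>t. \<Sum>i | i \<in> Z \<and> \<gamma> i \<le> t. m i)"
  define E where "E = (\<lambda>t. Nt t - M t)"
  have E: "\<bar>E t\<bar> \<le> C * ln (t + 2)" if "t \<ge> 0" for t using N[OF that] by (simp add: E_def Nt_def)
  have "0 \<le> C * ln 2" "0 \<le> D * ln 2" using E[of 0] M'_le[of 0] by simp_all
  then have CD: "C \<ge> 0" "D \<ge> 0" using ln_gt_zero[of "2::real"] by (auto simp: zero_le_mult_iff)
  have "\<exists>e. ((\<lambda>T. (\<Sum>i | i \<in> Z \<and> \<gamma> i \<le> T. of_real (m i) * f n (\<gamma> i))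
            - integral {0..T} (\<lambda>t. f n t * of_real (M' t))) \<longlongrightarrow> e) at_top
          \<and> norm e \<le> (4 * D + 6 * C) * (sqrt n * (ln (sqrt n + 2) + 1))" if n: "n \<ge> 1" for n :: nat
  proof -
    define S where "S = (\<lambda>t. \<Sum>i | i \<in> Z \<and> \<gamma> i \<le> t. of_real (m i) * f n (\<gamma> i))"
    define \<Delta> where "\<Delta> = (\<lambda>T. S T - integral {0..T} (\<lambda>t. f n t * of_real (M' t)))"
    have cont_f: "continuous_on X (f n)" for X
      by (intro continuous_at_imp_continuous_on ballI has_vector_derivative_continuous[OF f(1)])
    have int: "(\<lambda>t. f n t * of_real (M' t)) integrable_on {a..b}" for a b
      by (intro integrable_continuous_interval continuous_intros cont_f continuous_on_subset[OF M(2)]) auto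
    \<comment> \<open>The boundary term and the integral with f' contribute 2 C n (ln (U + 2) + 1) /
      U each.\<close>
    define \<beta> where "\<beta> = (\<lambda>U. 4 * C * n * ((ln (U + 2) + 1) / U))"
    have step: "norm (\<Delta> T - \<Delta> U) \<le> \<beta> U" if UT: "1 \<le> U" "U \<le> T" for U T
    proof -
      have 1: "((\<lambda>t. of_real (Nt t - Nt U) * f' n t) has_integral (of_real (Nt T - Nt U) * f n T - (S T - S U))) {U..T}"
        unfolding Nt_def S_def by (rule partial_summation_aux[OF fin UT(2) f(1)])
      have "((\<lambda>t. of_real (M t - M U) * f' n t + of_real (M' t) * f n t) has_integral
          (of_real (M T - M U) * f n T - of_real (M U - M U) * f n U)) {U..T}"
      proof (rule fundamental_theorem_of_calculus[OF UT(2)])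
        fix t
        have "((\<lambda>t. complex_of_real (M t - M U)) has_vector_derivative of_real (M' t)) (at t within {U..T})"
          by (intro has_vector_derivative_of_real) (auto intro!: derivative_eq_intros DERIV_subset[OF M(1)])
        then show "((\<lambda>t. of_real (M t - M U) * f n t) has_vector_derivative of_real (M t - M U) * f' n t + of_real (M' t) * f n t) (at t within {U..T})"
          by (intro has_vector_derivative_mult has_vector_derivative_at_within[OF f(1)])
      qed
      from has_integral_diff[OF this integrable_integral[OF int, of U T]]
      have 2: "((\<lambda>t. of_real (M t - M U) * f' n t) has_integral
          (of_real (M T - M U) * f n T - integral {U..T} (\<lambda>t. f n t * of_real (M' t)))) {U..T}"
        by (simp add: mult.commute)
      have "integral {0..U} (\<lambda>t. f n t * of_real (M' t)) + integral {U..T} (\<lambda>t. f n t * of_real (M' t)) =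
          integral {0..T} (\<lambda>t. f n t * of_real (M' t))"
        using UT by (intro Henstock_Kurzweil_Integration.integral_combine int) auto
      then have eq: "(of_real (Nt T - Nt U) * f n T - (S T - S U)) - (of_real (M T - M U) * f n T - integral {U..T} (\<lambda>t. f n t * of_real (M' t)))
          = of_real (E T - E U) * f n T - (\<Delta> T - \<Delta> U)"
        by (simp add: E_def \<Delta>_def algebra_simps)
      have eq': "(\<lambda>t. of_real (Nt t - Nt U) * f' n t - of_real (M t - M U) * f' n t) = (\<lambda>t. of_real (E t - E U) * f' n t)"
        by (simp add: fun_eq_iff E_def algebra_simps)
      have 3: "((\<lambda>t. of_real (E t - E U) * f' n t) has_integral (of_real (E T - E U) * f n T - (\<Delta> T - \<Delta> U))) {U..T}"
        using has_integral_diff[OF 1 2] unfolding eq eq' .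
      have EU: "\<bar>E t - E U\<bar> \<le> 2 * C * ln (t + 2)" if "U \<le> t" for t
      proof -
        have "C * ln (U + 2) \<le> C * ln (t + 2)" using that UT CD by (intro mult_left_mono) auto
        then show ?thesis using E[of t] E[of U] that UT by auto
      qed
      have "norm (integral {U..T} (\<lambda>t. of_real (E t - E U) * f' n t)) \<le> integral {U..T} (\<lambda>t. 2 * C * n * (ln (t + 2) / t ^ 2))"
      proof (rule integral_norm_bound_integral)
        show "(\<lambda>t. of_real (E t - E U) * f' n t) integrable_on {U..T}" using 3 by blast
        show "(\<lambda>t. 2 * C * n * (ln (t + 2) / t ^ 2)) integrable_on {U..T}"
          by (intro integrable_on_mult_right ln_over_antimono UT)
        fix t assume t: "t \<in> {U..T}"
        have "norm (of_real (E t - E U) * f' n t) = \<bar>E t - E U\<bar> * norm (f' n t)"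
          by (simp only: norm_mult norm_of_real)
        also have "\<dots> \<le> (2 * C * ln (t + 2)) * (n / t ^ 2)"
          using t UT CD by (intro mult_mono EU f(4)) auto
        finally show "norm (of_real (E t - E U) * f' n t) \<le> 2 * C * n * (ln (t + 2) / t ^ 2)" by (simp add: mult_ac)
      qed
      also have "\<dots> = 2 * C * n * integral {U..T} (\<lambda>t. ln (t + 2) / t ^ 2)"
        by (rule integral_mult_right)
      also have "\<dots> \<le> 2 * C * n * ((ln (U + 2) + 1) / U)"
        using CD by (intro mult_left_mono ln_over_antimono UT) auto
      finally have 4: "norm (of_real (E T - E U) * f n T - (\<Delta> T - \<Delta> U)) \<le> 2 * C * n * ((ln (U + 2) + 1) / U)"
        using integral_unique[OF 3] by simp
      have "norm (of_real (E T - E U) * f n T) = \<bar>E T - E U\<bar> * norm (f n T)"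
        by (simp only: norm_mult norm_of_real)
      also have "\<dots> \<le> (2 * C * ln (T + 2)) * (n / T)"
        using UT CD by (intro mult_mono EU f(3)) auto
      also have "\<dots> = 2 * C * n * (ln (T + 2) / T)" by simp
      also have "\<dots> \<le> 2 * C * n * ((ln (T + 2) + 1) / T)"
        using UT CD by (intro mult_left_mono divide_right_mono) auto
      also have "\<dots> \<le> 2 * C * n * ((ln (U + 2) + 1) / U)"
        using CD by (intro mult_left_mono ln_over_antimono UT) auto
      finally have "norm (of_real (E T - E U) * f n T) \<le> 2 * C * n * ((ln (U + 2) + 1) / U)" .
      then have "norm (\<Delta> T - \<Delta> U) \<le> 2 * C * n * ((ln (U + 2) + 1) / U) + 2 * C * n * ((ln (U + 2) + 1) / U)"
        using 4 norm_triangle_sub[of "\<Delta> T - \<Delta> U" "of_real (E T - E U) * f n T"]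
          norm_minus_commute[of "\<Delta> T - \<Delta> U" "of_real (E T - E U) * f n T"]
        by linarith
      also have "\<dots> = \<beta> U" by (simp add: \<beta>_def)
      finally show ?thesis .
    qed
    have "(\<beta> \<longlongrightarrow> 0) at_top" unfolding \<beta>_def by real_asymp
    from limit_at_top_of_Cauchy_bound[OF step this]
    obtain e where e: "(\<Delta> \<longlongrightarrow> e) at_top" "\<And>U. U \<ge> 1 \<Longrightarrow> norm (e - \<Delta> U) \<le> \<beta> U" by blast
    \<comment> \<open>Here n / U = U, so the tail has the size of the part below U. The constant 4 D
      + 6 C collects 4 D + 2 C from below U and 4 C from the tail.\<close>
    define U where "U = sqrt n"
    define L where "L = ln (U + 2)"
    have U: "U \<ge> 1" "U * U = n" using n by (auto simp: U_def)
    have L: "L \<ge> 0" using U by (simp add: L_def)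
    have M'L: "\<bar>M' t\<bar> \<le> D * L" if "t \<in> {0..U}" for t
    proof -
      have "D * ln (t + 2) \<le> D * L" unfolding L_def using that CD by (intro mult_left_mono) auto
      then show ?thesis using M'_le[of t] that by simp
    qed
    have MI: "(M' has_integral (M U - M 0)) {0..U}"
      using U by (intro fundamental_theorem_of_calculus)
        (auto simp: has_real_derivative_iff_has_vector_derivative[symmetric] intro!: DERIV_subset[OF M(1)])
    have "norm (M U - M 0) \<le> D * L * measure lborel {0..U}"
      by (rule has_integral_bound_real[OF _ finite.emptyI MI]) (use CD L M'L in auto)
    then have MU: "\<bar>M U\<bar> \<le> D * L * U" using M(3) U by simp
    have "norm (integral {0..U} (\<lambda>t. f n t * of_real (M' t))) \<le> 2 * (D * L) * measure lborel {0..U}"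
    proof (rule has_integral_bound_real[OF _ finite.emptyI integrable_integral[OF int]])
      fix t assume "t \<in> {0..U} - {}"
      then have "norm (f n t) * \<bar>M' t\<bar> \<le> 2 * (D * L)" by (intro mult_mono f M'L) auto
      then show "norm (f n t * of_real (M' t)) \<le> 2 * (D * L)" by (simp add: norm_mult)
    qed (use CD L in auto)
    then have I: "norm (integral {0..U} (\<lambda>t. f n t * of_real (M' t))) \<le> 2 * D * L * U" using U by simp
    have "norm (S U) \<le> (\<Sum>i | i \<in> Z \<and> \<gamma> i \<le> U. m i * 2)"
      unfolding S_def by (intro sum_norm_le) (use m0 f(2) in \<open>auto simp: norm_mult intro!: mult_left_mono\<close>)
    also have "\<dots> = 2 * Nt U" by (simp add: Nt_def sum_distrib_left mult.commute)
    also have "\<dots> \<le> 2 * (D * L * U + C * L)" using E[of U] MU U by (simp add: E_def L_def)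
    finally have "norm (\<Delta> U) \<le> 2 * (D * L * U + C * L) + 2 * D * L * U"
      using I norm_triangle_ineq4[of "S U" "integral {0..U} (\<lambda>t. f n t * of_real (M' t))"] by (simp add: \<Delta>_def)
    also have "\<dots> = 4 * D * (U * L) + 2 * C * L" by (simp add: algebra_simps)
    also have "\<dots> \<le> 4 * D * (U * (L + 1)) + 2 * C * (U * (L + 1))"
    proof (intro add_mono mult_left_mono)
      have "1 * (L + 1) \<le> U * (L + 1)" using U L by (intro mult_right_mono) auto
      then show "L \<le> U * (L + 1)" by (rule order_trans[rotated]) simp
    qed (use U L CD in auto)
    finally have "norm (\<Delta> U) \<le> 4 * D * (U * (L + 1)) + 2 * C * (U * (L + 1))" .
    moreover have "\<beta> U = 4 * C * (U * (L + 1))"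
    proof -
      have nU: "real n / U = U" using U by (simp add: field_simps)
      have "\<beta> U = 4 * C * n * ((L + 1) / U)" by (simp only: \<beta>_def L_def)
      also have "\<dots> = 4 * C * (real n / U * (L + 1))" by simp
      finally show ?thesis by (simp only: nU)
    qed
    moreover have "norm e \<le> norm (e - \<Delta> U) + norm (\<Delta> U)" using norm_triangle_ineq[of "e - \<Delta> U" "\<Delta> U"] by simp
    ultimately have "norm e \<le> (4 * D + 6 * C) * (U * (L + 1))"
      using e(2)[OF U(1)] by (simp add: distrib_right)
    then show ?thesis using e(1) unfolding \<Delta>_def S_def U_def L_def by blast
  qed
  then show ?thesis by blast
qed

section \<open>The Euler product\<close>

text \<open>For Re s >= 3 and theta < 1 the term belonging to p^(k+1) is O(p^(-2(k+1))), so the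
  double series over primes and exponents converges normally. Its sum is a bounded continuous
  logarithm of F, which controls F from above and from below.\<close>

lemma Euler_product_exp:
  fixes b :: "nat \<Rightarrow> complex" and F :: "complex \<Rightarrow> complex"
  assumes b: "\<And>p k. prime p \<Longrightarrow> k \<ge> 1 \<Longrightarrow> norm (b (p ^ k)) \<le> C * real p powr (real k * \<theta>)"
    and \<theta>: "\<theta> < 1"
    and lim: "\<And>s. Re s > 1 \<Longrightarrow> (\<lambda>N. \<Prod>p\<in>{p. prime p \<and> p \<le> N}.
                 exp (\<Sum>k. b (p ^ Suc k) / of_nat (p ^ Suc k) powr s)) \<longlonglongrightarrow> F s"
  shows "\<exists>P B. continuous_on {s. Re s \<ge> 3} P \<and> (\<forall>s. Re s \<ge> 3 \<longrightarrow> norm (P s) \<le> B \<and> F s = exp (P s))"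
proof -
  define H where "H = {s. Re s \<ge> (3::real)}"
  define u where "u = (\<lambda>p k s. b (p ^ Suc k) / of_nat (p ^ Suc k) powr s)"
  define q where "q = (\<lambda>p s. if prime p then (\<Sum>k. u p k s) else 0)"
  have u_le: "norm (u p k s) \<le> \<bar>C\<bar> / real p ^ 2 * (1/4) ^ k" if p: "prime p" and s: "s \<in> H" for p k s
  proof -
    have p2: "real p \<ge> 2" using prime_ge_2_nat[OF p] by simp
    have "norm (u p k s) = norm (b (p ^ Suc k)) / real (p ^ Suc k) powr Re s"
      using p2 by (simp add: u_def norm_divide norm_powr_real_powr)
    also have "real (p ^ Suc k) powr Re s = real p powr (real (Suc k) * Re s)"
    proof -
      have "real (p ^ Suc k) = real p powr real (Suc k)" using p2 by (subst powr_realpow) auto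
      then show ?thesis by (simp only: powr_powr)
    qed
    also have "norm (b (p ^ Suc k)) / real p powr (real (Suc k) * Re s) \<le>
        (\<bar>C\<bar> * real p powr (real (Suc k) * \<theta>)) / real p powr (real (Suc k) * Re s)"
      using b[OF p, of "Suc k"] by (intro divide_right_mono order_trans[OF b[OF p]] mult_right_mono) auto
    also have "\<dots> = \<bar>C\<bar> * real p powr (real (Suc k) * \<theta> - real (Suc k) * Re s)"
      by (simp only: powr_diff times_divide_eq_right)
    also have "\<dots> \<le> \<bar>C\<bar> * real p powr (- real (2 * Suc k))"
    proof (intro mult_left_mono powr_mono)
      have "real (Suc k) * 2 \<le> real (Suc k) * (Re s - \<theta>)"
        using s \<theta> by (intro mult_left_mono) (auto simp: H_def)
      then show "real (Suc k) * \<theta> - real (Suc k) * Re s \<le> - real (2 * Suc k)" by (simp add: algebra_simps)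
    qed (use p2 in auto)
    also have "real p powr (- real (2 * Suc k)) = 1 / real p ^ 2 * (1 / real p ^ 2) ^ k"
      using p2 by (subst powr_minus, subst powr_realpow) (auto simp: power_mult power_one_over divide_inverse power_inverse power_mult_distrib power2_eq_square)
    also have "\<dots> \<le> 1 / real p ^ 2 * (1 / 4) ^ k"
    proof (intro mult_left_mono power_mono)
      have "(2::real) ^ 2 \<le> real p ^ 2" using p2 by (intro power_mono) auto
      then show "1 / real p ^ 2 \<le> 1 / 4" by (simp add: divide_simps)
    qed auto
    finally show ?thesis by (simp add: mult_left_mono)
  qed
  have geo: "summable (\<lambda>k. \<bar>C\<bar> / real p ^ 2 * (1/4) ^ k)" for p
    by (intro summable_mult summable_geometric) auto
  have u_sum: "summable (\<lambda>k. norm (u p k s))" if "prime p" "s \<in> H" for p s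
    by (rule summable_comparison_test'[OF geo]) (use u_le[OF that] in auto)
  have q_le: "norm (q p s) \<le> 2 * \<bar>C\<bar> * (1 / real p ^ 2)" if s: "s \<in> H" for p s
  proof (cases "prime p")
    case True
    have "norm (q p s) \<le> (\<Sum>k. norm (u p k s))"
      using True summable_norm[OF u_sum[OF True s]] by (simp add: q_def)
    also have "\<dots> \<le> (\<Sum>k. \<bar>C\<bar> / real p ^ 2 * (1/4) ^ k)"
      by (intro suminf_le u_le True s u_sum geo)
    also have "\<dots> = \<bar>C\<bar> / real p ^ 2 * (4/3)"
      by (subst suminf_mult) (auto simp: suminf_geometric)
    also have "\<dots> \<le> \<bar>C\<bar> / real p ^ 2 * 2" by (intro mult_left_mono) auto
    also have "\<dots> = 2 * \<bar>C\<bar> * (1 / real p ^ 2)" by simp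
    finally show ?thesis .
  qed (auto simp: q_def)
  have q_summable: "summable (\<lambda>p. 2 * \<bar>C\<bar> * (1 / real p ^ 2))"
    by (intro summable_mult inverse_power_summable[THEN summable_cong[THEN iffD1, rotated]]) (auto simp: divide_inverse)
  have cont_q: "continuous_on H (q p)" for p
  proof (cases "prime p")
    case True
    have "continuous_on H (\<lambda>s. \<Sum>k. u p k s)"
    proof (rule uniform_limit_theorem)
      show "uniform_limit H (\<lambda>n s. \<Sum>k<n. u p k s) (\<lambda>s. \<Sum>k. u p k s) sequentially"
        by (rule Weierstrass_m_test[OF u_le[OF True] geo])
      have "p \<noteq> 0" using True by auto
      then have "continuous_on H (\<lambda>s. u p k s)" for k
        unfolding u_def powr_def by (auto intro!: continuous_intros)
      then show "\<forall>\<^sub>F n in sequentially. continuous_on H (\<lambda>s. \<Sum>k<n. u p k s)"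
        by (intro always_eventually allI continuous_intros)
    qed auto
    then show ?thesis using True by (simp add: q_def[abs_def])
  qed (simp add: q_def[abs_def])
  define P where "P = (\<lambda>s. \<Sum>p. q p s)"
  have "continuous_on H P" unfolding P_def
  proof (rule uniform_limit_theorem)
    show "uniform_limit H (\<lambda>n s. \<Sum>p<n. q p s) (\<lambda>s. \<Sum>p. q p s) sequentially"
      by (rule Weierstrass_m_test[OF q_le q_summable])
    show "\<forall>\<^sub>F n in sequentially. continuous_on H (\<lambda>s. \<Sum>p<n. q p s)"
      by (intro always_eventually allI continuous_intros cont_q)
  qed auto
  moreover have "norm (P s) \<le> (\<Sum>p. 2 * \<bar>C\<bar> * (1 / real p ^ 2)) \<and> F s = exp (P s)" if s: "s \<in> H" for s
  proof
    have sm: "summable (\<lambda>p. norm (q p s))"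
      by (rule summable_comparison_test'[OF q_summable]) (use q_le[OF s] in auto)
    have "norm (P s) \<le> (\<Sum>p. norm (q p s))" unfolding P_def by (rule summable_norm[OF sm])
    also have "\<dots> \<le> (\<Sum>p. 2 * \<bar>C\<bar> * (1 / real p ^ 2))" by (intro suminf_le q_le s sm q_summable)
    finally show "norm (P s) \<le> (\<Sum>p. 2 * \<bar>C\<bar> * (1 / real p ^ 2))" .
    \<comment> \<open>The product runs over primes up to and including N, hence the shifted partial
      sums.\<close>
    have "(\<lambda>N. exp (\<Sum>p<Suc N. q p s)) \<longlonglongrightarrow> exp (P s)"
      unfolding P_def by (intro tendsto_exp LIMSEQ_Suc summable_LIMSEQ summable_norm_cancel[OF sm])
    moreover have "exp (\<Sum>p<Suc N. q p s) = (\<Prod>p\<in>{p. prime p \<and> p \<le> N}. exp (\<Sum>k. b (p ^ Suc k) / of_nat (p ^ Suc k) powr s))" for N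
    proof -
      have fin: "finite {p. prime p \<and> p \<le> N}" by (rule finite_subset[of _ "{..N}"]) auto
      have "(\<Sum>p<Suc N. q p s) = (\<Sum>p\<in>{p. prime p \<and> p \<le> N}. \<Sum>k. u p k s)"
        by (rule sum.mono_neutral_cong_right) (auto simp: q_def)
      then show ?thesis by (simp only: exp_sum[OF fin] u_def)
    qed
    ultimately have "(\<lambda>N. \<Prod>p\<in>{p. prime p \<and> p \<le> N}. exp (\<Sum>k. b (p ^ Suc k) / of_nat (p ^ Suc k) powr s)) \<longlonglongrightarrow> exp (P s)"
      by simp
    then show "F s = exp (P s)" using LIMSEQ_unique[OF lim[of s]] s by (simp add: H_def)
  qed
  ultimately show ?thesis unfolding H_def by blast
qed

section \<open>The completed function under the Riemann hypothesis\<close>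

locale selberg_GRH =
  fixes a :: "nat \<Rightarrow> complex" and F :: "complex \<Rightarrow> complex" and Q :: real and r :: nat
    and lam :: "nat \<Rightarrow> real" and mu :: "nat \<Rightarrow> complex" and \<omega> :: complex
  assumes S: "selberg_class a F Q r lam mu \<omega>"
    and GRH: "\<forall>\<rho>. xi_F F Q r lam mu \<rho> = 0 \<longrightarrow> Re \<rho> = 1/2"
begin

lemma Q_pos: "Q > 0" and lam_pos: "j \<in> {1..r} \<Longrightarrow> lam j > 0" and Re_mu: "j \<in> {1..r} \<Longrightarrow> Re (mu j) \<ge> 0"
  and norm_omega: "norm \<omega> = 1"
  and phi_functional: "s \<noteq> 0 \<Longrightarrow> s \<noteq> 1 \<Longrightarrow>
          (\<And>j. j \<in> {1..r} \<Longrightarrow> of_real (lam j) * s + mu j \<notin> \<int>\<^sub>\<le>\<^sub>0) \<Longrightarrow>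
          (\<And>j. j \<in> {1..r} \<Longrightarrow> of_real (lam j) * (1 - cnj s) + mu j \<notin> \<int>\<^sub>\<le>\<^sub>0) \<Longrightarrow>
          phi_F F Q r lam mu s = \<omega> * cnj (phi_F F Q r lam mu (1 - cnj s))"
  using S unfolding selberg_class_def by blast+

definition m :: nat where "m = m_F F"

text \<open>The value \<open>F 1\<close> is unconstrained, so (s - 1)^m F s may fail to be the
  entire function at s = 1; an entire function agreeing with it elsewhere is chosen instead.\<close>

definition G :: "complex \<Rightarrow> complex" where
  "G = (SOME G. entire_finite_order G \<and> (\<forall>s. s \<noteq> 1 \<longrightarrow> G s = (s - 1) ^ m * F s))"

lemma G: "entire_finite_order G" "s \<noteq> 1 \<Longrightarrow> G s = (s - 1) ^ m * F s"
proof -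
  have "\<exists>m. pole_order_ok F m" using S unfolding selberg_class_def by blast
  then have "pole_order_ok F m" unfolding m_def m_F_def by (rule LeastI_ex)
  then have "entire_finite_order G \<and> (\<forall>s. s \<noteq> 1 \<longrightarrow> G s = (s - 1) ^ m * F s)"
    unfolding pole_order_ok_def G_def by (rule someI_ex)
  then show "entire_finite_order G" "s \<noteq> 1 \<Longrightarrow> G s = (s - 1) ^ m * F s" by auto
qed

lemma G_holomorphic: "G holomorphic_on X"
  using G(1) unfolding entire_finite_order_def by (blast intro: holomorphic_on_subset)

definition gam :: "complex \<Rightarrow> complex" where
  "gam s = (\<Prod>j\<in>{1..r}. Gamma (of_real (lam j) * s + mu j))"

text \<open>The formula for xi with \<open>G\<close> in place of (s - 1)^m F. It is holomorphic on
  Re s > 0, where no Gamma factor has a pole.\<close>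

definition Xr :: "complex \<Rightarrow> complex" where
  "Xr s = s ^ m * G s * of_real Q powr s * gam s"

lemma Re_gamma_arg: "j \<in> {1..r} \<Longrightarrow> Re s > 0 \<Longrightarrow> Re (of_real (lam j) * s + mu j) > 0"
  using lam_pos[of j] Re_mu[of j] by (simp add: add_pos_nonneg)

lemma gamma_arg: "j \<in> {1..r} \<Longrightarrow> Re s > 0 \<Longrightarrow> of_real (lam j) * s + mu j \<notin> \<int>\<^sub>\<le>\<^sub>0"
  using Re_pos_not_nonpos(3)[OF Re_gamma_arg] by blast

lemma Xr_eq: "s \<noteq> 1 \<Longrightarrow> Xr s = s ^ m * (s - 1) ^ m * phi_F F Q r lam mu s"
  by (simp add: Xr_def G(2) phi_F_def gam_def)

lemma Xr_holomorphic: "Xr holomorphic_on {s. Re s > 0}"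
  unfolding Xr_def gam_def
  by (intro holomorphic_intros G_holomorphic) (use gamma_arg Q_pos in auto)

text \<open>For Re s < 1 the reflected point lies in the right half-plane, so only the Gamma
  arguments at s itself have to be kept off the poles.\<close>

lemma Xr_reflect:
  assumes "Re s < 1" "s \<noteq> 0" "\<And>j. j \<in> {1..r} \<Longrightarrow> of_real (lam j) * s + mu j \<notin> \<int>\<^sub>\<le>\<^sub>0"
  shows "Xr s = \<omega> * cnj (Xr (1 - cnj s))"
proof -
  have s1: "s \<noteq> 1" "1 - cnj s \<noteq> 1" using assms by auto
  have "phi_F F Q r lam mu s = \<omega> * cnj (phi_F F Q r lam mu (1 - cnj s))"
    by (rule phi_functional) (use assms s1 gamma_arg[of _ "1 - cnj s"] in auto)
  moreover have "cnj ((1 - cnj s) ^ m * (1 - cnj s - 1) ^ m) = s ^ m * (s - 1) ^ m"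
    by (simp add: power_mult_distrib[symmetric] algebra_simps)
  ultimately show ?thesis by (simp add: Xr_eq s1 mult_ac)
qed

text \<open>Farther left the default value of Gamma at a pole would spoil the product formula, so
  the functional equation serves as definition on that side.\<close>

definition Xi :: "complex \<Rightarrow> complex" where
  "Xi s = (if Re s > 1/2 then Xr s else \<omega> * cnj (Xr (1 - cnj s)))"

lemma Xi_right: "Re s > 0 \<Longrightarrow> Xi s = Xr s"
  using Xr_reflect[of s] gamma_arg[of _ s] Re_pos_not_nonpos(1)[of s] by (auto simp: Xi_def)

lemma Xi_left: "Re s < 1 \<Longrightarrow> Xi s = \<omega> * cnj (Xr (1 - cnj s))"
  using Xr_reflect[of s] gamma_arg[of _ s] Re_pos_not_nonpos(1)[of s] by (cases "Re s > 0") (auto simp: Xi_def)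

text \<open>The half-planes Re s > 0 and Re s < 1 cover the plane, and on each a single formula
  holds. The left one is holomorphic because conjugating both before and after preserves
  holomorphy.\<close>

lemma Xi_holomorphic: "Xi holomorphic_on X"
proof -
  have "Xi holomorphic_on ({s. Re s > 0} \<union> {s. Re s < 1})"
  proof (rule holomorphic_on_Un)
    show "Xi holomorphic_on {s. Re s > 0}"
      by (rule holomorphic_transform[OF Xr_holomorphic]) (simp add: Xi_right)
    have "(\<lambda>u. Xr (1 - u)) holomorphic_on cnj ` {s. Re s < 1}"
    proof -
      have "(Xr \<circ> (\<lambda>u. 1 - u)) holomorphic_on cnj ` {s. Re s < 1}"
        by (rule holomorphic_on_compose_gen[OF _ Xr_holomorphic]) (auto intro!: holomorphic_intros)
      then show ?thesis by (simp add: o_def)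
    qed
    then have "(cnj \<circ> (\<lambda>u. Xr (1 - u)) \<circ> cnj) holomorphic_on {s. Re s < 1}"
      by (rule holomorphic_on_compose_cnj_cnj) (rule open_halfspace_Re_lt)
    then have "(\<lambda>s. \<omega> * cnj (Xr (1 - cnj s))) holomorphic_on {s. Re s < 1}"
      by (intro holomorphic_intros) (simp add: o_def)
    then show "Xi holomorphic_on {s. Re s < 1}"
      by (rule holomorphic_transform) (simp add: Xi_left)
  qed (auto intro: open_halfspace_Re_gt open_halfspace_Re_lt)
  moreover have "{s. Re s > 0} \<union> {s. Re s < 1} = UNIV" by auto
  ultimately show ?thesis using holomorphic_on_subset by (metis subset_UNIV)
qed

lemma Xi_reflect: "Xi s = \<omega> * cnj (Xi (1 - cnj s))"
proof (cases "Re s < 1")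
  case True
  then show ?thesis using Xi_left[of s] Xi_right[of "1 - cnj s"] by simp
next
  case False
  have "\<omega> * cnj \<omega> = 1" using norm_omega by (simp add: complex_norm_square[symmetric])
  then have "\<omega> * cnj (\<omega> * cnj (Xr s)) = Xr s" by simp
  then show ?thesis using False Xi_right[of s] Xi_left[of "1 - cnj s"] by simp
qed

text \<open>\<open>xi_F\<close> is a limit at s, so agreement on a punctured neighbourhood is
  enough: the points excluded by the functional equation, namely 0, 1 and poles of Gamma factors,
  are isolated.\<close>

lemma xi_eq: "xi_F F Q r lam mu s = Xi s"
proof -
  define E where "E = (\<lambda>z. z ^ m_F F * (z - 1) ^ m_F F * phi_F F Q r lam mu z)"
  have E: "E z = Xr z" if "z \<noteq> 1" for z using that by (simp add: E_def Xr_eq m_def)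
  have ne: "eventually (\<lambda>z. z \<noteq> w) (at s)" for w :: complex
    by (cases "w = s") (auto simp: eventually_neq_at_within eventually_at_filter t1_space_nhds intro: eventually_mono)
  have "eventually (\<lambda>z. Xi z = E z) (at s)"
  proof (cases "Re s > 0")
    case True
    have "eventually (\<lambda>z. z \<in> {z. Re z > 0}) (at s)"
      using True by (intro eventually_at_in_open' open_halfspace_Re_gt) auto
    then show ?thesis using ne[of 1] by eventually_elim (simp add: Xi_right E)
  next
    case False
    have "eventually (\<lambda>z. z \<in> {z. Re z < 1}) (at s)"
      using False by (intro eventually_at_in_open' open_halfspace_Re_lt) auto
    moreover have "eventually (\<lambda>z. \<forall>j\<in>{1..r}. of_real (lam j) * z + mu j \<notin> \<int>\<^sub>\<le>\<^sub>0) (at s)"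
    proof (rule eventually_ball_finite)
      show "\<forall>j\<in>{1..r}. eventually (\<lambda>z. of_real (lam j) * z + mu j \<notin> \<int>\<^sub>\<le>\<^sub>0) (at s)"
      proof
        fix j assume j: "j \<in> {1..r}"
        \<comment> \<open>The excluded points are zeros of an entire function that is nonzero at z =
          1, hence isolated.\<close>
        have "(\<lambda>z. rGamma (of_real (lam j) * z + mu j)) holomorphic_on UNIV"
          by (intro holomorphic_intros)
        moreover have "rGamma (of_real (lam j) * 1 + mu j) \<noteq> 0"
          using gamma_arg[OF j, of 1] by (simp add: rGamma_eq_zero_iff)
        ultimately have "eventually (\<lambda>z. rGamma (of_real (lam j) * z + mu j) \<noteq> 0 \<and> z \<in> UNIV) (at s)"
          by (intro non_zero_neighbour_alt[where \<beta> = 1]) auto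
        then show "eventually (\<lambda>z. of_real (lam j) * z + mu j \<notin> \<int>\<^sub>\<le>\<^sub>0) (at s)"
          by (simp add: rGamma_eq_zero_iff)
      qed
    qed simp
    ultimately show ?thesis using ne[of 1] ne[of 0]
    proof eventually_elim
      case (elim z)
      have "Xr z = \<omega> * cnj (Xr (1 - cnj z))" using elim by (intro Xr_reflect) auto
      then show ?case using elim by (simp add: E Xi_left)
    qed
  qed
  moreover have "(Xi \<longlongrightarrow> Xi s) (at s)"
    using holomorphic_on_imp_continuous_on[OF Xi_holomorphic[of UNIV]]
    by (simp add: continuous_on_eq_continuous_at isCont_def)
  ultimately have "(E \<longlongrightarrow> Xi s) (at s)" using tendsto_cong by fastforce
  then show ?thesis unfolding xi_F_def E_def by (intro tendsto_Lim) auto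
qed

lemma Xi_zero: "Xi s = 0 \<Longrightarrow> Re s = 1/2"
  using GRH xi_eq by metis

lemma G_nonzero: "Re s > 1/2 \<Longrightarrow> G s \<noteq> 0"
  using Xi_zero[of s] Xi_right[of s] by (auto simp: Xr_def)

section \<open>Polynomial growth and a logarithm of \<open>G\<close>\<close>

lemma Euler_exp: "\<exists>P B. continuous_on {s. Re s \<ge> 3} P \<and> (\<forall>s. Re s \<ge> 3 \<longrightarrow> norm (P s) \<le> B \<and> F s = exp (P s))"
proof -
  obtain b \<theta> C where b: "\<theta> < 1/2" "\<forall>p k. prime p \<and> k \<ge> 1 \<longrightarrow> norm (b (p ^ k)) \<le> C * real p powr (real k * \<theta>)"
    "\<forall>s. Re s > 1 \<longrightarrow> (\<lambda>N. \<Prod>p\<in>{p. prime p \<and> p \<le> N}.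
                 exp (\<Sum>k. b (p ^ Suc k) / of_nat (p ^ Suc k) powr s)) \<longlonglongrightarrow> F s"
    using S unfolding selberg_class_def by blast
  show ?thesis by (rule Euler_product_exp[of b C \<theta>]) (use b in auto)
qed

text \<open>On Re s = - 6 the reflected point has real part 7, where the Euler product bounds F, and
  the quotient of the Gamma factors is of polynomial size. The abscissa - 6 is the leftmost one
  reached by discs of radius 9 about points of real part 3, on which \<open>G\<close> has to be
  bounded.\<close>

lemma F_left_bound:
  "\<exists>C n. C > 0 \<and> (\<forall>s. Re s = - 6 \<and> (\<forall>j\<in>{1..r}. of_real (lam j) * s + mu j \<notin> \<int>\<^sub>\<le>\<^sub>0) \<longrightarrow>
     norm (F s) \<le> C * norm (s + 9) ^ n)"
proof -
  have "\<exists>C n. C > 0 \<and> (\<forall>s. Re s = - 6 \<and> of_real (lam j) * s + mu j \<notin> \<int>\<^sub>\<le>\<^sub>0 \<longrightarrow>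
     norm (Gamma (of_real (lam j) * (1 - cnj s) + mu j)) \<le> C * norm (s + 9) ^ n * norm (Gamma (of_real (lam j) * s + mu j)))"
    if j: "j \<in> {1..r}" for j
  proof -
    have l: "lam j > 0" "Re (mu j) \<ge> 0" using lam_pos Re_mu j by auto
    obtain C n where C: "C > 0" "\<And>z. Re z = - 6 * lam j + Re (mu j) \<Longrightarrow> z \<notin> \<int>\<^sub>\<le>\<^sub>0 \<Longrightarrow>
           norm (Gamma (z + of_real (13 * lam j))) \<le> C * (norm z + 1) ^ n * norm (Gamma z)"
      using Gamma_ratio_bound[of "13 * lam j" "- 6 * lam j + Re (mu j)"] l by auto
    define D where "D = 4 * lam j + norm (mu j) + 1"
    have D: "D > 0" using l by (simp add: D_def add_pos_nonneg add_nonneg_pos)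
    have "norm (Gamma (of_real (lam j) * (1 - cnj s) + mu j)) \<le> C * D ^ n * norm (s + 9) ^ n * norm (Gamma (of_real (lam j) * s + mu j))"
      if s: "Re s = - 6" "of_real (lam j) * s + mu j \<notin> \<int>\<^sub>\<le>\<^sub>0" for s
    proof -
      define z where "z = of_real (lam j) * s + mu j"
      have eq: "of_real (lam j) * (1 - cnj s) + mu j = z + of_real (13 * lam j)"
        using s by (simp add: z_def complex_eq_iff)
      have "norm (Gamma (of_real (lam j) * (1 - cnj s) + mu j)) \<le> C * (norm z + 1) ^ n * norm (Gamma z)"
        unfolding eq by (rule C(2)) (use s in \<open>auto simp: z_def\<close>)
      also have "\<dots> \<le> C * (D * norm (s + 9)) ^ n * norm (Gamma z)"
      proof (intro mult_right_mono mult_left_mono power_mono)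
        have 3: "norm (s + 9) \<ge> 3" using complex_Re_le_cmod[of "s + 9"] s by simp
        have "norm s \<le> norm (s + 9) + 9" using norm_triangle_ineq4[of "s + 9" 9] by simp
        then have "norm s \<le> 4 * norm (s + 9)" using 3 by linarith
        then have "lam j * norm s \<le> lam j * (4 * norm (s + 9))" using l by (intro mult_left_mono) auto
        moreover have "norm z \<le> lam j * norm s + norm (mu j)"
          unfolding z_def using norm_triangle_ineq[of "of_real (lam j) * s" "mu j"] l by (simp add: norm_mult)
        moreover have "(norm (mu j) + 1) * 1 \<le> (norm (mu j) + 1) * norm (s + 9)"
          using 3 by (intro mult_left_mono) auto
        ultimately show "norm z + 1 \<le> D * norm (s + 9)" by (simp add: D_def algebra_simps)
      qed (use C in auto)
      finally show ?thesis by (simp add: power_mult_distrib z_def mult_ac)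
    qed
    moreover have "C * D ^ n > 0" using C D by simp
    ultimately show ?thesis by blast
  qed
  then obtain C n where Cn: "\<And>j. j \<in> {1..r} \<Longrightarrow> C j > 0" "\<And>j s. j \<in> {1..r} \<Longrightarrow> Re s = - 6 \<Longrightarrow> of_real (lam j) * s + mu j \<notin> \<int>\<^sub>\<le>\<^sub>0 \<Longrightarrow>
     norm (Gamma (of_real (lam j) * (1 - cnj s) + mu j)) \<le> C j * norm (s + 9) ^ n j * norm (Gamma (of_real (lam j) * s + mu j))"
    by metis
  obtain P B where PB: "\<And>s. Re s \<ge> 3 \<Longrightarrow> norm (P s) \<le> B \<and> F s = exp (P s)"
    using Euler_exp by blast
  \<comment> \<open>The power 13 = 7 + 6 is what remains of the two factors Q^s in the functional
    equation.\<close>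
  define K where "K = exp B * Q powr 13 * (\<Prod>j\<in>{1..r}. C j)"
  have "norm (F s) \<le> K * norm (s + 9) ^ (\<Sum>j\<in>{1..r}. n j)"
    if s: "Re s = - 6" "\<forall>j\<in>{1..r}. of_real (lam j) * s + mu j \<notin> \<int>\<^sub>\<le>\<^sub>0" for s
  proof -
    define s' where "s' = 1 - cnj s"
    have s': "Re s' = 7" using s by (simp add: s'_def)
    have F': "norm (F s') \<le> exp B"
      using PB[of s'] s' norm_exp[of "P s'"] by (auto intro: order_trans)
    have gs: "norm (gam s) > 0" using s(2) by (auto simp: gam_def Gamma_eq_zero_iff)
    have "norm (gam s') \<le> (\<Prod>j\<in>{1..r}. C j * norm (s + 9) ^ n j * norm (Gamma (of_real (lam j) * s + mu j)))"
      unfolding gam_def prod_norm[symmetric] s'_def using s by (intro prod_mono conjI Cn) auto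
    also have "\<dots> = (\<Prod>j\<in>{1..r}. C j) * norm (s + 9) ^ (\<Sum>j\<in>{1..r}. n j) * norm (gam s)"
      by (simp only: prod.distrib power_sum gam_def prod_norm)
    finally have g: "norm (gam s') \<le> (\<Prod>j\<in>{1..r}. C j) * norm (s + 9) ^ (\<Sum>j\<in>{1..r}. n j) * norm (gam s)" .
    have "phi_F F Q r lam mu s = \<omega> * cnj (phi_F F Q r lam mu (1 - cnj s))"
      by (rule phi_functional) (use s s' gamma_arg[of _ s'] in \<open>auto simp: s'_def\<close>)
    then have "norm (phi_F F Q r lam mu s) = norm (phi_F F Q r lam mu s')"
      by (simp add: norm_mult norm_omega s'_def)
    then have "norm (F s) * Q powr (-6) * norm (gam s) = norm (F s') * Q powr 7 * norm (gam s')"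
      using Q_pos s s' by (simp add: phi_F_def gam_def norm_mult norm_powr_real_powr)
    also have "\<dots> \<le> exp B * Q powr 7 * ((\<Prod>j\<in>{1..r}. C j) * norm (s + 9) ^ (\<Sum>j\<in>{1..r}. n j) * norm (gam s))"
      using F' g by (intro mult_mono) auto
    also have "\<dots> = K * norm (s + 9) ^ (\<Sum>j\<in>{1..r}. n j) * Q powr (-6) * norm (gam s)"
    proof -
      have "Q powr 7 = Q powr 13 * Q powr (-6)" by (simp add: powr_add[symmetric])
      then show ?thesis by (simp add: K_def mult_ac)
    qed
    finally show ?thesis using gs Q_pos by (simp add: mult_le_cancel_right)
  qed
  moreover have "K > 0" unfolding K_def using Cn(1) Q_pos by (intro mult_pos_pos prod_pos) auto
  ultimately show ?thesis by blast
qed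

end

context selberg_GRH begin

text \<open>Phragmen-Lindelof on - 6 <= Re s <= 3 for G / (s + 9)^n: the left edge is bounded
  through the functional equation, the right edge and everything beyond it through the Euler
  product, and the finite order of \<open>G\<close> supplies the a priori growth. The shift by 9
  keeps the base of the denominator at modulus at least 3.\<close>

lemma G_growth: "\<exists>B n. B > 0 \<and> (\<forall>s. Re s \<ge> - 6 \<longrightarrow> norm (G s) \<le> B * norm (s + 9) ^ n)"
proof -
  obtain C N where C: "C > 0" "\<And>s. Re s = - 6 \<Longrightarrow> (\<forall>j\<in>{1..r}. of_real (lam j) * s + mu j \<notin> \<int>\<^sub>\<le>\<^sub>0) \<Longrightarrow>
     norm (F s) \<le> C * norm (s + 9) ^ N"
    using F_left_bound by blast
  obtain P B where PB: "\<And>s. Re s \<ge> 3 \<Longrightarrow> norm (P s) \<le> B \<and> F s = exp (P s)"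
    using Euler_exp by blast
  define n where "n = m + N"
  \<comment> \<open>A Gamma argument can be a nonpositive integer only where its imaginary part
    vanishes, which fixes Im s on the line. At these at most r points \<open>F_left_bound\<close>
    says nothing, and \<open>G\<close> is bounded by the maximum over the finite set.\<close>
  define bad where "bad = (\<lambda>j. Complex (- 6) (- Im (mu j) / lam j)) ` {1..r}"
  have "finite ((\<lambda>s. norm (G s)) ` bad)" by (simp add: bad_def)
  then obtain K where K: "\<And>s. s \<in> bad \<Longrightarrow> norm (G s) \<le> K"
    by (meson bdd_above.E bdd_above_finite imageI)
  \<comment> \<open>The entries serve, in turn, the lower bound 1, the exceptional points, the right
    edge, and the left edge, where |s - 1| <= 5 |s + 9| produces 5^m.\<close>
  define D where "D = max (max 1 K) (max (exp B) (5 ^ m * C))"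
  have D: "D \<ge> 1" "D \<ge> K" "D \<ge> exp B" "D \<ge> 5 ^ m * C" by (simp_all add: D_def)
  have ge3: "norm (s + 9) \<ge> 3" if "Re s \<ge> - 6" for s
    using complex_Re_le_cmod[of "s + 9"] that by simp
  have right: "norm (G s) \<le> D * norm (s + 9) ^ n" if s: "Re s \<ge> 3" for s
  proof -
    have "norm (G s) = norm (s - 1) ^ m * norm (F s)"
      using s by (subst G(2)) (auto simp: norm_mult norm_power)
    also have "\<dots> \<le> norm (s + 9) ^ m * exp B"
    proof (intro mult_mono power_mono)
      show "norm (s - 1) \<le> norm (s + 9)"
        unfolding cmod_def using s by (intro real_sqrt_le_mono add_mono) (auto intro!: power_mono)
      show "norm (F s) \<le> exp B"
        using PB[OF s] norm_exp[of "P s"] by (auto intro: order_trans)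
    qed auto
    also have "\<dots> \<le> norm (s + 9) ^ n * D"
      using ge3[of s] s D by (intro mult_mono power_increasing) (auto simp: n_def)
    finally show ?thesis by (simp add: mult.commute)
  qed
  have left: "norm (G s) \<le> D * norm (s + 9) ^ n" if s: "Re s = - 6" for s
  proof (cases "\<forall>j\<in>{1..r}. of_real (lam j) * s + mu j \<notin> \<int>\<^sub>\<le>\<^sub>0")
    case True
    have 3: "norm (s + 9) \<ge> 3" using ge3 s by simp
    have "norm (G s) = norm (s - 1) ^ m * norm (F s)"
      using s by (subst G(2)) (auto simp: norm_mult norm_power)
    also have "\<dots> \<le> (5 * norm (s + 9)) ^ m * (C * norm (s + 9) ^ N)"
    proof (intro mult_mono power_mono C(2) True s)
      have "norm (s - 1) \<le> norm (s + 9) + 10" using norm_triangle_ineq4[of "s + 9" 10] by simp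
      then show "norm (s - 1) \<le> 5 * norm (s + 9)" using 3 by linarith
    qed auto
    also have "\<dots> = (5 ^ m * C) * norm (s + 9) ^ n" by (simp add: n_def power_mult_distrib power_add)
    also have "\<dots> \<le> D * norm (s + 9) ^ n" using D by (intro mult_right_mono) auto
    finally show ?thesis .
  next
    case False
    then obtain j where j: "j \<in> {1..r}" "of_real (lam j) * s + mu j \<in> \<int>\<^sub>\<le>\<^sub>0" by blast
    then obtain k where "of_real (lam j) * s + mu j = of_int k" by (auto elim: nonpos_Ints_cases)
    from arg_cong[OF this, of Im] have "lam j * Im s + Im (mu j) = 0" by simp
    then have "Im s = - Im (mu j) / lam j" using lam_pos[OF j(1)] by (simp add: field_simps add_eq_0_iff)
    then have "s = Complex (- 6) (- Im (mu j) / lam j)" using s by (simp add: complex_eq_iff)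
    then have "s \<in> bad" using j(1) by (auto simp: bad_def)
    then have "norm (G s) \<le> D * 1" using K[of s] D by simp
    also have "\<dots> \<le> D * norm (s + 9) ^ n"
      using ge3[of s] s D by (intro mult_left_mono one_le_power) auto
    finally show ?thesis .
  qed
  have mid: "norm (G s) \<le> D * norm (s + 9) ^ n" if s: "- 6 \<le> Re s" "Re s \<le> 3" for s
  proof -
    obtain p c where pc: "\<And>z. norm (G z) \<le> c * exp (norm z powr p)"
      using G(1) unfolding entire_finite_order_def by blast
    have ne: "norm (z + 9) ^ n \<ge> 1" if "- 6 \<le> Re z" for z
      using ge3[OF that] by (intro one_le_power) auto
    have "norm (G s / (s + 9) ^ n) \<le> D"
    proof (rule Phragmen_Lindelof_strip[where f = "\<lambda>z. G z / (z + 9) ^ n" and S = "{z. - 6 \<le> Re z}" and C = c and p = p])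
      show "(\<lambda>z. G z / (z + 9) ^ n) holomorphic_on {z. - 6 \<le> Re z}"
        using ge3 by (intro holomorphic_intros G_holomorphic) fastforce
      fix z
      { assume "- 6 \<le> Re z"
        have "norm (G z / (z + 9) ^ n) \<le> norm (G z) / 1"
          unfolding norm_divide norm_power using ne[OF \<open>- 6 \<le> Re z\<close>] by (intro divide_left_mono) auto
        then show "norm (G z / (z + 9) ^ n) \<le> c * exp (norm z powr p)" using pc[of z] by simp }
      { assume "Re z = - 6 \<or> Re z = 3"
        then show "norm (G z / (z + 9) ^ n) \<le> D"
          unfolding norm_divide norm_power using left[of z] right[of z] ne[of z]
          by (subst pos_divide_le_eq) auto }
    qed (use s D in auto)
    then show ?thesis unfolding norm_divide norm_power using ne[OF s(1)] by (subst (asm) pos_divide_le_eq) auto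
  qed
  have "norm (G s) \<le> D * norm (s + 9) ^ n" if "Re s \<ge> - 6" for s
    using mid[of s] right[of s] that by linarith
  then show ?thesis using D(1) by (intro exI[of _ D] exI[of _ n]) auto
qed

text \<open>On Re s >= 3 the branch h differs by a constant from m Ln (s - 1) + P, so Im h is
  bounded on the line Re s = 3. Moving horizontally from there to s changes it by O(log M), where M
  compares \<open>G\<close> on a disc with its value at the centre and may be taken as a power of
  the height.\<close>

lemma ln_G: "\<exists>h C. h holomorphic_on {s. Re s > 1/2} \<and> (\<forall>s. Re s > 1/2 \<longrightarrow> G s = exp (h s)) \<and>
  (\<forall>s. 1/2 < Re s \<and> Re s \<le> 3 \<longrightarrow> \<bar>Im (h s)\<bar> \<le> C * ln (\<bar>Im s\<bar> + 2))"
proof -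
  obtain h where h: "h holomorphic_on {s. Re s > 1/2}" "\<And>s. Re s > 1/2 \<Longrightarrow> G s = exp (h s)"
    using holomorphic_ln_convex[OF open_halfspace_Re_gt convex_halfspace_Re_gt G_holomorphic, of "1/2"] G_nonzero
    by (metis mem_Collect_eq)
  obtain P B0 where P: "continuous_on {s. Re s \<ge> 3} P" "\<And>s. Re s \<ge> 3 \<Longrightarrow> norm (P s) \<le> B0 \<and> F s = exp (P s)"
    using Euler_exp by blast
  obtain B n where B: "B > 0" "\<And>s. Re s \<ge> - 6 \<Longrightarrow> norm (G s) \<le> B * norm (s + 9) ^ n"
    using G_growth by blast
  have "\<exists>d. \<forall>s\<in>{s. Re s \<ge> 3}. h s - of_nat m * Ln (s - 1) - P s = d"
  proof (rule continuous_exp_const_imp_const)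
    show "connected {s. Re s \<ge> 3}" by (intro convex_connected convex_halfspace_Re_ge)
    have "continuous_on {s. Re s \<ge> 3} h"
      using holomorphic_on_imp_continuous_on[OF h(1)] by (rule continuous_on_subset) auto
    then show "continuous_on {s. Re s \<ge> 3} (\<lambda>s. h s - of_nat m * Ln (s - 1) - P s)"
      using P(1) by (intro continuous_intros) (auto simp: complex_nonpos_Reals_iff)
    fix s assume "s \<in> {s. Re s \<ge> (3::real)}"
    then have s: "Re s \<ge> 3" "s - 1 \<noteq> 0" "s \<noteq> 1" by auto
    have "exp (of_nat m * Ln (s - 1)) = (s - 1) ^ m"
      unfolding exp_of_nat_mult exp_Ln[OF s(2)] ..
    moreover have "exp (h s) = (s - 1) ^ m * exp (P s)"
      using h(2)[of s] G(2)[OF s(3)] P(2)[OF s(1)] s(1) by simp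
    ultimately show "exp (h s - of_nat m * Ln (s - 1) - P s) = 1"
      using s(2) by (simp add: exp_diff)
  qed
  then obtain d where d: "\<And>s. Re s \<ge> 3 \<Longrightarrow> h s - of_nat m * Ln (s - 1) - P s = d" by auto
  define K1 where "K1 = m * pi + B0 + norm d"
  \<comment> \<open>On the disc |z + 9| <= 21 + |Im s| <= 11 (|Im s| + 2), which gives 11^n;
    \<open>exp B0\<close> is the price of the lower bound for \<open>G\<close> at the centre, and
    the added 1 makes K > 1.\<close>
  define K where "K = B * 11 ^ n * exp B0 + 1"
  define A where "A = 20 + pi / ln 2"
  have "norm (P 3) \<le> B0" using P(2)[of 3] by simp
  then have B0: "B0 \<ge> 0" by (rule order_trans[OF norm_ge_zero])
  have K1: "K1 \<ge> 0" using B0 by (simp add: K1_def)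
  have A: "A > 0" using pi_gt_zero by (simp add: A_def add_pos_pos)
  have K: "K > 1" using B by (simp add: K_def)
  have "\<bar>Im (h s)\<bar> \<le> (A * (ln K / ln 2 + n) + K1 / ln 2) * ln (\<bar>Im s\<bar> + 2)"
    if s: "1/2 < Re s" "Re s \<le> 3" for s
  proof -
    define T where "T = \<bar>Im s\<bar> + 2"
    define c where "c = Complex 3 (Im s)"
    define M where "M = K * T ^ n"
    have T: "T \<ge> 2" by (simp add: T_def)
    have Tn: "T ^ n \<ge> 1" using T by (intro one_le_power) auto
    have lnT: "ln T \<ge> ln 2" using T by simp
    have Gc: "norm (G c) \<ge> exp (- B0)"
    proof -
      have "norm (G c) = norm (c - 1) ^ m * exp (Re (P c))"
      proof -
        have "c \<noteq> 1" by (simp add: c_def complex_eq_iff)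
        then have "G c = (c - 1) ^ m * exp (P c)" using G(2)[of c] P(2)[of c] by (simp add: c_def)
        then show ?thesis by (simp add: norm_mult norm_power)
      qed
      also have "\<dots> \<ge> 1 * exp (- B0)"
      proof (intro mult_mono one_le_power)
        show "1 \<le> norm (c - 1)" using complex_Re_le_cmod[of "c - 1"] by (simp add: c_def)
        show "exp (- B0) \<le> exp (Re (P c))"
          using P(2)[of c] abs_Re_le_cmod[of "P c"] by (auto simp: c_def)
      qed auto
      finally show ?thesis by simp
    qed
    have M: "M > 1"
      using K Tn unfolding M_def by (metis less_le_trans mult_le_cancel_left1 mult.commute not_less order.strict_trans zero_less_one less_imp_le)
    have "\<bar>Im (h s) - Im (h c)\<bar> \<le> (20 + pi / ln 2) * ln M"
    proof (rule Im_holomorphic_log_bound[OF G_holomorphic _ M _ h])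
      fix z assume z: "norm (z - c) \<le> 9"
      have "Re z \<ge> - 6" using z abs_Re_le_cmod[of "z - c"] by (simp add: c_def)
      then have "norm (G z) \<le> B * norm (z + 9) ^ n" by (rule B(2))
      also have "\<dots> \<le> B * (11 * T) ^ n"
      proof (intro mult_left_mono power_mono)
        have "norm (z + 9) \<le> norm (z - c) + norm (c + 9)" using norm_triangle_ineq[of "z - c" "c + 9"] by simp
        also have "norm (c + 9) \<le> 12 + \<bar>Im s\<bar>" using cmod_le[of "c + 9"] by (simp add: c_def)
        finally show "norm (z + 9) \<le> 11 * T" using z by (simp add: T_def)
      qed (use B in auto)
      also have "\<dots> = B * 11 ^ n * exp B0 * T ^ n * exp (- B0)" by (simp add: power_mult_distrib exp_minus)
      also have "\<dots> \<le> M * norm (G c)"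
        unfolding M_def using Gc B Tn by (intro mult_mono) (auto simp: K_def)
      finally show "norm (G z) \<le> M * norm (G c)" .
    qed (use s in \<open>auto simp: c_def\<close>)
    moreover have "ln M \<le> (ln K / ln 2 + n) * ln T"
    proof -
      have "ln M = ln K + n * ln T" using K T by (simp add: M_def ln_mult ln_realpow)
      moreover have "ln K \<le> ln K / ln 2 * ln T"
        using K lnT by (simp add: field_simps mult_left_mono)
      ultimately show ?thesis by (simp add: distrib_right)
    qed
    then have "(20 + pi / ln 2) * ln M \<le> A * ((ln K / ln 2 + n) * ln T)"
      using A unfolding A_def[symmetric] by (intro mult_left_mono) auto
    moreover have "\<bar>Im (h c)\<bar> \<le> K1"
    proof -
      have "h c = of_nat m * Ln (c - 1) + P c + d" using d[of c] by (simp add: c_def algebra_simps)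
      then have "Im (h c) = m * Im (Ln (c - 1)) + Im (P c) + Im d" by simp
      moreover have "\<bar>Im (Ln (c - 1))\<bar> \<le> pi"
        using Im_Ln_le_pi[of "c - 1"] mpi_less_Im_Ln[of "c - 1"] by (auto simp: c_def complex_eq_iff abs_le_iff)
      then have "\<bar>m * Im (Ln (c - 1))\<bar> \<le> m * pi" by (simp add: abs_mult mult_left_mono)
      moreover have "\<bar>Im (P c)\<bar> \<le> B0" using P(2)[of c] abs_Im_le_cmod[of "P c"] by (auto simp: c_def)
      moreover have "\<bar>Im d\<bar> \<le> norm d" by (rule abs_Im_le_cmod)
      ultimately show ?thesis unfolding K1_def by linarith
    qed
    moreover have "K1 \<le> K1 / ln 2 * ln T" using K1 lnT by (simp add: field_simps mult_left_mono)
    ultimately show ?thesis unfolding T_def[symmetric] by (simp add: algebra_simps)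
  qed
  then show ?thesis using h by blast
qed

end

section \<open>Phase asymptotics and zero counting\<close>

text \<open>Lets logarithmic errors at the heights of the Gamma arguments, which are affine in t, be
  restated in terms of t.\<close>

lemma ln_affine_le: "\<exists>K\<ge>0. \<forall>T. ln (\<bar>u * T + v\<bar> + 2) \<le> K * ln (\<bar>T\<bar> + 2)" for u v :: real
proof -
  define q where "q = \<bar>u\<bar> + \<bar>v\<bar> + 1"
  have "ln (\<bar>u * T + v\<bar> + 2) \<le> (ln q / ln 2 + 1) * ln (\<bar>T\<bar> + 2)" for T
  proof -
    have "\<bar>v\<bar> * 1 \<le> \<bar>v\<bar> * (\<bar>T\<bar> + 2)" by (intro mult_left_mono) auto
    moreover have "\<bar>u * T + v\<bar> \<le> \<bar>u\<bar> * \<bar>T\<bar> + \<bar>v\<bar>" by (metis abs_mult abs_triangle_ineq)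
    moreover have "q * (\<bar>T\<bar> + 2) = \<bar>u\<bar> * \<bar>T\<bar> + 2 * \<bar>u\<bar> + \<bar>v\<bar> * (\<bar>T\<bar> + 2) + \<bar>T\<bar> + 2"
      unfolding q_def by (simp add: algebra_simps)
    ultimately have "\<bar>u * T + v\<bar> + 2 \<le> q * (\<bar>T\<bar> + 2)"
      using abs_ge_zero[of u] abs_ge_zero[of T] by linarith
    then have "ln (\<bar>u * T + v\<bar> + 2) \<le> ln (q * (\<bar>T\<bar> + 2))" by (intro ln_mono) auto
    also have "\<dots> = ln q + ln (\<bar>T\<bar> + 2)" by (intro ln_mult_pos) (auto simp: q_def)
    also have "ln q \<le> ln q / ln 2 * ln (\<bar>T\<bar> + 2)"
    proof -
      have "ln q \<ge> 0" "ln 2 \<le> ln (\<bar>T\<bar> + 2)" by (simp_all add: q_def)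
      then show ?thesis by (simp add: field_simps mult_left_mono)
    qed
    finally show ?thesis by (simp add: distrib_right)
  qed
  moreover have "ln q / ln 2 + 1 \<ge> 0" by (simp add: q_def)
  ultimately show ?thesis by blast
qed

text \<open>The phase of Stirling's main term at s = 1/2 + it; it is odd and smooth through t =
  0.\<close>

definition phase0 :: "real \<Rightarrow> real" where
  "phase0 t = Im (crit t * Ln (crit t) - crit t)"

lemma phase0_deriv: "(phase0 has_real_derivative ln (norm (crit t))) (at t)"
proof -
  have nz: "crit t \<noteq> 0" "crit t \<notin> \<real>\<^sub>\<le>\<^sub>0"
    using Re_pos_not_nonpos[of "crit t"] by auto
  have "((\<lambda>s. s * Ln s - s) has_field_derivative Ln (crit t)) (at (crit t))"
    using nz by (auto intro!: derivative_eq_intros)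
  from field_vector_diff_chain_at[OF vertical_line_deriv this]
  have "((\<lambda>t. crit t * Ln (crit t) - crit t) has_vector_derivative \<i> * Ln (crit t)) (at t)"
    by (simp add: o_def)
  then show ?thesis
    unfolding has_vector_derivative_complex_iff phase0_def[abs_def] using nz by simp
qed

lemma phase0_0 [simp]: "phase0 0 = 0"
proof -
  have "crit 0 = of_real (1/2)" by (simp add: complex_eq_iff)
  moreover have "Ln (of_real (1/2)) = of_real (ln (1/2))" by (rule Ln_of_real) simp
  ultimately show ?thesis unfolding phase0_def by (simp only:) simp
qed

lemma phase0_minus: "phase0 (- t) = - phase0 t"
proof -
  have "crit (- t) = cnj (crit t)" by (simp add: complex_eq_iff)
  moreover have "Ln (cnj (crit t)) = cnj (Ln (crit t))"
    using Re_pos_not_nonpos(2)[of "crit t"] by (intro cnj_Ln[symmetric]) auto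
  ultimately show ?thesis by (simp add: phase0_def)
qed

lemma abs_ln_crit_norm_le: "\<bar>ln (norm (crit t))\<bar> \<le> 2 * ln (\<bar>t\<bar> + 2)"
proof -
  have 1: "1/2 \<le> norm (crit t)" "norm (crit t) \<le> \<bar>t\<bar> + 2"
    using complex_Re_le_cmod[of "crit t"] cmod_le[of "crit t"] by auto
  have "ln (1/2) \<le> ln (norm (crit t))" "ln (norm (crit t)) \<le> ln (\<bar>t\<bar> + 2)"
    using 1 by (intro ln_mono; linarith)+
  moreover have "ln 2 \<le> ln (\<bar>t\<bar> + 2)" "ln 2 \<ge> (0::real)" by simp_all
  moreover have "ln (1/2) = - ln (2::real)" by (simp add: ln_div)
  ultimately show ?thesis by linarith
qed

lemma entropy_shift_bound:
  assumes "l > 0" "Re \<mu> \<ge> 0"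
  shows "\<exists>C. \<forall>t. norm (((of_real l * crit t + \<mu>) * Ln (of_real l * crit t + \<mu>) - (of_real l * crit t + \<mu>))
    - (of_real l * crit t * Ln (of_real l * crit t) - of_real l * crit t)) \<le> C * ln (\<bar>t\<bar> + 2)"
proof -
  obtain K where K: "K \<ge> 0" "\<And>T. ln (\<bar>l * T + (l + norm \<mu>)\<bar> + 2) \<le> K * ln (\<bar>T\<bar> + 2)"
    using ln_affine_le[of l "l + norm \<mu>"] by blast
  define D where "D = (\<bar>ln (l / 2)\<bar> + pi / 2) / ln 2"
  have D: "D \<ge> 0" by (simp add: D_def)
  have "norm (((of_real l * crit t + \<mu>) * Ln (of_real l * crit t + \<mu>) - (of_real l * crit t + \<mu>))
    - (of_real l * crit t * Ln (of_real l * crit t) - of_real l * crit t)) \<le> ((K + D) * norm \<mu>) * ln (\<bar>t\<bar> + 2)" for t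
  proof -
    define u where "u = of_real l * crit t"
    define g where "g = (\<lambda>w. w * Ln w - w)"
    have seg: "Re w \<ge> l / 2" "norm w \<le> l * \<bar>t\<bar> + (l + norm \<mu>)" if "w \<in> closed_segment u (u + \<mu>)" for w
    proof -
      obtain x where x: "0 \<le> x" "x \<le> 1" "w = (1 - x) *\<^sub>R u + x *\<^sub>R (u + \<mu>)" using \<open>w \<in> _\<close> by (auto simp: in_segment)
      then have w: "w = u + x *\<^sub>R \<mu>" by (simp add: algebra_simps)
      show "Re w \<ge> l / 2" using x(1,2) assms by (simp add: w u_def)
      have "norm w \<le> norm u + x * norm \<mu>" using norm_triangle_ineq[of u "x *\<^sub>R \<mu>"] x(1,2) by (simp add: w)
      also have "\<dots> \<le> norm u + 1 * norm \<mu>" using x by (intro add_left_mono mult_right_mono) auto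
      also have "norm u \<le> l * (1 + \<bar>t\<bar>)"
        unfolding u_def norm_mult using cmod_le[of "crit t"] assms by (simp add: mult_left_mono)
      finally show "norm w \<le> l * \<bar>t\<bar> + (l + norm \<mu>)" by (simp add: algebra_simps)
    qed
    have "norm (g (u + \<mu>) - g u) \<le> ((K + D) * ln (\<bar>t\<bar> + 2)) * norm ((u + \<mu>) - u)"
    proof (rule field_differentiable_bound[of "closed_segment u (u + \<mu>)"])
      fix w assume w: "w \<in> closed_segment u (u + \<mu>)"
      have Re: "Re w > 0" using seg(1)[OF w] assms by linarith
      show "(g has_field_derivative Ln w) (at w within closed_segment u (u + \<mu>))"
        unfolding g_def using Re_pos_not_nonpos[OF Re] by (auto intro!: derivative_eq_intros)
      have nw: "l / 2 \<le> norm w" using seg(1)[OF w] complex_Re_le_cmod[of w] by linarith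
      have "ln (l / 2) \<le> ln (norm w)" using nw assms by (intro ln_mono) auto
      moreover have "norm w > 0" using Re_pos_not_nonpos[OF Re] by simp
      then have "ln (norm w) \<le> ln (\<bar>l * \<bar>t\<bar> + (l + norm \<mu>)\<bar> + 2)"
        using seg(2)[OF w] by (intro ln_mono) auto
      moreover have "ln (\<bar>l * \<bar>t\<bar> + (l + norm \<mu>)\<bar> + 2) \<le> K * ln (\<bar>t\<bar> + 2)" using K(2)[of "\<bar>t\<bar>"] by simp
      moreover have "ln (\<bar>l * \<bar>t\<bar> + (l + norm \<mu>)\<bar> + 2) \<ge> 0" by simp
      ultimately have "\<bar>ln (norm w)\<bar> \<le> K * ln (\<bar>t\<bar> + 2) + \<bar>ln (l / 2)\<bar>" by linarith
      moreover have "norm (Ln w) \<le> \<bar>ln (norm w)\<bar> + pi / 2" using Re Re_pos_not_nonpos[OF Re] by (intro Ln_norm_le) auto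
      moreover have "\<bar>ln (l / 2)\<bar> + pi / 2 \<le> D * ln (\<bar>t\<bar> + 2)"
      proof -
        have "(\<bar>ln (l / 2)\<bar> + pi / 2) = D * ln 2" by (simp add: D_def)
        also have "\<dots> \<le> D * ln (\<bar>t\<bar> + 2)" using D by (intro mult_left_mono) auto
        finally show ?thesis .
      qed
      ultimately show "norm (Ln w) \<le> (K + D) * ln (\<bar>t\<bar> + 2)" by (simp add: distrib_right)
    qed auto
    then show ?thesis by (simp add: g_def u_def mult_ac)
  qed
  then show ?thesis by blast
qed

text \<open>Because l > 0, Ln (l s) = ln l + Ln s. The linear term l ln l t is the origin of the
  product of the \<open>lam j powr (2 * lam j)\<close> in the final constant.\<close>

lemma Im_entropy_scale:
  assumes "l > 0"
  shows "Im (of_real l * crit t * Ln (of_real l * crit t) - of_real l * crit t) = l * phase0 t + l * ln l * t"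
proof -
  have "Ln (of_real l * crit t) = of_real (ln l) + Ln (crit t)"
    using assms crit_line_norm(3)[of t] by (subst Ln_times_of_real) (auto simp: Ln_of_real)
  then have "of_real l * crit t * Ln (of_real l * crit t) - of_real l * crit t =
    of_real l * (crit t * Ln (crit t) - crit t) + of_real (l * ln l) * crit t"
    by (simp add: algebra_simps)
  then show ?thesis by (simp add: phase0_def algebra_simps)
qed

lemma Im_ln_Gamma_line:
  assumes "l > 0" "Re \<mu> \<ge> 0"
  shows "\<exists>C. \<forall>t. \<bar>Im (ln_Gamma (of_real l * crit t + \<mu>)) - (l * phase0 t + l * ln l * t)\<bar> \<le> C * ln (\<bar>t\<bar> + 2)"
proof -
  define z where "z = (\<lambda>t. of_real l * crit t + \<mu>)"
  obtain C1 where C1: "\<And>w. Re w = l / 2 + Re \<mu> \<Longrightarrow> norm (ln_Gamma w - (w * Ln w - w)) \<le> C1 * ln (\<bar>Im w\<bar> + 2)"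
    using Stirling_vertical[of "l / 2 + Re \<mu>"] assms by (auto simp: add_pos_nonneg)
  obtain C2 where C2: "\<And>t. norm ((z t * Ln (z t) - z t)
    - (of_real l * crit t * Ln (of_real l * crit t) - of_real l * crit t)) \<le> C2 * ln (\<bar>t\<bar> + 2)"
    using entropy_shift_bound[OF assms] unfolding z_def by blast
  obtain K where K: "K \<ge> 0" "\<And>T. ln (\<bar>l * T + Im \<mu>\<bar> + 2) \<le> K * ln (\<bar>T\<bar> + 2)"
    using ln_affine_le[of l "Im \<mu>"] by blast
  have "\<bar>Im (ln_Gamma (z t)) - (l * phase0 t + l * ln l * t)\<bar> \<le> (\<bar>C1\<bar> * K + C2) * ln (\<bar>t\<bar> + 2)" for t
  proof -
    have Rez: "Re (z t) = l / 2 + Re \<mu>" "Im (z t) = l * t + Im \<mu>" by (simp_all add: z_def)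
    have "norm (ln_Gamma (z t) - (z t * Ln (z t) - z t)) \<le> C1 * ln (\<bar>l * t + Im \<mu>\<bar> + 2)"
      using C1[of "z t"] Rez by simp
    also have "\<dots> \<le> \<bar>C1\<bar> * ln (\<bar>l * t + Im \<mu>\<bar> + 2)" by (intro mult_right_mono) auto
    also have "\<dots> \<le> \<bar>C1\<bar> * (K * ln (\<bar>t\<bar> + 2))" by (intro mult_left_mono K) auto
    finally have "\<bar>Im (ln_Gamma (z t) - (z t * Ln (z t) - z t))\<bar> \<le> \<bar>C1\<bar> * (K * ln (\<bar>t\<bar> + 2))"
      using abs_Im_le_cmod order_trans by blast
    moreover have "\<bar>Im ((z t * Ln (z t) - z t)
      - (of_real l * crit t * Ln (of_real l * crit t) - of_real l * crit t))\<bar> \<le> C2 * ln (\<bar>t\<bar> + 2)"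
      using C2[of t] abs_Im_le_cmod order_trans by blast
    ultimately show ?thesis
      unfolding minus_complex.simps(2)[of "ln_Gamma (z t)"] minus_complex.simps(2)[of "z t * Ln (z t) - z t"] Im_entropy_scale[OF assms(1)]
      by (simp add: distrib_right)
  qed
  then show ?thesis unfolding z_def by blast
qed

context selberg_GRH begin

text \<open>Only the logarithm of lambda Q^2: half of it enters the constant of the theorem, whose
  other part, with the Euler constant, arises from the harmonic numbers.\<close>

definition cF :: real where
  "cF = ln ((\<Prod>j\<in>{1..r}. lam j powr (2 * lam j)) * Q ^ 2)"

text \<open>Up to O(log), the phase of Q^s and the Gamma factors on the line;
  \<open>Psi t / pi\<close> is the smooth count of zeros on one side up to height t.\<close>

definition Psi :: "real \<Rightarrow> real" where
  "Psi t = (degree_F r lam * phase0 t + cF * t) / 2"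

lemma cF_eq: "cF = 2 * (\<Sum>j\<in>{1..r}. lam j * ln (lam j)) + 2 * ln Q"
proof -
  have pos: "lam j powr (2 * lam j) > 0" if "j \<in> {1..r}" for j using lam_pos[OF that] by simp
  have "cF = ln (\<Prod>j\<in>{1..r}. lam j powr (2 * lam j)) + ln (Q ^ 2)"
    unfolding cF_def using pos Q_pos by (intro ln_mult_pos prod_pos) auto
  also have "ln (\<Prod>j\<in>{1..r}. lam j powr (2 * lam j)) = (\<Sum>j\<in>{1..r}. ln (lam j powr (2 * lam j)))"
    using pos by (intro ln_prod) auto
  also have "\<dots> = (\<Sum>j\<in>{1..r}. 2 * (lam j * ln (lam j)))"
    using lam_pos by (intro sum.cong) (auto simp: ln_powr)
  finally show ?thesis using Q_pos by (simp add: sum_distrib_left ln_realpow)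
qed

lemma Psi_eq: "Psi t = t * ln Q + (\<Sum>j\<in>{1..r}. lam j * phase0 t + lam j * ln (lam j) * t)"
  unfolding Psi_def cF_eq degree_F_def sum.distrib sum_distrib_right[symmetric]
  by (simp add: field_simps)

lemma Xi_nonzero: "Xi 3 \<noteq> 0"
  using Xi_zero[of 3] by auto

abbreviation mult :: "complex \<Rightarrow> real" where
  "mult \<rho> \<equiv> real_of_int (zorder Xi \<rho>)"

abbreviation Zpos :: "complex set" where
  "Zpos \<equiv> {\<rho>. Xi \<rho> = 0 \<and> 0 < Im \<rho>}"

text \<open>A zero on the real axis, that is rho = 1/2, is assigned to this side, so that the two
  sets partition all zeros.\<close>

abbreviation Zneg :: "complex set" where
  "Zneg \<equiv> {\<rho>. Xi \<rho> = 0 \<and> Im \<rho> \<le> 0}"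

abbreviation Npos :: "real \<Rightarrow> real" where
  "Npos t \<equiv> \<Sum>\<rho> | \<rho> \<in> Zpos \<and> Im \<rho> \<le> t. mult \<rho>"

abbreviation Nneg :: "real \<Rightarrow> real" where
  "Nneg t \<equiv> \<Sum>\<rho> | \<rho> \<in> Zneg \<and> - Im \<rho> \<le> t. mult \<rho>"

lemma finite_zeros: "finite {\<rho>. Xi \<rho> = 0 \<and> \<bar>Im \<rho>\<bar> \<le> T}"
proof (rule finite_subset)
  show "{\<rho>. Xi \<rho> = 0 \<and> \<bar>Im \<rho>\<bar> \<le> T} \<subseteq> {\<rho> \<in> cbox (Complex 0 (- T)) (Complex 1 T). Xi \<rho> = 0}"
  proof
    fix \<rho> assume \<rho>: "\<rho> \<in> {\<rho>. Xi \<rho> = 0 \<and> \<bar>Im \<rho>\<bar> \<le> T}"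
    then have "Re \<rho> = 1/2" using Xi_zero by blast
    then show "\<rho> \<in> {\<rho> \<in> cbox (Complex 0 (- T)) (Complex 1 T). Xi \<rho> = 0}"
      using \<rho> by (auto simp: in_cbox_complex_iff)
  qed
  show "finite {\<rho> \<in> cbox (Complex 0 (- T)) (Complex 1 T). Xi \<rho> = 0}"
    by (rule finite_zeros_compact[OF Xi_holomorphic Xi_nonzero]) simp
qed

lemma zorder_Xi_nonneg: "zorder Xi \<rho> \<ge> 0"
  by (rule zorder_entire_nonneg[OF Xi_holomorphic Xi_nonzero])

text \<open>To the right of the line h + R is a logarithm of \<open>Xi\<close>, where R collects
  Q^s, the Gamma factors and s^m. R is continuous up to the line, where Stirling gives its phase; h
  is defined only for Re s > 1/2 and enters through a bound uniform in the distance to the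
  line.\<close>

lemma zeros_between:
  "\<exists>C\<ge>0. \<forall>T1 T2. T1 < T2 \<and> Xi (crit T1) \<noteq> 0 \<and> Xi (crit T2) \<noteq> 0 \<longrightarrow>
     \<bar>pi * (\<Sum>\<rho> | Xi \<rho> = 0 \<and> T1 < Im \<rho> \<and> Im \<rho> < T2. mult \<rho>) - (Psi T2 - Psi T1)\<bar>
       \<le> C * (ln (\<bar>T1\<bar> + 2) + ln (\<bar>T2\<bar> + 2))"
proof -
  obtain h Ch where h: "h holomorphic_on {s. Re s > 1/2}" "\<And>s. Re s > 1/2 \<Longrightarrow> G s = exp (h s)"
    "\<And>s. 1/2 < Re s \<Longrightarrow> Re s \<le> 3 \<Longrightarrow> \<bar>Im (h s)\<bar> \<le> Ch * ln (\<bar>Im s\<bar> + 2)"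
    using ln_G by blast
  define R where "R = (\<lambda>s. s * of_real (ln Q) + (\<Sum>j\<in>{1..r}. ln_Gamma (of_real (lam j) * s + mu j)) + of_nat m * Ln s)"
  have arg: "of_real (lam j) * s + mu j \<notin> \<real>\<^sub>\<le>\<^sub>0" if "j \<in> {1..r}" "Re s > 0" for j s
    using Re_pos_not_nonpos(2)[OF Re_gamma_arg[OF that]] .
  have lnGamma_hol: "(\<lambda>s. ln_Gamma (of_real (lam j) * s + mu j)) holomorphic_on {s. Re s > 0}" if "j \<in> {1..r}" for j
    by (intro analytic_imp_holomorphic analytic_on_ln_Gamma analytic_intros) (use arg[OF that] in blast)
  have R_hol: "R holomorphic_on {s. Re s > 0}"
    unfolding R_def by (intro holomorphic_intros lnGamma_hol) (auto simp: complex_nonpos_Reals_iff)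
  have "\<forall>j\<in>{1..r}. \<exists>C. \<forall>t. \<bar>Im (ln_Gamma (of_real (lam j) * crit t + mu j)) - (lam j * phase0 t + lam j * ln (lam j) * t)\<bar> \<le> C * ln (\<bar>t\<bar> + 2)"
    using Im_ln_Gamma_line lam_pos Re_mu by blast
  then obtain Cg where Cg: "\<And>j t. j \<in> {1..r} \<Longrightarrow> \<bar>Im (ln_Gamma (of_real (lam j) * crit t + mu j)) - (lam j * phase0 t + lam j * ln (lam j) * t)\<bar> \<le> Cg j * ln (\<bar>t\<bar> + 2)"
    by metis
  define C where "C = (\<Sum>j\<in>{1..r}. Cg j) + m * pi / ln 2"
  have R_bound: "\<bar>Im (R (crit t)) - Psi t\<bar> \<le> C * ln (\<bar>t\<bar> + 2)" for t
  proof -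
    have "Im (R (crit t)) - Psi t =
      (\<Sum>j\<in>{1..r}. Im (ln_Gamma (of_real (lam j) * crit t + mu j)) - (lam j * phase0 t + lam j * ln (lam j) * t))
      + m * Im (Ln (crit t))"
      by (simp add: R_def Psi_eq sum_subtractf)
    moreover have "\<bar>\<Sum>j\<in>{1..r}. Im (ln_Gamma (of_real (lam j) * crit t + mu j)) - (lam j * phase0 t + lam j * ln (lam j) * t)\<bar>
       \<le> (\<Sum>j\<in>{1..r}. Cg j * ln (\<bar>t\<bar> + 2))"
      by (rule order_trans[OF sum_abs]) (intro sum_mono Cg)
    moreover have "\<bar>m * Im (Ln (crit t))\<bar> \<le> m * pi / ln 2 * ln (\<bar>t\<bar> + 2)"
    proof -
      have "\<bar>Im (Ln (crit t))\<bar> \<le> pi"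
        using Im_Ln_le_pi[of "crit t"] mpi_less_Im_Ln[of "crit t"] crit_line_norm(3)[of t] by (auto simp: abs_le_iff)
      then have "\<bar>m * Im (Ln (crit t))\<bar> \<le> m * pi" by (simp add: abs_mult mult_left_mono)
      also have "m * pi = m * pi / ln 2 * ln 2" by simp
      also have "\<dots> \<le> m * pi / ln 2 * ln (\<bar>t\<bar> + 2)" by (intro mult_left_mono) auto
      finally show ?thesis .
    qed
    ultimately show ?thesis by (simp add: C_def distrib_right sum_distrib_right)
  qed
  have "\<bar>pi * (\<Sum>\<rho> | Xi \<rho> = 0 \<and> T1 < Im \<rho> \<and> Im \<rho> < T2. mult \<rho>) - (Psi T2 - Psi T1)\<bar>
       \<le> (Ch + C) * (ln (\<bar>T1\<bar> + 2) + ln (\<bar>T2\<bar> + 2))"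
    if T: "T1 < T2" "Xi (crit T1) \<noteq> 0" "Xi (crit T2) \<noteq> 0" for T1 T2
  proof -
    define N where "N = pi * (\<Sum>\<rho> | Xi \<rho> = 0 \<and> T1 < Im \<rho> \<and> Im \<rho> < T2. mult \<rho>)"
    define \<sigma> where "\<sigma> = (\<lambda>T \<delta>. Complex (1/2 + \<delta>) T)"
    have lim: "((\<lambda>\<delta>. Im (h (\<sigma> T2 \<delta>) + R (\<sigma> T2 \<delta>)) - Im (h (\<sigma> T1 \<delta>) + R (\<sigma> T1 \<delta>))) \<longlongrightarrow> N) (at_right 0)"
      unfolding N_def \<sigma>_def
    proof (rule zeros_between_eq_phase_difference[where H = "\<lambda>s. h s + R s", OF Xi_holomorphic Xi_reflect Xi_zero _ _ T])
      show "(\<lambda>s. h s + R s) holomorphic_on {s. Re s > 1/2}"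
        by (intro holomorphic_on_add h holomorphic_on_subset[OF R_hol]) auto
      fix s :: complex assume s: "Re s > 1/2"
      then have s0: "Re s > 0" "s \<noteq> 0" by auto
      have "exp (\<Sum>j\<in>{1..r}. ln_Gamma (of_real (lam j) * s + mu j)) = gam s"
        unfolding gam_def exp_sum[OF finite_atLeastAtMost]
        using gamma_arg s0 by (intro prod.cong refl exp_ln_Gamma_complex) auto
      moreover have "exp (of_nat m * Ln s) = s ^ m" unfolding exp_of_nat_mult exp_Ln[OF s0(2)] ..
      moreover have "exp (s * of_real (ln Q)) = of_real Q powr s"
        using Q_pos by (simp add: powr_def Ln_of_real)
      ultimately show "Xi s = exp (h s + R s)"
        using h(2)[OF s] Xi_right[OF s0(1)] by (simp add: R_def exp_add Xr_def)
    qed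
    have \<sigma>: "((\<lambda>\<delta>. \<sigma> T \<delta>) \<longlongrightarrow> crit T) (at_right 0)" for T
      unfolding \<sigma>_def by (rule tendsto_eq_intros refl)+ simp_all
    have "((\<lambda>\<delta>. R (\<sigma> T \<delta>)) \<longlongrightarrow> R (crit T)) (at_right 0)" for T
    proof -
      have "isCont R (crit T)"
        using continuous_on_eq_continuous_at[OF open_halfspace_Re_gt[of 0], of R] holomorphic_on_imp_continuous_on[OF R_hol]
        by auto
      then show ?thesis by (rule isCont_tendsto_compose[OF _ \<sigma>])
    qed
    then have limR: "((\<lambda>\<delta>. Im (R (\<sigma> T \<delta>))) \<longlongrightarrow> Im (R (crit T))) (at_right 0)" for T
      by (rule tendsto_Im)
    \<comment> \<open>What is left is the limit of the phase change of h alone.\<close>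
    define N' where "N' = N - (Im (R (crit T2)) - Im (R (crit T1)))"
    have "((\<lambda>\<delta>. \<bar>(Im (h (\<sigma> T2 \<delta>) + R (\<sigma> T2 \<delta>)) - Im (h (\<sigma> T1 \<delta>) + R (\<sigma> T1 \<delta>))) - (Im (R (\<sigma> T2 \<delta>)) - Im (R (\<sigma> T1 \<delta>)))\<bar>) \<longlongrightarrow> \<bar>N'\<bar>) (at_right 0)"
      unfolding N'_def by (intro tendsto_intros lim limR)
    then have "\<bar>N'\<bar> \<le> Ch * (ln (\<bar>T1\<bar> + 2) + ln (\<bar>T2\<bar> + 2))"
    proof (rule tendsto_upperbound)
      have "eventually (\<lambda>\<delta>::real. \<delta> \<in> {0<..<1}) (at_right 0)" by (rule eventually_at_right_real) simp
      then show "eventually (\<lambda>\<delta>. \<bar>(Im (h (\<sigma> T2 \<delta>) + R (\<sigma> T2 \<delta>)) - Im (h (\<sigma> T1 \<delta>) + R (\<sigma> T1 \<delta>))) - (Im (R (\<sigma> T2 \<delta>)) - Im (R (\<sigma> T1 \<delta>)))\<bar> \<le> Ch * (ln (\<bar>T1\<bar> + 2) + ln (\<bar>T2\<bar> + 2))) (at_right 0)"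
      proof eventually_elim
        case (elim \<delta>)
        then have "\<bar>Im (h (\<sigma> T1 \<delta>))\<bar> \<le> Ch * ln (\<bar>T1\<bar> + 2)" "\<bar>Im (h (\<sigma> T2 \<delta>))\<bar> \<le> Ch * ln (\<bar>T2\<bar> + 2)"
          using h(3)[of "\<sigma> T1 \<delta>"] h(3)[of "\<sigma> T2 \<delta>"] by (auto simp: \<sigma>_def)
        then show ?case by (simp add: distrib_left)
      qed
    qed simp
    then show ?thesis using R_bound[of T1] R_bound[of T2] unfolding N_def[symmetric] N'_def
      by (simp add: algebra_simps) linarith
  qed
  moreover have "Ch + C \<ge> 0"
  proof -
    have "0 \<le> Ch * ln 2" "0 \<le> C * ln 2" using h(3)[of 1] R_bound[of 0] by auto
    then show ?thesis using ln_gt_zero[of "2::real"] by (simp add: zero_le_mult_iff)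
  qed
  ultimately show ?thesis by blast
qed

end

section \<open>Zero counts up to an arbitrary height\<close>

lemma ln_3_le: "ln (\<bar>x\<bar> + 3) \<le> 2 * ln (\<bar>x\<bar> + 2)" for x :: real
proof -
  have "\<bar>x\<bar> + 3 \<le> (\<bar>x\<bar> + 2) ^ 2" by (simp add: power2_eq_square algebra_simps)
  then have "ln (\<bar>x\<bar> + 3) \<le> ln ((\<bar>x\<bar> + 2) ^ 2)" by (intro ln_mono) auto
  also have "\<dots> = 2 * ln (\<bar>x\<bar> + 2)" by (subst ln_realpow) auto
  finally show ?thesis .
qed

text \<open>The phase formula needs endpoints that are not heights of zeros. The point halfway to
  the next element of \<open>A\<close>, or to x + 1, is such an endpoint, and passing to it skips no
  element.\<close>

lemma finite_gap_above:
  fixes x :: real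
  assumes "finite A"
  shows "\<exists>y>x. y < x + 1 \<and> (\<forall>a\<in>A. \<not> (x < a \<and> a \<le> y))"
proof -
  define B where "B = insert (x + 1) {a \<in> A. x < a}"
  have B: "finite B" "B \<noteq> {}" using assms by (auto simp: B_def)
  have "x < Min B" using B by (subst Min_gr_iff) (auto simp: B_def)
  moreover have "Min B \<le> x + 1" using B by (intro Min_le) (auto simp: B_def)
  moreover have "Min B \<le> a" if "a \<in> A" "x < a" for a using that B by (intro Min_le) (auto simp: B_def)
  ultimately have "x < (x + Min B) / 2" "(x + Min B) / 2 < x + 1" "\<And>a. a \<in> A \<Longrightarrow> \<not> (x < a \<and> a \<le> (x + Min B) / 2)"
    by (auto simp: field_simps) (smt (verit) field_sum_of_halves)+
  then show ?thesis by blast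
qed

context selberg_GRH begin

lemma zero_gap_above: "\<exists>y>x. y < x + 1 \<and> (\<forall>\<rho>. Xi \<rho> = 0 \<longrightarrow> \<not> (x < Im \<rho> \<and> Im \<rho> \<le> y))"
proof -
  obtain y where y: "y > x" "y < x + 1" "\<forall>a\<in>Im ` {\<rho>. Xi \<rho> = 0 \<and> \<bar>Im \<rho>\<bar> \<le> \<bar>x\<bar> + 1}. \<not> (x < a \<and> a \<le> y)"
    using finite_gap_above[OF finite_imageI[OF finite_zeros], of x Im "\<bar>x\<bar> + 1"] by blast
  have "\<not> (x < Im \<rho> \<and> Im \<rho> \<le> y)" if "Xi \<rho> = 0" for \<rho>
  proof
    assume *: "x < Im \<rho> \<and> Im \<rho> \<le> y"
    then have "\<bar>Im \<rho>\<bar> \<le> \<bar>x\<bar> + 1" using y(2) by linarith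
    then show False using y(3) * that by blast
  qed
  then show ?thesis using y by blast
qed

lemma zero_gap_below: "\<exists>y<x. x - 1 < y \<and> (\<forall>\<rho>. Xi \<rho> = 0 \<longrightarrow> \<not> (y \<le> Im \<rho> \<and> Im \<rho> < x))"
proof -
  obtain y where y: "y > - x" "y < - x + 1" "\<forall>a\<in>(\<lambda>\<rho>. - Im \<rho>) ` {\<rho>. Xi \<rho> = 0 \<and> \<bar>Im \<rho>\<bar> \<le> \<bar>x\<bar> + 1}. \<not> (- x < a \<and> a \<le> y)"
    using finite_gap_above[OF finite_imageI[OF finite_zeros], of "- x" "\<lambda>\<rho>. - Im \<rho>" "\<bar>x\<bar> + 1"] by blast
  have "\<not> (- y \<le> Im \<rho> \<and> Im \<rho> < x)" if "Xi \<rho> = 0" for \<rho>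
  proof
    assume *: "- y \<le> Im \<rho> \<and> Im \<rho> < x"
    then have "\<bar>Im \<rho>\<bar> \<le> \<bar>x\<bar> + 1" using y(2) by linarith
    then have "- Im \<rho> \<in> (\<lambda>\<rho>. - Im \<rho>) ` {\<rho>. Xi \<rho> = 0 \<and> \<bar>Im \<rho>\<bar> \<le> \<bar>x\<bar> + 1}" using that by blast
    then have "\<not> (- x < - Im \<rho> \<and> - Im \<rho> \<le> y)" using y(3) by blast
    then show False using * by linarith
  qed
  moreover have "- y < x" "x - 1 < - y" using y by auto
  ultimately show ?thesis by blast
qed

definition Psi' :: "real \<Rightarrow> real" where
  "Psi' t = (degree_F r lam * ln (norm (crit t)) + cF) / 2"

lemma Psi_deriv: "(Psi has_real_derivative Psi' t) (at t)"
  unfolding Psi_def[abs_def] Psi'_def by (auto intro!: derivative_eq_intros phase0_deriv)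

lemma Psi_0 [simp]: "Psi 0 = 0" and Psi_minus: "Psi (- t) = - Psi t"
  by (simp_all add: Psi_def phase0_minus add_divide_distrib diff_divide_distrib)

lemma Psi'_bound: "\<exists>D\<ge>0. \<forall>t. \<bar>Psi' t\<bar> \<le> D * ln (\<bar>t\<bar> + 2)"
proof -
  define D where "D = \<bar>degree_F r lam\<bar> + \<bar>cF\<bar> / ln 2"
  have "\<bar>Psi' t\<bar> \<le> D * ln (\<bar>t\<bar> + 2)" for t
  proof -
    have "\<bar>Psi' t\<bar> \<le> (\<bar>degree_F r lam\<bar> * \<bar>ln (norm (crit t))\<bar> + \<bar>cF\<bar>) / 2"
      unfolding Psi'_def abs_divide by (simp add: abs_mult[symmetric])
    also have "\<dots> \<le> (\<bar>degree_F r lam\<bar> * (2 * ln (\<bar>t\<bar> + 2)) + \<bar>cF\<bar> / ln 2 * ln (\<bar>t\<bar> + 2)) / 2"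
    proof (intro divide_right_mono add_mono mult_left_mono abs_ln_crit_norm_le)
      have "\<bar>cF\<bar> = \<bar>cF\<bar> / ln 2 * ln 2" by simp
      also have "\<dots> \<le> \<bar>cF\<bar> / ln 2 * ln (\<bar>t\<bar> + 2)" by (intro mult_left_mono) auto
      finally show "\<bar>cF\<bar> \<le> \<bar>cF\<bar> / ln 2 * ln (\<bar>t\<bar> + 2)" .
    qed auto
    also have "\<dots> = \<bar>degree_F r lam\<bar> * ln (\<bar>t\<bar> + 2) + (\<bar>cF\<bar> / ln 2 * ln (\<bar>t\<bar> + 2)) / 2" by (simp add: field_simps)
    also have "\<dots> \<le> \<bar>degree_F r lam\<bar> * ln (\<bar>t\<bar> + 2) + \<bar>cF\<bar> / ln 2 * ln (\<bar>t\<bar> + 2)"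
    proof -
      have half: "u + y / 2 \<le> u + y" if "0 \<le> y" for u y :: real using that by simp
      show ?thesis by (rule half, intro mult_nonneg_nonneg) auto
    qed
    finally show ?thesis by (simp add: D_def distrib_right)
  qed
  moreover have "D \<ge> 0" by (simp add: D_def)
  ultimately show ?thesis by blast
qed

text \<open>Moving an endpoint by at most 1, as is done to avoid zeros, changes the smooth count by
  O(log) only.\<close>

lemma Psi_variation: "\<exists>D\<ge>0. \<forall>x y. \<bar>y - x\<bar> \<le> 1 \<longrightarrow> \<bar>Psi y - Psi x\<bar> \<le> D * ln (\<bar>x\<bar> + 2)"
proof -
  obtain D where D: "D \<ge> 0" "\<And>t. \<bar>Psi' t\<bar> \<le> D * ln (\<bar>t\<bar> + 2)" using Psi'_bound by blast
  have "\<bar>Psi y - Psi x\<bar> \<le> (2 * D) * ln (\<bar>x\<bar> + 2)" if xy: "\<bar>y - x\<bar> \<le> 1" for x y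
  proof -
    have "norm (Psi y - Psi x) \<le> (D * ln (\<bar>x\<bar> + 3)) * norm (y - x)"
    proof (rule field_differentiable_bound[of "closed_segment x y"])
      fix z assume z: "z \<in> closed_segment x y"
      show "(Psi has_field_derivative Psi' z) (at z within closed_segment x y)"
        using Psi_deriv by (rule has_field_derivative_at_within)
      have "\<bar>z\<bar> \<le> \<bar>x\<bar> + 1" using z xy by (auto simp: closed_segment_eq_real_ivl split: if_splits)
      then have "D * ln (\<bar>z\<bar> + 2) \<le> D * ln (\<bar>x\<bar> + 3)" using D by (intro mult_left_mono ln_mono) auto
      then show "norm (Psi' z) \<le> D * ln (\<bar>x\<bar> + 3)" using D(2)[of z] by simp
    qed auto
    also have "\<dots> \<le> (D * (2 * ln (\<bar>x\<bar> + 2))) * 1"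
      using xy D by (intro mult_mono mult_left_mono ln_3_le) auto
    finally show ?thesis by simp
  qed
  then show ?thesis using D(1) by (intro exI[of _ "2 * D"]) auto
qed

text \<open>Both counts start from one zero-free height \<open>\<epsilon>\<close> just above 0,
  which separates \<open>Zpos\<close> from \<open>Zneg\<close>, and end at a zero-free height within
  1 of t or - t. Each shift costs O(log), and the oddness of \<open>Psi\<close> gives both counts
  the same main term.\<close>

lemma zero_count:
  "\<exists>C. \<forall>t\<ge>0. \<bar>Npos t - Psi t / pi\<bar> \<le> C * ln (t + 2)"
  "\<exists>C. \<forall>t\<ge>0. \<bar>Nneg t - Psi t / pi\<bar> \<le> C * ln (t + 2)"
proof -
  obtain C where C: "C \<ge> 0" "\<And>T1 T2. T1 < T2 \<Longrightarrow> Xi (crit T1) \<noteq> 0 \<Longrightarrow> Xi (crit T2) \<noteq> 0 \<Longrightarrow>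
     \<bar>pi * (\<Sum>\<rho> | Xi \<rho> = 0 \<and> T1 < Im \<rho> \<and> Im \<rho> < T2. mult \<rho>) - (Psi T2 - Psi T1)\<bar>
       \<le> C * (ln (\<bar>T1\<bar> + 2) + ln (\<bar>T2\<bar> + 2))"
    using zeros_between by blast
  obtain D where D: "D \<ge> 0" "\<And>x y. \<bar>y - x\<bar> \<le> 1 \<Longrightarrow> \<bar>Psi y - Psi x\<bar> \<le> D * ln (\<bar>x\<bar> + 2)"
    using Psi_variation by blast
  obtain \<epsilon> where \<epsilon>: "0 < \<epsilon>" "\<epsilon> < 1" "\<And>\<rho>. Xi \<rho> = 0 \<Longrightarrow> \<not> (0 < Im \<rho> \<and> Im \<rho> \<le> \<epsilon>)"
    using zero_gap_above[of 0] by auto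
  have X\<epsilon>: "Xi (crit \<epsilon>) \<noteq> 0" using \<epsilon>(3)[of "crit \<epsilon>"] \<epsilon>(1) by auto
  have ln2: "ln 2 \<le> ln (t + 2)" if "t \<ge> 0" for t :: real using that by simp
  have ln3: "ln (u + 2) \<le> 2 * ln (t + 2)" if "0 \<le> u" "u \<le> t + 1" "t \<ge> 0" for u t :: real
  proof -
    have "ln (u + 2) \<le> ln (t + 3)" using that by (intro ln_mono) auto
    then show ?thesis using ln_3_le[of t] unfolding abs_of_nonneg[OF that(3)] by linarith
  qed
  have small: "\<bar>Psi t\<bar> \<le> D * ln (u + 2)" if "0 \<le> t" "t \<le> 1" "0 \<le> u" for t u
  proof -
    have "\<bar>Psi t\<bar> \<le> D * ln 2" using D(2)[of t 0] that by simp
    also have "\<dots> \<le> D * ln (u + 2)" using D(1) that by (intro mult_left_mono) auto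
    finally show ?thesis .
  qed
  have pi1: "\<bar>N - p / pi\<bar> \<le> b" if "\<bar>pi * N - p\<bar> \<le> b" for N p b :: real
  proof -
    have "N - p / pi = (pi * N - p) / pi" by (simp add: field_simps)
    then have "\<bar>N - p / pi\<bar> = \<bar>pi * N - p\<bar> / pi" by simp
    also have "\<dots> \<le> \<bar>pi * N - p\<bar>" using pi_gt3 by (simp add: divide_le_eq mult_le_cancel_left1)
    finally show ?thesis using that by simp
  qed
  have "\<bar>Npos t - Psi t / pi\<bar> \<le> (4 * C + 2 * D) * ln (t + 2)"
    if t: "t \<ge> 0" for t
  proof (rule pi1, cases "t < \<epsilon>")
    case True
    \<comment> \<open>Below \<open>\<epsilon>\<close> there is no interval for the phase formula; no
      zero is counted, and \<open>Psi t\<close> is itself within the error.\<close>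
    then have 0: "Npos t = 0"
      by (intro sum.neutral) (use \<epsilon>(3) in fastforce)
    have "0 \<le> (4 * C + D) * ln (t + 2)" using C D t by simp
    then show "\<bar>pi * Npos t - Psi t\<bar> \<le> (4 * C + 2 * D) * ln (t + 2)"
      unfolding 0 using small[of t t] t True \<epsilon> by (simp add: algebra_simps)
  next
    case False
    obtain t' where t': "t < t'" "t' < t + 1" "\<And>\<rho>. Xi \<rho> = 0 \<Longrightarrow> \<not> (t < Im \<rho> \<and> Im \<rho> \<le> t')"
      using zero_gap_above[of t] by blast
    have Xt': "Xi (crit t') \<noteq> 0" using t'(3)[of "crit t'"] t'(1) by auto
    have "{\<rho>. \<rho> \<in> Zpos \<and> Im \<rho> \<le> t} = {\<rho>. Xi \<rho> = 0 \<and> \<epsilon> < Im \<rho> \<and> Im \<rho> < t'}"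
      using \<epsilon> t' by fastforce
    moreover have "\<bar>pi * (\<Sum>\<rho> | Xi \<rho> = 0 \<and> \<epsilon> < Im \<rho> \<and> Im \<rho> < t'. mult \<rho>) - (Psi t' - Psi \<epsilon>)\<bar> \<le> C * (ln (\<epsilon> + 2) + ln (t' + 2))"
      using C(2)[of \<epsilon> t'] X\<epsilon> Xt' False t' \<epsilon>(1) by auto
    moreover have "C * (ln (\<epsilon> + 2) + ln (t' + 2)) \<le> C * (2 * ln (t + 2) + 2 * ln (t + 2))"
      using t t' \<epsilon> C by (intro mult_left_mono add_mono ln3) auto
    moreover have "\<bar>Psi t' - Psi t\<bar> \<le> D * ln (t + 2)" using D(2)[of t' t] t t' by simp
    moreover have "\<bar>Psi \<epsilon>\<bar> \<le> D * ln (t + 2)" using small[of \<epsilon> t] \<epsilon> t by simp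
    ultimately show "\<bar>pi * Npos t - Psi t\<bar> \<le> (4 * C + 2 * D) * ln (t + 2)"
      by (simp add: algebra_simps)
  qed
  then show "\<exists>C. \<forall>t\<ge>0. \<bar>Npos t - Psi t / pi\<bar> \<le> C * ln (t + 2)"
    by blast
  have "\<bar>Nneg t - Psi t / pi\<bar> \<le> (4 * C + 2 * D) * ln (t + 2)"
    if t: "t \<ge> 0" for t
  proof (rule pi1)
    obtain t' where t': "t' < - t" "- t - 1 < t'" "\<And>\<rho>. Xi \<rho> = 0 \<Longrightarrow> \<not> (t' \<le> Im \<rho> \<and> Im \<rho> < - t)"
      using zero_gap_below[of "- t"] by blast
    have Xt': "Xi (crit t') \<noteq> 0" using t'(3)[of "crit t'"] t'(1) by auto
    have "{\<rho>. \<rho> \<in> Zneg \<and> - Im \<rho> \<le> t} = {\<rho>. Xi \<rho> = 0 \<and> t' < Im \<rho> \<and> Im \<rho> < \<epsilon>}"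
      using \<epsilon> t' by fastforce
    moreover have "\<bar>pi * (\<Sum>\<rho> | Xi \<rho> = 0 \<and> t' < Im \<rho> \<and> Im \<rho> < \<epsilon>. mult \<rho>) - (Psi \<epsilon> - Psi t')\<bar> \<le> C * (ln (- t' + 2) + ln (\<epsilon> + 2))"
      using C(2)[of t' \<epsilon>] X\<epsilon> Xt' t t' \<epsilon>(1) by auto
    moreover have "C * (ln (- t' + 2) + ln (\<epsilon> + 2)) \<le> C * (2 * ln (t + 2) + 2 * ln (t + 2))"
      using t t' \<epsilon> C by (intro mult_left_mono add_mono ln3) auto
    moreover have "\<bar>Psi t' - Psi (- t)\<bar> \<le> D * ln (t + 2)" using D(2)[of t' "- t"] t t' by simp
    moreover have "\<bar>Psi \<epsilon>\<bar> \<le> D * ln (t + 2)" using small[of \<epsilon> t] \<epsilon> t by simp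
    ultimately show "\<bar>pi * Nneg t - Psi t\<bar> \<le> (4 * C + 2 * D) * ln (t + 2)"
      unfolding Psi_minus by (simp add: algebra_simps)
  qed
  then show "\<exists>C. \<forall>t\<ge>0. \<bar>Nneg t - Psi t / pi\<bar> \<le> C * ln (t + 2)"
    by blast
qed

end

section \<open>The Li coefficients\<close>

text \<open>The inverse of a number of modulus one is its conjugate, so negative powers become
  conjugated positive ones.\<close>

lemma crit_w_power_int:
  assumes "Re \<rho> = 1/2"
  shows "(1 - 1 / \<rho>) powi (- int n) = cnj (crit_w (Im \<rho>)) ^ n"
proof -
  have "\<rho> = crit (Im \<rho>)" using assms by (simp add: complex_eq_iff)
  then have "1 - 1 / \<rho> = crit_w (Im \<rho>)" by (simp add: crit_w_def)
  moreover have "inverse (crit_w (Im \<rho>)) = cnj (crit_w (Im \<rho>))"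
    by (rule inverse_unique) (simp add: complex_norm_square[symmetric])
  ultimately show ?thesis by (simp add: power_int_minus power_inverse[symmetric])
qed

text \<open>The facts about the summands that partial summation asks for. The bound n / t comes from
  |1 - w^n| <= n |1 - w| = n / |s| on the unit circle.\<close>

lemma crit_f_properties:
  fixes n :: nat and t :: real
  shows "((\<lambda>t. 1 - crit_w t ^ n) has_vector_derivative (\<i> * of_nat n * crit_w t ^ n / of_real (1/4 + t ^ 2))) (at t)"
    "norm (1 - crit_w t ^ n) \<le> 2" "t > 0 \<Longrightarrow> norm (1 - crit_w t ^ n) \<le> n / t"
    "t > 0 \<Longrightarrow> norm (\<i> * of_nat n * crit_w t ^ n / of_real (1/4 + t ^ 2)) \<le> n / t ^ 2"
proof -
  have "((\<lambda>t. 1 - crit_w t ^ n) has_vector_derivative (0 - (- \<i> * of_nat n * crit_w t ^ n / of_real (1/4 + t ^ 2)))) (at t)"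
    by (intro has_vector_derivative_diff has_vector_derivative_const crit_w_power_deriv)
  then show "((\<lambda>t. 1 - crit_w t ^ n) has_vector_derivative (\<i> * of_nat n * crit_w t ^ n / of_real (1/4 + t ^ 2))) (at t)"
    by simp
  show "norm (1 - crit_w t ^ n) \<le> 2"
    using norm_triangle_ineq4[of 1 "crit_w t ^ n"] by (simp add: norm_power)
  show "norm (1 - crit_w t ^ n) \<le> n / t" if t: "t > 0"
  proof -
    have "norm (1 ^ n - crit_w t ^ n) \<le> n * norm (1 - crit_w t)" by (intro norm_power_diff) auto
    also have "norm (1 - crit_w t) = 1 / norm (crit t)" by (simp add: crit_w_def norm_divide)
    also have "\<dots> \<le> 1 / t" using t abs_Im_le_cmod[of "crit t"] by (simp add: frac_le)
    finally show ?thesis by (simp add: mult_left_mono)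
  qed
  show "norm (\<i> * of_nat n * crit_w t ^ n / of_real (1/4 + t ^ 2)) \<le> n / t ^ 2" if t: "t > 0"
  proof -
    have "norm (\<i> * of_nat n * crit_w t ^ n / of_real (1/4 + t ^ 2)) = n / (1/4 + t ^ 2)"
      using crit_line_norm(4)[of t] by (simp only: norm_divide norm_mult norm_power norm_crit_w norm_of_real) simp
    also have "\<dots> \<le> n / t ^ 2" using t by (intro divide_left_mono) (auto intro!: mult_pos_pos add_pos_pos)
    finally show ?thesis .
  qed
qed

text \<open>The bounds for the Euler constant are in terms of ln (n + 1). Passing to ln n adds an
  error of the opposite sign to the one already present, so 1 / n covers both.\<close>

lemma harm_minus_ln_bounds:
  assumes "n \<ge> 1"
  shows "\<bar>harm n - ln (real n) - euler_mascheroni\<bar> \<le> 1 / real n"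
proof -
  define t where "t = harm n - ln (real (Suc n))"
  have *: "t + inverse (of_nat (2 * (n + 1))) \<le> euler_mascheroni" "euler_mascheroni \<le> t + inverse (of_nat (2 * n))"
    using euler_mascheroni_bounds[OF assms] unfolding t_def atLeastAtMost_iff by blast+
  have "inverse (of_nat (2 * (n + 1))) \<ge> (0::real)" "inverse (of_nat (2 * n)) \<le> 1 / real n"
    using assms by (auto simp: field_simps)
  moreover have "ln (real (Suc n)) - ln (real n) \<le> 1 / real n"
  proof -
    have "ln (real (Suc n)) - ln (real n) = ln (real (Suc n) / real n)"
      using assms by (subst ln_div) auto
    also have "real (Suc n) / real n = 1 + 1 / real n" using assms by (simp add: field_simps)
    also have "ln (1 + 1 / real n) \<le> 1 / real n" by (rule ln_add_one_self_le_self) simp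
    finally show ?thesis .
  qed
  moreover have "ln (real n) \<le> ln (real (Suc n))" using assms by (intro ln_mono) auto
  ultimately show ?thesis using * unfolding t_def by linarith
qed

context selberg_GRH begin

text \<open>Below the real axis w is the conjugate of its value at the mirrored height. Both halves
  thus become sums over nonnegative heights of one function and of its conjugate.\<close>

lemma li_partial_split:
  assumes "T \<ge> 0"
  shows "li_partial Xi (int n) T =
    (\<Sum>\<rho> | \<rho> \<in> Zpos \<and> Im \<rho> \<le> T. of_real (mult \<rho>) * cnj (1 - crit_w (Im \<rho>) ^ n))
  + (\<Sum>\<rho> | \<rho> \<in> Zneg \<and> - Im \<rho> \<le> T. of_real (mult \<rho>) * (1 - crit_w (- Im \<rho>) ^ n))"
    (is "_ = sum ?f ?A + sum ?g ?B")
proof -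
  define h where "h = (\<lambda>\<rho>. of_int (zorder Xi \<rho>) * (1 - (1 - 1 / \<rho>) powi (- int n)))"
  have fin: "finite ?A" "finite ?B"
    by (rule finite_subset[OF _ finite_zeros[of T]]; use assms in auto)+
  have "{\<rho>. Xi \<rho> = 0 \<and> \<bar>Im \<rho>\<bar> \<le> T} = ?A \<union> ?B" using assms by auto
  then have "li_partial Xi (int n) T = sum h (?A \<union> ?B)" by (simp only: li_partial_def h_def)
  also have "\<dots> = sum h ?A + sum h ?B" by (intro sum.union_disjoint fin) auto
  also have "sum h ?A = sum ?f ?A"
  proof (rule sum.cong[OF refl])
    fix \<rho> assume "\<rho> \<in> ?A"
    then have "Re \<rho> = 1/2" using Xi_zero by blast
    then show "h \<rho> = ?f \<rho>" by (simp add: h_def crit_w_power_int)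
  qed
  also have "sum h ?B = sum ?g ?B"
  proof (rule sum.cong[OF refl])
    fix \<rho> assume "\<rho> \<in> ?B"
    then have "Re \<rho> = 1/2" using Xi_zero by blast
    then show "h \<rho> = ?g \<rho>" by (simp add: h_def crit_w_power_int crit_w_minus)
  qed
  finally show ?thesis .
qed

lemma Psi'_isCont: "isCont Psi' t"
  unfolding Psi'_def using crit_line_norm(3)[of t]
  by (intro continuous_intros isCont_vertical_line) auto

definition main_term :: "nat \<Rightarrow> real" where
  "main_term n = (degree_F r lam * (n * harm n - n) + cF * n) / 2"

abbreviation Ipos :: "nat \<Rightarrow> real \<Rightarrow> complex" where
  "Ipos n T \<equiv> integral {0..T} (\<lambda>t. cnj (1 - crit_w t ^ n) * of_real (Psi' t / pi))"

abbreviation Ineg :: "nat \<Rightarrow> real \<Rightarrow> complex" where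
  "Ineg n T \<equiv> integral {0..T} (\<lambda>t. (1 - crit_w t ^ n) * of_real (Psi' t / pi))"

text \<open>A number and its conjugate add up to twice the real part, so the imaginary parts of the
  two integrals cancel. What remains is even in t and combines the symmetric integrals against 1 and
  ln |s|.\<close>

lemma main_integral:
  "((\<lambda>T. Ipos n T
       + Ineg n T) \<longlongrightarrow> of_real (main_term n)) at_top"
proof -
  define q where "q = (\<lambda>t. (1 - Re (crit_w t ^ n)) * (Psi' t / pi))"
  have cq: "isCont q t" for t
    unfolding q_def by (intro continuous_intros isCont_crit_w_power Psi'_isCont) simp
  then have qint: "q integrable_on {u..v}" for u v
    by (intro integrable_continuous_interval continuous_at_imp_continuous_on) auto
  have q_even: "q (- t) = q t" for t
  proof -
    have "norm (crit (- t)) = norm (crit t)" by (simp add: cmod_def)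
    moreover have "Re (crit_w (- t) ^ n) = Re (cnj (crit_w t ^ n))" by (simp add: crit_w_minus)
    then have "Re (crit_w (- t) ^ n) = Re (crit_w t ^ n)" by (simp only: cnj.simps(1))
    ultimately show ?thesis by (simp add: q_def Psi'_def)
  qed
  have eq: "Ipos n T
       + Ineg n T = of_real (integral {-T..T} q)" if T: "T \<ge> 0" for T
  proof -
    have cw: "isCont (\<lambda>t. crit_w t ^ n) t" for t by (intro continuous_intros)
    have int: "(\<lambda>t. (1 - crit_w t ^ n) * of_real (Psi' t / pi)) integrable_on {0..T}"
              "(\<lambda>t. cnj (1 - crit_w t ^ n) * of_real (Psi' t / pi)) integrable_on {0..T}"
      by (intro integrable_continuous_interval continuous_at_imp_continuous_on ballI continuous_intros isCont_cnj cw Psi'_isCont; simp)+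
    have "Ipos n T
       + Ineg n T
      = integral {0..T} (\<lambda>t. cnj (1 - crit_w t ^ n) * of_real (Psi' t / pi) + (1 - crit_w t ^ n) * of_real (Psi' t / pi))"
      by (rule Henstock_Kurzweil_Integration.integral_add[symmetric]) (use int in auto)
    also have "(\<lambda>t. cnj (1 - crit_w t ^ n) * of_real (Psi' t / pi) + (1 - crit_w t ^ n) * of_real (Psi' t / pi)) = (\<lambda>t. complex_of_real (2 * q t))"
    proof
      fix t
      define z where "z = crit_w t ^ n"
      show "cnj (1 - crit_w t ^ n) * of_real (Psi' t / pi) + (1 - crit_w t ^ n) * of_real (Psi' t / pi) = complex_of_real (2 * q t)"
        unfolding q_def z_def[symmetric] by (simp add: complex_eq_iff algebra_simps)
    qed
    also have "integral {0..T} (\<lambda>t. complex_of_real (2 * q t)) = of_real (integral {0..T} (\<lambda>t. 2 * q t))"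
      by (rule integral_unique, rule has_integral_of_real, rule integrable_integral) (intro integrable_on_mult_right qint)
    also have "integral {0..T} (\<lambda>t. 2 * q t) = integral {-T..0} q + integral {0..T} q"
    proof -
      have "integral {0..T} q = integral {-T..0} (\<lambda>t. q (- t))"
        using Henstock_Kurzweil_Integration.integral_reflect_real[of T 0 q] by simp
      also have "\<dots> = integral {-T..0} q" by (simp add: q_even)
      finally show ?thesis by (subst integral_mult_right) simp
    qed
    also have "integral {-T..0} q + integral {0..T} q = integral {-T..T} q"
      using T by (intro Henstock_Kurzweil_Integration.integral_combine qint) auto
    finally show ?thesis by simp
  qed
  have qeq: "integral {-T..T} q = degree_F r lam / (2 * pi) * integral {-T..T} (\<lambda>t. (1 - Re (crit_w t ^ n)) * ln (norm (crit t)))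
      + cF / (2 * pi) * integral {-T..T} (\<lambda>t. 1 - Re (crit_w t ^ n))" for T
  proof (rule integral_unique)
    have cont: "isCont (\<lambda>t. ln (norm (crit t))) t" for t
      using crit_line_norm(3)[of t] by (intro continuous_intros isCont_vertical_line) auto
    have i1: "(\<lambda>t. (1 - Re (crit_w t ^ n)) * ln (norm (crit t))) integrable_on {-T..T}"
      by (intro integrable_continuous_interval continuous_at_imp_continuous_on ballI continuous_intros isCont_crit_w_power cont)
    have i2: "(\<lambda>t. 1 - Re (crit_w t ^ n)) integrable_on {-T..T}"
      by (intro integrable_continuous_interval continuous_at_imp_continuous_on ballI continuous_intros isCont_crit_w_power)
    have "((\<lambda>t. degree_F r lam / (2 * pi) * ((1 - Re (crit_w t ^ n)) * ln (norm (crit t))) + cF / (2 * pi) * (1 - Re (crit_w t ^ n)))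
      has_integral (degree_F r lam / (2 * pi) * integral {-T..T} (\<lambda>t. (1 - Re (crit_w t ^ n)) * ln (norm (crit t)))
      + cF / (2 * pi) * integral {-T..T} (\<lambda>t. 1 - Re (crit_w t ^ n)))) {-T..T}"
      by (intro has_integral_add has_integral_mult_right integrable_integral i1 i2)
    moreover have "degree_F r lam / (2 * pi) * ((1 - Re (crit_w t ^ n)) * ln (norm (crit t))) + cF / (2 * pi) * (1 - Re (crit_w t ^ n)) = q t" for t
      by (simp add: q_def Psi'_def field_simps)
    ultimately show "(q has_integral (degree_F r lam / (2 * pi) * integral {-T..T} (\<lambda>t. (1 - Re (crit_w t ^ n)) * ln (norm (crit t)))
      + cF / (2 * pi) * integral {-T..T} (\<lambda>t. 1 - Re (crit_w t ^ n)))) {-T..T}"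
      by simp
  qed
  have "((\<lambda>T. integral {-T..T} q) \<longlongrightarrow> degree_F r lam / (2 * pi) * (pi * (n * harm n - n)) + cF / (2 * pi) * (pi * n)) at_top"
    unfolding qeq by (intro tendsto_intros crit_integral_ln crit_integral_const)
  also have "degree_F r lam / (2 * pi) * (pi * (n * harm n - n)) + cF / (2 * pi) * (pi * n) = main_term n"
    by (simp add: main_term_def field_simps)
  finally have "((\<lambda>T. complex_of_real (integral {-T..T} q)) \<longlongrightarrow> of_real (main_term n)) at_top"
    by (rule tendsto_of_real)
  then show ?thesis
    by (rule Lim_transform_eventually) (rule eventually_mono[OF eventually_ge_at_top[of 0]], simp only: eq)
qed

abbreviation Spos :: "nat \<Rightarrow> real \<Rightarrow> complex" where
  "Spos n T \<equiv> \<Sum>\<rho> | \<rho> \<in> Zpos \<and> Im \<rho> \<le> T. of_real (mult \<rho>) * cnj (1 - crit_w (Im \<rho>) ^ n)"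

abbreviation Sneg :: "nat \<Rightarrow> real \<Rightarrow> complex" where
  "Sneg n T \<equiv> \<Sum>\<rho> | \<rho> \<in> Zneg \<and> - Im \<rho> \<le> T. of_real (mult \<rho>) * (1 - crit_w (- Im \<rho>) ^ n)"

text \<open>Each side has a limit for sum minus integral; adding the joint limit of the two
  integrals gives the limit of the truncated sums, although neither side is known to converge by
  itself.\<close>

lemma li_limit:
  "\<exists>K. \<forall>n\<ge>1. \<exists>e. (li_partial Xi (int n) \<longlongrightarrow> of_real (main_term n) + e) at_top \<and> norm e \<le> K * (sqrt n * (ln (sqrt n + 2) + 1))"
proof -
  obtain C1 where C1: "\<And>t. t \<ge> 0 \<Longrightarrow> \<bar>Npos t - Psi t / pi\<bar> \<le> C1 * ln (t + 2)"
    using zero_count(1) by blast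
  obtain C2 where C2: "\<And>t. t \<ge> 0 \<Longrightarrow> \<bar>Nneg t - Psi t / pi\<bar> \<le> C2 * ln (t + 2)"
    using zero_count(2) by blast
  obtain D where D: "D \<ge> 0" "\<And>t. \<bar>Psi' t\<bar> \<le> D * ln (\<bar>t\<bar> + 2)" using Psi'_bound by blast
  have M: "((\<lambda>t. Psi t / pi) has_real_derivative Psi' t / pi) (at t)" for t by (intro DERIV_cdivide Psi_deriv)
  have M': "continuous_on UNIV (\<lambda>t. Psi' t / pi)"
    by (intro continuous_at_imp_continuous_on ballI continuous_intros Psi'_isCont) simp
  have M'D: "\<bar>Psi' t / pi\<bar> \<le> D * ln (t + 2)" if "t \<ge> 0" for t
  proof -
    have "\<bar>Psi' t\<bar> / pi \<le> \<bar>Psi' t\<bar>" using pi_gt3 by (simp add: divide_le_eq mult_le_cancel_left1)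
    then show ?thesis using D(2)[of t] that by simp
  qed
  have fin1: "finite {\<rho> \<in> Zpos. Im \<rho> \<le> T}" and fin2: "finite {\<rho> \<in> Zneg. - Im \<rho> \<le> T}" for T
    by (rule finite_subset[OF _ finite_zeros[of T]]; force)+
  have z: "mult \<rho> \<ge> 0" for \<rho> using zorder_Xi_nonneg by simp
  have M0: "Psi 0 / pi = 0" by simp
  obtain K1 where K1: "\<And>n. n \<ge> 1 \<Longrightarrow> \<exists>e. ((\<lambda>T. Spos n T
            - Ipos n T) \<longlongrightarrow> e) at_top
          \<and> norm e \<le> K1 * (sqrt n * (ln (sqrt n + 2) + 1))"
  proof -
    have f': "((\<lambda>t. cnj (1 - crit_w t ^ n)) has_vector_derivative cnj (\<i> * of_nat n * crit_w t ^ n / of_real (1/4 + t ^ 2))) (at t)" for n t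
      by (intro has_vector_derivative_cnj crit_f_properties)
    have p: "norm (cnj (1 - crit_w t ^ n)) \<le> 2" "t > 0 \<Longrightarrow> norm (cnj (1 - crit_w t ^ n)) \<le> n / t"
      "t > 0 \<Longrightarrow> norm (cnj (\<i> * of_nat n * crit_w t ^ n / of_real (1/4 + t ^ 2))) \<le> n / t ^ 2" for n :: nat and t
      unfolding complex_mod_cnj by (fact crit_f_properties)+
    show ?thesis using partial_summation[OF fin1 z C1 M M' M0 M'D f' p] that by blast
  qed
  obtain K2 where K2: "\<And>n. n \<ge> 1 \<Longrightarrow> \<exists>e. ((\<lambda>T. Sneg n T
            - Ineg n T) \<longlongrightarrow> e) at_top
          \<and> norm e \<le> K2 * (sqrt n * (ln (sqrt n + 2) + 1))"
    using partial_summation[OF fin2 z C2 M M' M0 M'D crit_f_properties] by blast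
  have "\<exists>e. (li_partial Xi (int n) \<longlongrightarrow> of_real (main_term n) + e) at_top \<and> norm e \<le> (K1 + K2) * (sqrt n * (ln (sqrt n + 2) + 1))"
    if n: "n \<ge> 1" for n
  proof -
    obtain e1 e2 where e: "((\<lambda>T. Spos n T
            - Ipos n T) \<longlongrightarrow> e1) at_top"
      "((\<lambda>T. Sneg n T
            - Ineg n T) \<longlongrightarrow> e2) at_top"
      and ne: "norm e1 \<le> K1 * (sqrt n * (ln (sqrt n + 2) + 1))" "norm e2 \<le> K2 * (sqrt n * (ln (sqrt n + 2) + 1))"
      using K1[OF n] K2[OF n] by blast
    have "(li_partial Xi (int n) \<longlongrightarrow> of_real (main_term n) + (e1 + e2)) at_top"
      using tendsto_add[OF main_integral tendsto_add[OF e]]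
      by (rule Lim_transform_eventually)
        (rule eventually_mono[OF eventually_ge_at_top[of 0]], subst li_partial_split, simp_all add: algebra_simps)
    moreover have "norm (e1 + e2) \<le> (K1 + K2) * (sqrt n * (ln (sqrt n + 2) + 1))"
      using ne norm_triangle_ineq[of e1 e2] by (simp add: distrib_right)
    ultimately show ?thesis by blast
  qed
  then show ?thesis by blast
qed

text \<open>As n |H_n - ln n - gamma| <= 1, replacing the harmonic number costs a bounded
  amount.\<close>

lemma main_term_approx:
  assumes "n \<ge> 1"
  shows "\<bar>main_term n - (degree_F r lam / 2 * n * ln n + (degree_F r lam / 2 * (euler_mascheroni - 1) + 1/2 * cF) * n)\<bar> \<le> \<bar>degree_F r lam\<bar>"
proof -
  have "main_term n - (degree_F r lam / 2 * n * ln n + (degree_F r lam / 2 * (euler_mascheroni - 1) + 1/2 * cF) * n)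
    = degree_F r lam / 2 * (n * (harm n - ln n - euler_mascheroni))"
    by (simp add: main_term_def field_simps)
  also have "\<bar>\<dots>\<bar> = \<bar>degree_F r lam\<bar> / 2 * (n * \<bar>harm n - ln n - euler_mascheroni\<bar>)" by (simp add: abs_mult)
  also have "\<dots> \<le> \<bar>degree_F r lam\<bar> / 2 * (n * (1 / n))"
    by (intro mult_left_mono harm_minus_ln_bounds assms) auto
  also have "\<dots> \<le> \<bar>degree_F r lam\<bar>" using assms by simp
  finally show ?thesis .
qed

end

theorem theorem4p1:
  fixes a :: "nat \<Rightarrow> complex" and F :: "complex \<Rightarrow> complex" and Q :: real and r :: nat
    and lam :: "nat \<Rightarrow> real" and mu :: "nat \<Rightarrow> complex" and \<omega> :: complex
  assumes S: "selberg_class a F Q r lam mu \<omega>"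
    and GRH: "\<forall>\<rho>. xi_F F Q r lam mu \<rho> = 0 \<longrightarrow> Re \<rho> = 1/2"
  shows "\<exists>L :: nat \<Rightarrow> complex.
           (\<forall>n. (li_partial (xi_F F Q r lam mu) (int n) \<longlongrightarrow> L n) at_top) \<and>
           (\<lambda>n. L n - of_real (degree_F r lam / 2 * real n * ln (real n)
                   + (degree_F r lam / 2 * (euler_mascheroni - 1)
                      + 1/2 * ln ((\<Prod>j\<in>{1..r}. lam j powr (2 * lam j)) * Q^2)) * real n))
             \<in> O(\<lambda>n. of_real (sqrt (real n) * ln (real n)))"
proof -
  interpret selberg_GRH a F Q r lam mu \<omega> by unfold_locales (fact S, fact GRH)
  have xi: "xi_F F Q r lam mu = Xi" by (simp add: fun_eq_iff xi_eq)
  obtain K where K: "\<And>n. n \<ge> 1 \<Longrightarrow> \<exists>e. (li_partial Xi (int n) \<longlongrightarrow> of_real (main_term n) + e) at_top \<and> norm e \<le> K * (sqrt n * (ln (sqrt n + 2) + 1))"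
    using li_limit by blast
  then obtain e where e: "\<And>n. n \<ge> 1 \<Longrightarrow> (li_partial Xi (int n) \<longlongrightarrow> of_real (main_term n) + e n) at_top"
      "\<And>n. n \<ge> 1 \<Longrightarrow> norm (e n) \<le> K * (sqrt n * (ln (sqrt n + 2) + 1))"
    by metis
  \<comment> \<open>For n = 0 every summand is 1 - 1 = 0, so the limit is 0; the error term
    \<open>e\<close> is provided only for n >= 1.\<close>
  define L where "L = (\<lambda>n::nat. if n = 0 then 0 else of_real (main_term n) + e n)"
  define B where "B = (\<lambda>n::nat. degree_F r lam / 2 * real n * ln (real n)
                   + (degree_F r lam / 2 * (euler_mascheroni - 1) + 1/2 * cF) * real n)"
  have "(li_partial Xi (int n) \<longlongrightarrow> L n) at_top" for n
  proof (cases "n = 0")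
    case True
    have "li_partial Xi (int 0) = (\<lambda>T. 0)" by (simp add: fun_eq_iff li_partial_def)
    then show ?thesis using True by (simp add: L_def)
  qed (use e(1)[of n] in \<open>simp add: L_def\<close>)
  moreover have "(\<lambda>n. L n - of_real (B n)) \<in> O(\<lambda>n. complex_of_real (sqrt (real n) * ln (real n)))"
  proof -
    \<comment> \<open>The two sources of error are partial summation and the harmonic number. The
      sign of \<open>K\<close> is not recorded, hence its absolute value.\<close>
    define g where "g = (\<lambda>n::nat. \<bar>K\<bar> * (sqrt n * (ln (sqrt n + 2) + 1)) + \<bar>degree_F r lam\<bar>)"
    have "(\<lambda>n. norm (L n - of_real (B n))) \<in> O(g)"
    proof (rule bigoI[of _ 1])
      show "eventually (\<lambda>n. norm (norm (L n - of_real (B n))) \<le> 1 * norm (g n)) sequentially"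
        using eventually_ge_at_top[of 1]
      proof eventually_elim
        case (elim n)
        have "0 \<le> sqrt n * (ln (sqrt n + 2) + 1)" by (intro mult_nonneg_nonneg add_nonneg_nonneg ln_ge_zero) auto
        then have "norm (e n) \<le> \<bar>K\<bar> * (sqrt n * (ln (sqrt n + 2) + 1))"
          using e(2)[OF elim] by (meson abs_ge_self mult_right_mono order_trans)
        moreover have "\<bar>main_term n - B n\<bar> \<le> \<bar>degree_F r lam\<bar>"
          unfolding B_def using main_term_approx[OF elim] by simp
        moreover have "L n - of_real (B n) = of_real (main_term n - B n) + e n"
          using elim by (simp add: L_def)
        ultimately have "norm (L n - of_real (B n)) \<le> \<bar>degree_F r lam\<bar> + \<bar>K\<bar> * (sqrt n * (ln (sqrt n + 2) + 1))"
          by (simp only: norm_triangle_mono norm_of_real)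
        then have "norm (L n - of_real (B n)) \<le> g n" by (simp only: g_def add.commute)
        then show ?case by (simp add: order_trans[OF _ abs_ge_self])
      qed
    qed
    also have "g \<in> O(\<lambda>n. sqrt (real n) * ln (real n))"
    proof -
      have f: "(\<lambda>n. sqrt (real n) * (ln (sqrt (real n) + 2) + 1)) \<in> O(\<lambda>n. sqrt (real n) * ln (real n))"
        by real_asymp
      have "(\<lambda>n. 1) \<in> O(\<lambda>n. sqrt (real n) * ln (real n))" by real_asymp
      from landau_o.big.mult[OF bigo_const[of "\<bar>degree_F r lam\<bar>" sequentially] this]
        landau_o.big.mult[OF bigo_const[of "\<bar>K\<bar>" sequentially] f]
      show ?thesis unfolding g_def by (intro sum_in_bigo(1)) simp_all
    qed
    finally have "(\<lambda>n. norm (L n - of_real (B n))) \<in> O(\<lambda>n. sqrt (real n) * ln (real n))" .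
    then show ?thesis by (simp add: bigo_def norm_mult abs_mult)
  qed
  ultimately show ?thesis unfolding xi B_def cF_def by blast
qed

end
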